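(* Let $(\mathbb I,\tau)$ be a quasi-split Satake diagram. There is an algebra isomorphism $\widetilde\Phi^\imath:\widetilde{\mathbf B}^\imath_\tau\to\widetilde{\mathbf U}^\imath$ given by $$\vartheta_i\mapsto B_i,\qquad h_i\mapsto\widetilde k_{\tau i},\qquad i\in\mathbb I.$$ Moreover, $\widetilde\Phi^\imath(\widehat{\mathbf B}^\imath_\tau)=\widehat{\mathbf U}^\imath$.
   Context: Let $C=(c_{ij})_{i,j\in\mathbb I}$ be a symmetrizable generalized Cartan matrix, $\mathbb I$ finite, with symmetrizer $D=\mathrm{diag}(d_i)$, $d_i\in\mathbb Z_{>0}$. $v$ is an indeterminate, $v_i=v^{d_i}$, the base field is $\mathbb Q(v^{1/2})$, $\left[{m\atop r}\right]_{v_i}$ are the symmetric quantum binomials. A quasi-split Satake diagram $(\mathbb I,\tau)$ is given by a permutation $\tau$ of $\mathbb I$ with $\tau^2=\mathrm{Id}$, $c_{\tau i,\tau j}=c_{ij}$, $d_{\tau i}=d_i$. $\widehat{\mathbf U}$ is the algebra generated by $E_i,F_i,K_i,K_i'$ $(i\in\mathbb I)$ with relations: all $K_i,K_j'$ commute; $[E_i,F_j]=\delta_{ij}(v_i^{-1}-v_i)(K_i-K_i')$; $K_iE_j=v_i^{c_{ij}}E_jK_i$, $K_iF_j=v_i^{-c_{ij}}F_jK_i$, $K_i'E_j=v_i^{-c_{ij}}E_jK_i'$, $K_i'F_j=v_i^{c_{ij}}F_jK_i'$; and for $i\neq j$, $\sum_{r=0}^{1-c_{ij}}(-1)^r\left[{1-c_{ij}\atop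 r}\right]_{v_i}X_i^rX_jX_i^{1-c_{ij}-r}=0$ for $X=E$ and $X=F$. $\widetilde{\mathbf U}\supset\widehat{\mathbf U}$ is the algebra with the same generators and relations but with all $K_i,K_i'$ invertible. $B_i=F_i+E_{\tau i}K_i'$, $\widetilde k_i=K_iK_{\tau i}'$. $\widehat{\mathbf U}^\imath$ is the subalgebra of $\widehat{\mathbf U}$ generated by all $B_i,\widetilde k_i$; $\widetilde{\mathbf U}^\imath$ is the subalgebra of $\widetilde{\mathbf U}$ generated by all $B_i,\widetilde k_i^{\pm1}$. $\widetilde{\mathbf B}$ is the algebra generated by $\vartheta_i,h_i^{\pm1}$ with relations $h_ih_j=h_jh_i$, $h_i\vartheta_j=v_i^{c_{ij}}\vartheta_jh_i$, and Serre relations $\sum_{r=0}^{1-c_{ij}}(-1)^r\left[{1-c_{ij}\atop r}\right]_{v_i}\vartheta_i^r\vartheta_j\vartheta_i^{1-c_{ij}-r}=0$ $(i\ne j)$; $\widehat{\mathbf B}\subset\widetilde{\mathbf B}$ is the subalgebra generated by all $\vartheta_i,h_i$. $\widetilde{\mathbf B}$ is a Hopf algebra with $\Delta(\vartheta_i)=\vartheta_i\otimes1+h_i\otimes\vartheta_i$, $\Delta(h_i)=h_i\otimes h_i$, $\varepsilon(\vartheta_i)=0$, $\varepsilon(h_i)=1$. It carries the Hopf pairing $\varphi$ ($\varphi(a,bb')=\varphi(\Delta a,b\otimes b')$, $\varphi(aa',b)=\varphi(a\otimes a',\Delta b)$, $\varphi(a,1)=\varepsilon(a)=\varphi(1,a)$)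 determined by $\varphi(\vartheta_i,\vartheta_j)=\delta_{ij}(v_i-v_i^{-1})$, $\varphi(h_i,h_j)=v_i^{c_{ij}}$, $\varphi(\vartheta_i,h_j)=0$. $\tau$ acts on $\widetilde{\mathbf B}$ by $\vartheta_i\mapsto\vartheta_{\tau i}$, $h_i\mapsto h_{\tau i}$. $\widetilde{\mathbf B}^\imath_\tau$ is the vector space $\widetilde{\mathbf B}$ with the associative product $a\ast b=\sum\varphi(\tau(b_{(2)}),a_{(1)})\,a_{(2)}b_{(1)}$ and unit $1$; $\widehat{\mathbf B}^\imath_\tau$ is its subalgebra with underlying space $\widehat{\mathbf B}$. *)

theory Defs
  imports
    "HOL-Library.Poly_Mapping"
    "HOL-Computational_Algebra.Fraction_Field"
    "HOL-Computational_Algebra.Polynomial"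
    "HOL-Algebra.QuotRing"
    "HOL-Algebra.Module"
begin

section \<open>The base field and quantum binomials\<close>

text \<open>The base field is the field of rational functions over the rationals in one indeterminate,
  which plays the role of \<open>v\<^sup>1\<^sup>/\<^sup>2\<close>; so \<open>v\<close>, called \<open>vq\<close> below, is its square.\<close>

type_synonym qfield = "rat poly fract"

definition vhalf :: qfield where
  "vhalf = Fraction_Field.Fract [:0, 1:] 1"

definition vq :: qfield where
  "vq = vhalf ^ 2"

definition vi :: "('i \<Rightarrow> nat) \<Rightarrow> 'i \<Rightarrow> qfield" where
  "vi d i = vq ^ d i"

definition qint :: "qfield \<Rightarrow> nat \<Rightarrow> qfield" where
  "qint q n = (q ^ n - inverse q ^ n) / (q - inverse q)"

definition qfact :: "qfield \<Rightarrow> nat \<Rightarrow> qfield" where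
  "qfact q n = (\<Prod>k = 1..n. qint q k)"

definition qbinomial :: "qfield \<Rightarrow> nat \<Rightarrow> nat \<Rightarrow> qfield" where
  "qbinomial q m r = qfact q m / (qfact q r * qfact q (m - r))"


section \<open>Associative unital algebras over the base field\<close>

text \<open>An algebra is a record of type \<open>(qfield, 'a) module\<close>: a (not necessarily commutative)
  ring together with a scalar multiplication.\<close>

type_synonym 'a alg = "(qfield, 'a) module"

definition alg_hom :: "'a alg \<Rightarrow> 'b alg \<Rightarrow> ('a \<Rightarrow> 'b) set" where
  "alg_hom A B = {f \<in> ring_hom A B. \<forall>c. \<forall>x\<in>carrier A. f (c \<odot>\<^bsub>A\<^esub> x) = c \<odot>\<^bsub>B\<^esub> f x}"

definition alg_iso :: "'a alg \<Rightarrow> 'b alg \<Rightarrow> ('a \<Rightarrow> 'b) set" where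
  "alg_iso A B = alg_hom A B \<inter> ring_iso A B"

definition ground_alg :: "qfield alg" where
  "ground_alg = \<lparr>carrier = UNIV, mult = (*), one = 1, zero = 0, add = (+), smult = (*)\<rparr>"

inductive_set subalg_gen :: "'a alg \<Rightarrow> 'a set \<Rightarrow> 'a set" for A and S where
  one: "\<one>\<^bsub>A\<^esub> \<in> subalg_gen A S"
| incl: "x \<in> S \<Longrightarrow> x \<in> subalg_gen A S"
| add: "x \<in> subalg_gen A S \<Longrightarrow> y \<in> subalg_gen A S \<Longrightarrow> x \<oplus>\<^bsub>A\<^esub> y \<in> subalg_gen A S"
| mult: "x \<in> subalg_gen A S \<Longrightarrow> y \<in> subalg_gen A S \<Longrightarrow> x \<otimes>\<^bsub>A\<^esub> y \<in> subalg_gen A S"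
| smult: "x \<in> subalg_gen A S \<Longrightarrow> c \<odot>\<^bsub>A\<^esub> x \<in> subalg_gen A S"

definition subalg :: "'a alg \<Rightarrow> 'a set \<Rightarrow> 'a alg" where
  "subalg A S = A\<lparr>carrier := subalg_gen A S\<rparr>"

text \<open>The quotient by a two-sided ideal, extending the library's quotient ring.  Scalar
  multiplication is written as a union over representatives because the elementwise multiple
  of a coset by \<open>0\<close> is not a coset.\<close>

definition quot_alg :: "'a alg \<Rightarrow> 'a set \<Rightarrow> 'a set alg" where
  "quot_alg A I = ring.extend (A Quot I)
     (module.fields (\<lambda>c X. \<Union>x\<in>X. I +>\<^bsub>A\<^esub> (c \<odot>\<^bsub>A\<^esub> x)))"

definition scale :: "qfield \<Rightarrow> ('m \<Rightarrow>\<^sub>0 qfield) \<Rightarrow> 'm \<Rightarrow>\<^sub>0 qfield" where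
  "scale c = Poly_Mapping.map ((*) c)"

definition monoid_alg :: "'m monoid \<Rightarrow> ('m \<Rightarrow>\<^sub>0 qfield) alg" where
  "monoid_alg M =
    \<lparr>carrier = {p. Poly_Mapping.keys p \<subseteq> carrier M},
     mult = (\<lambda>p q. \<Sum>x\<in>Poly_Mapping.keys p. \<Sum>y\<in>Poly_Mapping.keys q.
               Poly_Mapping.single (x \<otimes>\<^bsub>M\<^esub> y) (Poly_Mapping.lookup p x * Poly_Mapping.lookup q y)),
     one = Poly_Mapping.single \<one>\<^bsub>M\<^esub> 1,
     zero = 0,
     add = (+),
     smult = scale\<rparr>"

definition free_alg :: "'g set \<Rightarrow> ('g list \<Rightarrow>\<^sub>0 qfield) alg" where
  "free_alg G = monoid_alg \<lparr>carrier = lists G, mult = (@), one = []\<rparr>"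

definition gen :: "'g \<Rightarrow> 'g list \<Rightarrow>\<^sub>0 qfield" where
  "gen g = Poly_Mapping.single [g] 1"

definition presented_alg :: "'g set \<Rightarrow> ('g list \<Rightarrow>\<^sub>0 qfield) set \<Rightarrow> ('g list \<Rightarrow>\<^sub>0 qfield) set alg" where
  "presented_alg G R = quot_alg (free_alg G) (genideal (free_alg G) R)"

definition presented_gen :: "'g set \<Rightarrow> ('g list \<Rightarrow>\<^sub>0 qfield) set \<Rightarrow> 'g \<Rightarrow> ('g list \<Rightarrow>\<^sub>0 qfield) set" where
  "presented_gen G R g = genideal (free_alg G) R +>\<^bsub>free_alg G\<^esub> gen g"


section \<open>Tensor products of algebras\<close>

text \<open>As a vector space, \<open>A \<otimes> B\<close> is the free vector space on \<open>carrier A \<times> carrier B\<close> modulo the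
  span of the bilinearity relations; the product comes from the componentwise product of pairs.\<close>

definition bilinear_rels :: "'a alg \<Rightarrow> 'b alg \<Rightarrow> ('a \<times> 'b \<Rightarrow>\<^sub>0 qfield) set" where
  "bilinear_rels A B =
     {Poly_Mapping.single (a \<oplus>\<^bsub>A\<^esub> a', b) 1 - Poly_Mapping.single (a, b) 1 - Poly_Mapping.single (a', b) 1
        | a a' b. a \<in> carrier A \<and> a' \<in> carrier A \<and> b \<in> carrier B}
   \<union> {Poly_Mapping.single (a, b \<oplus>\<^bsub>B\<^esub> b') 1 - Poly_Mapping.single (a, b) 1 - Poly_Mapping.single (a, b') 1
        | a b b'. a \<in> carrier A \<and> b \<in> carrier B \<and> b' \<in> carrier B}
   \<union> {Poly_Mapping.single (c \<odot>\<^bsub>A\<^esub> a, b) 1 - Poly_Mapping.single (a, b) c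
        | c a b. a \<in> carrier A \<and> b \<in> carrier B}
   \<union> {Poly_Mapping.single (a, c \<odot>\<^bsub>B\<^esub> b) 1 - Poly_Mapping.single (a, b) c
        | c a b. a \<in> carrier A \<and> b \<in> carrier B}"

definition bilinear_ideal :: "'a alg \<Rightarrow> 'b alg \<Rightarrow> ('a \<times> 'b \<Rightarrow>\<^sub>0 qfield) set" where
  "bilinear_ideal A B = module.span scale (bilinear_rels A B)"

definition tensor_alg :: "'a alg \<Rightarrow> 'b alg \<Rightarrow> ('a \<times> 'b \<Rightarrow>\<^sub>0 qfield) set alg" where
  "tensor_alg A B = quot_alg (monoid_alg (A \<times>\<times> B)) (bilinear_ideal A B)"

definition tensor_elem :: "'a alg \<Rightarrow> 'b alg \<Rightarrow> 'a \<Rightarrow> 'b \<Rightarrow> ('a \<times> 'b \<Rightarrow>\<^sub>0 qfield) set" where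
  "tensor_elem A B a b =
     bilinear_ideal A B +>\<^bsub>monoid_alg (A \<times>\<times> B)\<^esub> Poly_Mapping.single (a, b) 1"

text \<open>Sweedler sums: if \<open>X = \<Sum> a\<^sub>1 \<otimes> a\<^sub>2\<close>, then \<open>sweedler M X f\<close> is \<open>\<Sum> f a\<^sub>1 a\<^sub>2\<close>, computed in \<open>M\<close>.
  For bilinear \<open>f\<close>, the only case in which it is used, the value does not depend on the chosen
  representative of the coset \<open>X\<close>.\<close>

definition sweedler :: "'c alg \<Rightarrow> ('a \<times> 'b \<Rightarrow>\<^sub>0 qfield) set \<Rightarrow> ('a \<Rightarrow> 'b \<Rightarrow> 'c) \<Rightarrow> 'c" where
  "sweedler M X f =
     (let x = (SOME x. x \<in> X)
      in \<Oplus>\<^bsub>M\<^esub>p\<in>Poly_Mapping.keys x. Poly_Mapping.lookup x p \<odot>\<^bsub>M\<^esub> f (fst p) (snd p))"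


section \<open>Cartan and Satake data\<close>

definition symmetrizable_gcm :: "('i \<Rightarrow> 'i \<Rightarrow> int) \<Rightarrow> ('i \<Rightarrow> nat) \<Rightarrow> bool" where
  "symmetrizable_gcm C d \<longleftrightarrow>
     (\<forall>i. C i i = 2) \<and>
     (\<forall>i j. i \<noteq> j \<longrightarrow> C i j \<le> 0) \<and>
     (\<forall>i j. C i j = 0 \<longleftrightarrow> C j i = 0) \<and>
     (\<forall>i. d i > 0) \<and>
     (\<forall>i j. int (d i) * C i j = int (d j) * C j i)"

definition quasi_split_satake :: "('i \<Rightarrow> 'i \<Rightarrow> int) \<Rightarrow> ('i \<Rightarrow> nat) \<Rightarrow> ('i \<Rightarrow> 'i) \<Rightarrow> bool" where
  "quasi_split_satake C d \<tau> \<longleftrightarrow>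
     bij \<tau> \<and> \<tau> \<circ> \<tau> = id \<and> (\<forall>i j. C (\<tau> i) (\<tau> j) = C i j) \<and> (\<forall>i. d (\<tau> i) = d i)"

definition serre :: "'a alg \<Rightarrow> qfield \<Rightarrow> nat \<Rightarrow> 'a \<Rightarrow> 'a \<Rightarrow> 'a" where
  "serre A q m x y =
     (\<Oplus>\<^bsub>A\<^esub>r\<in>{0..m}. ((- 1) ^ r * qbinomial q m r) \<odot>\<^bsub>A\<^esub>
        (x [^]\<^bsub>A\<^esub> r \<otimes>\<^bsub>A\<^esub> y \<otimes>\<^bsub>A\<^esub> x [^]\<^bsub>A\<^esub> (m - r)))"


section \<open>The Drinfeld doubles\<close>

datatype 'i ugen = GE 'i | GF 'i | GK 'i | GK' 'i | GKinv 'i | GK'inv 'i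

definition U_hat_gens :: "'i ugen set" where
  "U_hat_gens = range GE \<union> range GF \<union> range GK \<union> range GK'"

context
  fixes A :: "('i ugen list \<Rightarrow>\<^sub>0 qfield) alg" (structure)
    and C :: "'i \<Rightarrow> 'i \<Rightarrow> int" and d :: "'i \<Rightarrow> nat"
begin

text \<open>Each relation \<open>l = r\<close> is represented by the element \<open>l \<ominus> r\<close> of the free algebra \<open>A\<close>.\<close>

definition U_hat_rels :: "('i ugen list \<Rightarrow>\<^sub>0 qfield) set" where
  "U_hat_rels =
     {x \<otimes> y \<ominus> y \<otimes> x | x y. x \<in> gen ` (range GK \<union> range GK') \<and> y \<in> gen ` (range GK \<union> range GK')}
   \<union> {(gen (GE i) \<otimes> gen (GF j) \<ominus> gen (GF j) \<otimes> gen (GE i))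
        \<ominus> (if i = j then inverse (vi d i) - vi d i else 0) \<odot> (gen (GK i) \<ominus> gen (GK' i)) | i j. True}
   \<union> {gen (GK i) \<otimes> gen (GE j) \<ominus> (vi d i powi C i j) \<odot> (gen (GE j) \<otimes> gen (GK i)) | i j. True}
   \<union> {gen (GK i) \<otimes> gen (GF j) \<ominus> (vi d i powi (- C i j)) \<odot> (gen (GF j) \<otimes> gen (GK i)) | i j. True}
   \<union> {gen (GK' i) \<otimes> gen (GE j) \<ominus> (vi d i powi (- C i j)) \<odot> (gen (GE j) \<otimes> gen (GK' i)) | i j. True}
   \<union> {gen (GK' i) \<otimes> gen (GF j) \<ominus> (vi d i powi C i j) \<odot> (gen (GF j) \<otimes> gen (GK' i)) | i j. True}
   \<union> {serre A (vi d i) (nat (1 - C i j)) (gen (GE i)) (gen (GE j)) | i j. i \<noteq> j}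
   \<union> {serre A (vi d i) (nat (1 - C i j)) (gen (GF i)) (gen (GF j)) | i j. i \<noteq> j}"

definition U_tilde_rels :: "('i ugen list \<Rightarrow>\<^sub>0 qfield) set" where
  "U_tilde_rels = U_hat_rels
   \<union> {gen (GK i) \<otimes> gen (GKinv i) \<ominus> \<one> | i. True}
   \<union> {gen (GKinv i) \<otimes> gen (GK i) \<ominus> \<one> | i. True}
   \<union> {gen (GK' i) \<otimes> gen (GK'inv i) \<ominus> \<one> | i. True}
   \<union> {gen (GK'inv i) \<otimes> gen (GK' i) \<ominus> \<one> | i. True}"

end

type_synonym 'i U = "('i ugen list \<Rightarrow>\<^sub>0 qfield) set"

definition U_hat :: "('i \<Rightarrow> 'i \<Rightarrow> int) \<Rightarrow> ('i \<Rightarrow> nat) \<Rightarrow> 'i U alg" where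
  "U_hat C d = presented_alg U_hat_gens (U_hat_rels (free_alg U_hat_gens) C d)"

definition U_hat_gen :: "('i \<Rightarrow> 'i \<Rightarrow> int) \<Rightarrow> ('i \<Rightarrow> nat) \<Rightarrow> 'i ugen \<Rightarrow> 'i U" where
  "U_hat_gen C d = presented_gen U_hat_gens (U_hat_rels (free_alg U_hat_gens) C d)"

definition U_tilde :: "('i \<Rightarrow> 'i \<Rightarrow> int) \<Rightarrow> ('i \<Rightarrow> nat) \<Rightarrow> 'i U alg" where
  "U_tilde C d = presented_alg UNIV (U_tilde_rels (free_alg UNIV) C d)"

definition U_tilde_gen :: "('i \<Rightarrow> 'i \<Rightarrow> int) \<Rightarrow> ('i \<Rightarrow> nat) \<Rightarrow> 'i ugen \<Rightarrow> 'i U" where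
  "U_tilde_gen C d = presented_gen UNIV (U_tilde_rels (free_alg UNIV) C d)"

text \<open>The canonical map along which \<open>U_hat\<close> is regarded as a subalgebra of \<open>U_tilde\<close>.  Here and
  below, \<open>SOME\<close> selects a map whose values on the carrier are determined by the stated
  properties.\<close>

definition U_incl :: "('i \<Rightarrow> 'i \<Rightarrow> int) \<Rightarrow> ('i \<Rightarrow> nat) \<Rightarrow> 'i U \<Rightarrow> 'i U" where
  "U_incl C d = (SOME f. f \<in> alg_hom (U_hat C d) (U_tilde C d) \<and>
     (\<forall>g\<in>U_hat_gens. f (U_hat_gen C d g) = U_tilde_gen C d g))"


section \<open>The universal iquantum groups\<close>

definition B_hat_elem :: "('i \<Rightarrow> 'i \<Rightarrow> int) \<Rightarrow> ('i \<Rightarrow> nat) \<Rightarrow> ('i \<Rightarrow> 'i) \<Rightarrow> 'i \<Rightarrow> 'i U" where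
  "B_hat_elem C d \<tau> i = U_hat_gen C d (GF i) \<oplus>\<^bsub>U_hat C d\<^esub>
     U_hat_gen C d (GE (\<tau> i)) \<otimes>\<^bsub>U_hat C d\<^esub> U_hat_gen C d (GK' i)"

definition k_hat_elem :: "('i \<Rightarrow> 'i \<Rightarrow> int) \<Rightarrow> ('i \<Rightarrow> nat) \<Rightarrow> ('i \<Rightarrow> 'i) \<Rightarrow> 'i \<Rightarrow> 'i U" where
  "k_hat_elem C d \<tau> i = U_hat_gen C d (GK i) \<otimes>\<^bsub>U_hat C d\<^esub> U_hat_gen C d (GK' (\<tau> i))"

definition Ui_hat :: "('i \<Rightarrow> 'i \<Rightarrow> int) \<Rightarrow> ('i \<Rightarrow> nat) \<Rightarrow> ('i \<Rightarrow> 'i) \<Rightarrow> 'i U alg" where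
  "Ui_hat C d \<tau> = subalg (U_hat C d) (range (B_hat_elem C d \<tau>) \<union> range (k_hat_elem C d \<tau>))"

definition B_elem :: "('i \<Rightarrow> 'i \<Rightarrow> int) \<Rightarrow> ('i \<Rightarrow> nat) \<Rightarrow> ('i \<Rightarrow> 'i) \<Rightarrow> 'i \<Rightarrow> 'i U" where
  "B_elem C d \<tau> i = U_tilde_gen C d (GF i) \<oplus>\<^bsub>U_tilde C d\<^esub>
     U_tilde_gen C d (GE (\<tau> i)) \<otimes>\<^bsub>U_tilde C d\<^esub> U_tilde_gen C d (GK' i)"

definition k_elem :: "('i \<Rightarrow> 'i \<Rightarrow> int) \<Rightarrow> ('i \<Rightarrow> nat) \<Rightarrow> ('i \<Rightarrow> 'i) \<Rightarrow> 'i \<Rightarrow> 'i U" where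
  "k_elem C d \<tau> i = U_tilde_gen C d (GK i) \<otimes>\<^bsub>U_tilde C d\<^esub> U_tilde_gen C d (GK' (\<tau> i))"

definition Ui_tilde :: "('i \<Rightarrow> 'i \<Rightarrow> int) \<Rightarrow> ('i \<Rightarrow> nat) \<Rightarrow> ('i \<Rightarrow> 'i) \<Rightarrow> 'i U alg" where
  "Ui_tilde C d \<tau> = subalg (U_tilde C d)
     (range (B_elem C d \<tau>) \<union> range (k_elem C d \<tau>) \<union> range (\<lambda>i. inv\<^bsub>U_tilde C d\<^esub> (k_elem C d \<tau> i)))"


section \<open>The Hopf algebra of Borel type\<close>

datatype 'i bgen = GTheta 'i | GH 'i | GHinv 'i

definition Bor_rels ::
  "('i bgen list \<Rightarrow>\<^sub>0 qfield) alg \<Rightarrow> ('i \<Rightarrow> 'i \<Rightarrow> int) \<Rightarrow> ('i \<Rightarrow> nat) \<Rightarrow> ('i bgen list \<Rightarrow>\<^sub>0 qfield) set" where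
  "Bor_rels A C d =
     {gen (GH i) \<otimes>\<^bsub>A\<^esub> gen (GH j) \<ominus>\<^bsub>A\<^esub> gen (GH j) \<otimes>\<^bsub>A\<^esub> gen (GH i) | i j. True}
   \<union> {gen (GH i) \<otimes>\<^bsub>A\<^esub> gen (GTheta j) \<ominus>\<^bsub>A\<^esub>
        (vi d i powi C i j) \<odot>\<^bsub>A\<^esub> (gen (GTheta j) \<otimes>\<^bsub>A\<^esub> gen (GH i)) | i j. True}
   \<union> {serre A (vi d i) (nat (1 - C i j)) (gen (GTheta i)) (gen (GTheta j)) | i j. i \<noteq> j}
   \<union> {gen (GH i) \<otimes>\<^bsub>A\<^esub> gen (GHinv i) \<ominus>\<^bsub>A\<^esub> \<one>\<^bsub>A\<^esub> | i. True}
   \<union> {gen (GHinv i) \<otimes>\<^bsub>A\<^esub> gen (GH i) \<ominus>\<^bsub>A\<^esub> \<one>\<^bsub>A\<^esub> | i. True}"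

type_synonym 'i B = "('i bgen list \<Rightarrow>\<^sub>0 qfield) set"

definition Bor :: "('i \<Rightarrow> 'i \<Rightarrow> int) \<Rightarrow> ('i \<Rightarrow> nat) \<Rightarrow> 'i B alg" where
  "Bor C d = presented_alg UNIV (Bor_rels (free_alg UNIV) C d)"

definition theta_elem :: "('i \<Rightarrow> 'i \<Rightarrow> int) \<Rightarrow> ('i \<Rightarrow> nat) \<Rightarrow> 'i \<Rightarrow> 'i B" where
  "theta_elem C d i = presented_gen UNIV (Bor_rels (free_alg UNIV) C d) (GTheta i)"

definition h_elem :: "('i \<Rightarrow> 'i \<Rightarrow> int) \<Rightarrow> ('i \<Rightarrow> nat) \<Rightarrow> 'i \<Rightarrow> 'i B" where
  "h_elem C d i = presented_gen UNIV (Bor_rels (free_alg UNIV) C d) (GH i)"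

definition Bor_hat :: "('i \<Rightarrow> 'i \<Rightarrow> int) \<Rightarrow> ('i \<Rightarrow> nat) \<Rightarrow> 'i B alg" where
  "Bor_hat C d = subalg (Bor C d) (range (theta_elem C d) \<union> range (h_elem C d))"

text \<open>An algebra homomorphism out of \<open>Bor\<close> is determined by its values on \<open>\<vartheta>\<^sub>i\<close> and \<open>h\<^sub>i\<close>, since
  it respects the inverses of the \<open>h\<^sub>i\<close>.\<close>

definition comult :: "('i \<Rightarrow> 'i \<Rightarrow> int) \<Rightarrow> ('i \<Rightarrow> nat) \<Rightarrow> 'i B \<Rightarrow> ('i B \<times> 'i B \<Rightarrow>\<^sub>0 qfield) set" where
  "comult C d =
     (let B = Bor C d; tens = tensor_elem B B in
      SOME f. f \<in> alg_hom B (tensor_alg B B) \<and>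
        (\<forall>i. f (theta_elem C d i) =
           tens (theta_elem C d i) \<one>\<^bsub>B\<^esub> \<oplus>\<^bsub>tensor_alg B B\<^esub> tens (h_elem C d i) (theta_elem C d i)) \<and>
        (\<forall>i. f (h_elem C d i) = tens (h_elem C d i) (h_elem C d i)))"

definition counit :: "('i \<Rightarrow> 'i \<Rightarrow> int) \<Rightarrow> ('i \<Rightarrow> nat) \<Rightarrow> 'i B \<Rightarrow> qfield" where
  "counit C d = (SOME f. f \<in> alg_hom (Bor C d) ground_alg \<and>
     (\<forall>i. f (theta_elem C d i) = 0) \<and> (\<forall>i. f (h_elem C d i) = 1))"

definition tau_map :: "('i \<Rightarrow> 'i \<Rightarrow> int) \<Rightarrow> ('i \<Rightarrow> nat) \<Rightarrow> ('i \<Rightarrow> 'i) \<Rightarrow> 'i B \<Rightarrow> 'i B" where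
  "tau_map C d \<tau> = (SOME f. f \<in> alg_hom (Bor C d) (Bor C d) \<and>
     (\<forall>i. f (theta_elem C d i) = theta_elem C d (\<tau> i)) \<and> (\<forall>i. f (h_elem C d i) = h_elem C d (\<tau> i)))"

definition bilinear_form :: "'a alg \<Rightarrow> ('a \<Rightarrow> 'a \<Rightarrow> qfield) \<Rightarrow> bool" where
  "bilinear_form A \<phi> \<longleftrightarrow>
     (\<forall>a\<in>carrier A. \<forall>a'\<in>carrier A. \<forall>b\<in>carrier A.
        \<phi> (a \<oplus>\<^bsub>A\<^esub> a') b = \<phi> a b + \<phi> a' b \<and> \<phi> b (a \<oplus>\<^bsub>A\<^esub> a') = \<phi> b a + \<phi> b a') \<and>
     (\<forall>c. \<forall>a\<in>carrier A. \<forall>b\<in>carrier A.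
        \<phi> (c \<odot>\<^bsub>A\<^esub> a) b = c * \<phi> a b \<and> \<phi> a (c \<odot>\<^bsub>A\<^esub> b) = c * \<phi> a b)"

text \<open>The pairing is extended to tensors by \<open>\<phi> (a \<otimes> a', b \<otimes> b') = \<phi> (a, b) \<phi> (a', b')\<close>.\<close>

definition is_hopf_pairing :: "('i \<Rightarrow> 'i \<Rightarrow> int) \<Rightarrow> ('i \<Rightarrow> nat) \<Rightarrow> ('i B \<Rightarrow> 'i B \<Rightarrow> qfield) \<Rightarrow> bool" where
  "is_hopf_pairing C d \<phi> \<longleftrightarrow>
     bilinear_form (Bor C d) \<phi> \<and>
     (\<forall>a\<in>carrier (Bor C d). \<forall>b\<in>carrier (Bor C d). \<forall>b'\<in>carrier (Bor C d).
        \<phi> a (b \<otimes>\<^bsub>Bor C d\<^esub> b') =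
          sweedler ground_alg (comult C d a) (\<lambda>a1 a2. \<phi> a1 b * \<phi> a2 b')) \<and>
     (\<forall>a\<in>carrier (Bor C d). \<forall>a'\<in>carrier (Bor C d). \<forall>b\<in>carrier (Bor C d).
        \<phi> (a \<otimes>\<^bsub>Bor C d\<^esub> a') b =
          sweedler ground_alg (comult C d b) (\<lambda>b1 b2. \<phi> a b1 * \<phi> a' b2)) \<and>
     (\<forall>a\<in>carrier (Bor C d). \<phi> a \<one>\<^bsub>Bor C d\<^esub> = counit C d a \<and> \<phi> \<one>\<^bsub>Bor C d\<^esub> a = counit C d a) \<and>
     (\<forall>i j. \<phi> (theta_elem C d i) (theta_elem C d j) = (if i = j then vi d i - inverse (vi d i) else 0)) \<and>
     (\<forall>i j. \<phi> (h_elem C d i) (h_elem C d j) = vi d i powi C i j) \<and>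
     (\<forall>i j. \<phi> (theta_elem C d i) (h_elem C d j) = 0)"

definition hopf_pairing :: "('i \<Rightarrow> 'i \<Rightarrow> int) \<Rightarrow> ('i \<Rightarrow> nat) \<Rightarrow> 'i B \<Rightarrow> 'i B \<Rightarrow> qfield" where
  "hopf_pairing C d = (SOME \<phi>. is_hopf_pairing C d \<phi>)"


section \<open>The iHopf algebras\<close>

text \<open>\<open>a \<ast> b = \<Sum> \<phi> (\<tau> b\<^sub>2, a\<^sub>1) a\<^sub>2 b\<^sub>1\<close>, with \<open>\<Delta> a = \<Sum> a\<^sub>1 \<otimes> a\<^sub>2\<close> and \<open>\<Delta> b = \<Sum> b\<^sub>1 \<otimes> b\<^sub>2\<close>.\<close>

definition imult :: "('i \<Rightarrow> 'i \<Rightarrow> int) \<Rightarrow> ('i \<Rightarrow> nat) \<Rightarrow> ('i \<Rightarrow> 'i) \<Rightarrow> 'i B \<Rightarrow> 'i B \<Rightarrow> 'i B" where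
  "imult C d \<tau> a b =
     sweedler (Bor C d) (comult C d a) (\<lambda>a1 a2.
       sweedler (Bor C d) (comult C d b) (\<lambda>b1 b2.
         hopf_pairing C d (tau_map C d \<tau> b2) a1 \<odot>\<^bsub>Bor C d\<^esub> (a2 \<otimes>\<^bsub>Bor C d\<^esub> b1)))"

definition Bi_tilde :: "('i \<Rightarrow> 'i \<Rightarrow> int) \<Rightarrow> ('i \<Rightarrow> nat) \<Rightarrow> ('i \<Rightarrow> 'i) \<Rightarrow> 'i B alg" where
  "Bi_tilde C d \<tau> = (Bor C d)\<lparr>mult := imult C d \<tau>\<rparr>"

definition Bi_hat :: "('i \<Rightarrow> 'i \<Rightarrow> int) \<Rightarrow> ('i \<Rightarrow> nat) \<Rightarrow> ('i \<Rightarrow> 'i) \<Rightarrow> 'i B alg" where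
  "Bi_hat C d \<tau> = (Bor_hat C d)\<lparr>mult := imult C d \<tau>\<rparr>"

end

theory Submission
  imports Defs "HOL-Library.Product_Plus"
begin

text \<open>All structure is lifted to free algebras on words, where the coproduct of a word is a sum of
  words and the pairing is given by recursion; the Serre relations enter only through the fact that
  a quantum Serre element is skew-primitive modulo the torus relations, so that they generate a
  coideal lying in the radical of the pairing.

  The twisted product admits a character \<open>\<chi>\<close> with \<open>\<chi> \<vartheta>\<^sub>i = 0\<close> and \<open>\<chi> h\<^sub>i = 1\<close>.  With the two
  embeddings \<open>\<rho>\<^sup>+\<close>, \<open>\<rho>\<^sup>-\<close> of the Borel part into the Drinfeld double, the exchange relation of the
  double shows that \<open>\<Phi> a = \<Sum> \<chi> a\<^sub>2 \<rho>\<^sup>+ (\<tau> a\<^sub>3) \<rho>\<^sup>- a\<^sub>1\<close> is multiplicative, and it takes the required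
  values on generators.  For injectivity, the double acts on functions from the Borel part to itself,
  and applying \<open>\<Phi> a\<close> to the counit recovers \<open>a\<close> up to nonzero factors and terms with fewer
  \<open>\<vartheta>\<close>'s.\<close>

section \<open>Linear extension and ideals in monoid algebras\<close>

text \<open>The form of \<open>\<Phi>\<close> comes from a cocycle. The exchange relation of the
  double carries one pairing on each side, and the twisted product supplies only the one on the
  right. The missing one is the factor in \<open>\<chi> p \<chi> q = \<Sum> \<phi> (\<tau>
  q\<^sub>2, p\<^sub>1) \<chi> (p\<^sub>2 q\<^sub>1)\<close>, which is why a character of the
  twisted product sits between the two embeddings. For the ordinary product \<open>\<chi>\<close>
  need not be multiplicative, so its compatibility with the Serre relations is a separate task: for
  a Serre element \<open>S\<close> after a word \<open>a\<close> it follows by evaluating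
  \<open>\<chi> (a \<ast> S)\<close> in two ways. Neither side comes with a basis, so the claims are
  phrased as membership in ideals. The common tool is that a Sweedler-type formula respects a
  coideal once it does so in each tensor slot. Injectivity is read modulo the Borel relations from
  the component of highest theta degree; the factors divided out there are values on torus words,
  hence powers of \<open>v\<close>.\<close>

instantiation list :: (type) monoid_add
begin
definition zero_list :: "'a list" where "zero_list = []"
definition plus_list :: "'a list \<Rightarrow> 'a list \<Rightarrow> 'a list" where "plus_list = (@)"
instance by standard (simp_all add: zero_list_def plus_list_def)
end

text \<open>With append as addition on lists, the convolution product of finitely supported
  functions is the product of the free algebra and \<open>1\<close> is the empty word. With
  componentwise addition on pairs, the same type gives the tensor square of the free
  algebra.\<close>

type_synonym 'm vec = "'m \<Rightarrow>\<^sub>0 qfield"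

abbreviation mon :: "'m \<Rightarrow> 'm vec" where
  "mon w \<equiv> Poly_Mapping.single w 1"

abbreviation keys :: "'m vec \<Rightarrow> 'm set" where
  "keys \<equiv> Poly_Mapping.keys"

abbreviation lookup :: "'m vec \<Rightarrow> 'm \<Rightarrow> qfield" where
  "lookup \<equiv> Poly_Mapping.lookup"

lemma lookup_scale [simp]: "lookup (scale c x) k = c * lookup x k"
  unfolding scale_def by (simp add: map.rep_eq when_def)

lemma vs_scale [simp, intro]: "vector_space scale"
  by unfold_locales (auto intro!: poly_mapping_eqI simp: lookup_add algebra_simps)

lemma vs_times [simp, intro]: "vector_space ((*) :: qfield \<Rightarrow> _)"
  by unfold_locales (auto simp: algebra_simps)

interpretation sc: vector_space "scale :: qfield \<Rightarrow> 'm vec \<Rightarrow> 'm vec"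
  by (rule vs_scale)

lemma scale_single [simp]: "scale c (Poly_Mapping.single k a) = Poly_Mapping.single k (c * a)"
  unfolding scale_def by simp

lemma scale_mult_left: "scale c x * y = scale c (x * y)"
  unfolding scale_def mult_map_scale_conv_mult by (simp add: mult.assoc)

lemma keys_add_sub: "keys (x + y) \<subseteq> keys x \<union> keys y"
  by (rule keys_add)

lemma vec_expand: "x = (\<Sum>k\<in>keys x. scale (lookup x k) (mon k))"
proof (rule poly_mapping_eqI)
  fix k
  have "lookup (\<Sum>k\<in>keys x. scale (lookup x k) (mon k)) k
      = (\<Sum>j\<in>keys x. lookup x j when j = k)"
    unfolding lookup_sum by (rule sum.cong) (simp_all add: lookup_single)
  also have "\<dots> = lookup x k"
  proof (cases "k \<in> keys x")
    case True
    have "(\<Sum>j\<in>keys x. lookup x j when j = k) = (\<Sum>j\<in>keys x. if j = k then lookup x j else 0)"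
      by (rule sum.cong) (simp_all add: when_def)
    also have "\<dots> = (if k \<in> keys x then lookup x k else 0)"
      by (simp add: sum.delta)
    finally show ?thesis using True by simp
  next
    case False
    then show ?thesis by (auto simp: in_keys_iff when_def intro!: sum.neutral)
  qed
  finally show "lookup x k = lookup (\<Sum>k\<in>keys x. scale (lookup x k) (mon k)) k" ..
qed

lemma vec_induct_keys [consumes 1, case_names zero add mon]:
  assumes "keys x \<subseteq> A" and "P 0" and "\<And>x y. P x \<Longrightarrow> P y \<Longrightarrow> P (x + y)"
    and "\<And>k c. k \<in> A \<Longrightarrow> P (scale c (mon k))"
  shows "P x"
proof -
  have "P (\<Sum>k\<in>B. scale (lookup x k) (mon k))" if "finite B" "B \<subseteq> A" for B
    using that by (induction B) (use assms in auto)
  from this[of "keys x"] assms(1) show ?thesis using vec_expand[of x] by simp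
qed

lemma vec_induct [case_names zero add mon]:
  assumes "P 0" and "\<And>x y. P x \<Longrightarrow> P y \<Longrightarrow> P (x + y)" and "\<And>k c. P (scale c (mon k))"
  shows "P (x :: 'm vec)"
  by (rule vec_induct_keys[of x UNIV]) (use assms in auto)

lemma scale_mult_right: "x * scale c y = scale c (x * (y :: ('m :: monoid_add) vec))"
proof (induction x rule: vec_induct)
  case (mon k b)
  show ?case
    by (induction y rule: vec_induct) (simp_all add: sc.scale_right_distrib distrib_left mult_single mult_ac)
qed (simp_all add: distrib_right sc.scale_right_distrib)

lemmas scale_mult = scale_mult_left scale_mult_right

lemma mono_mult: "mon a * mon b = mon (a @ b)"
  by (simp add: mult_single plus_list_def)

lemma mono_Nil: "mon [] = 1"
  by (metis single_one zero_list_def)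

text \<open>Scalar multiplication is an argument, so that functionals with values in the field and
  vector-valued maps share one theory of linear extension.\<close>

definition lin :: "(qfield \<Rightarrow> 'v::ab_group_add \<Rightarrow> 'v) \<Rightarrow> ('m \<Rightarrow> 'v) \<Rightarrow> 'm vec \<Rightarrow> 'v" where
  "lin s F x = (\<Sum>k\<in>keys x. s (lookup x k) (F k))"

lemma lin_superset:
  assumes "vector_space s" "finite A" "keys x \<subseteq> A"
  shows "lin s F x = (\<Sum>k\<in>A. s (lookup x k) (F k))"
proof -
  interpret vector_space s by fact
  show ?thesis unfolding lin_def
    by (rule sum.mono_neutral_left) (use assms in \<open>auto simp: in_keys_iff\<close>)
qed

lemma lin_0 [simp]: "lin s F 0 = 0"
  by (simp add: lin_def)

lemma lin_add [simp]:
  assumes "vector_space s"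
  shows "lin s F (x + y) = lin s F x + lin s F y"
proof -
  interpret vector_space s by fact
  let ?A = "keys x \<union> keys y"
  have "lin s F (x + y) = (\<Sum>k\<in>?A. s (lookup (x + y) k) (F k))"
    using keys_add_sub[of x y] by (intro lin_superset assms) auto
  also have "\<dots> = (\<Sum>k\<in>?A. s (lookup x k) (F k)) + (\<Sum>k\<in>?A. s (lookup y k) (F k))"
    by (simp add: lookup_add scale_left_distrib sum.distrib)
  also have "\<dots> = lin s F x + lin s F y"
    by (subst (1 2) lin_superset[OF assms, of ?A]) auto
  finally show ?thesis .
qed

lemma lin_scale [simp]:
  assumes "vector_space s"
  shows "lin s F (scale c x) = s c (lin s F x)"
proof -
  interpret vector_space s by fact
  have "lin s F (scale c x) = (\<Sum>k\<in>keys x. s (lookup (scale c x) k) (F k))"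
    by (intro lin_superset assms) (auto simp: in_keys_iff)
  then show ?thesis by (simp add: lin_def scale_sum_right)
qed

lemma lin_single [simp]:
  assumes "vector_space s"
  shows "lin s F (Poly_Mapping.single k c) = s c (F k)"
proof -
  interpret vector_space s by fact
  show ?thesis by (cases "c = 0") (simp_all add: lin_def)
qed

lemma lin_uminus [simp]:
  assumes "vector_space s" shows "lin s F (- x) = - lin s F x"
proof -
  have "lin s F (- x) + lin s F x = 0"
    using lin_add[OF assms, of F "-x" x] by simp
  then show ?thesis by (simp add: eq_neg_iff_add_eq_0)
qed

lemma lin_diff [simp]:
  assumes "vector_space s" shows "lin s F (x - y) = lin s F x - lin s F y"
  using lin_add[OF assms, of F x "-y"] lin_uminus[OF assms] by simp

lemma lin_sum [simp]:
  assumes "vector_space s" shows "lin s F (\<Sum>a\<in>A. g a) = (\<Sum>a\<in>A. lin s F (g a))"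
  by (induction A rule: infinite_finite_induct) (simp_all add: assms)

lemma lin_mono_id [simp]: "lin scale mon x = x"
  unfolding lin_def by (rule vec_expand[symmetric])

lemma lin_cong: "(\<And>k. k \<in> keys x \<Longrightarrow> F k = G k) \<Longrightarrow> lin s F x = lin s G x"
  unfolding lin_def by (rule sum.cong) auto

lemma lin_fun_add: "vector_space s \<Longrightarrow> lin s (\<lambda>k. F k + G k) x = lin s F x + lin s G x"
  unfolding lin_def vector_space_def by (simp add: sum.distrib)

lemma lin_fun_0 [simp]: "vector_space s \<Longrightarrow> lin s (\<lambda>k. 0) x = 0"
  unfolding lin_def by (rule sum.neutral) (simp add: module.scale_zero_right module_iff_vector_space)

definition lmap :: "(qfield \<Rightarrow> 'v::ab_group_add \<Rightarrow> 'v) \<Rightarrow> (qfield \<Rightarrow> 'w::ab_group_add \<Rightarrow> 'w) \<Rightarrow> ('v \<Rightarrow> 'w) \<Rightarrow> bool" where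
  "lmap s t h \<longleftrightarrow> (\<forall>x y. h (x + y) = h x + h y) \<and> (\<forall>c x. h (s c x) = t c (h x))"

lemma lmap_0: "lmap s t h \<Longrightarrow> h 0 = 0"
  unfolding lmap_def by (metis add_cancel_right_left)

lemma lmap_diff: "lmap s t h \<Longrightarrow> h (x - y) = h x - h y"
  unfolding lmap_def by (metis add_diff_cancel diff_add_cancel)

lemma lmap_sum: "lmap s t h \<Longrightarrow> h (\<Sum>a\<in>A. g a) = (\<Sum>a\<in>A. h (g a))"
  by (induction A rule: infinite_finite_induct) (simp_all add: lmap_0, simp add: lmap_def)

lemma lmap_lin: "lmap s t h \<Longrightarrow> h (lin s F x) = lin t (\<lambda>k. h (F k)) x"
  by (simp add: lin_def lmap_sum) (simp add: lmap_def)

lemma lmap_lin_self: "vector_space s \<Longrightarrow> lmap scale s (lin s F)"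
  by (simp add: lmap_def)

lemma lmap_eq_lin:
  assumes "lmap scale s h" "vector_space s" shows "h x = lin s (\<lambda>k. h (mon k)) x"
  using lmap_lin[OF assms(1), of mon x] by simp

lemma lmap_mult_left: "lmap scale scale (\<lambda>x :: ('m::monoid_add) vec. y * x)"
  by (simp add: lmap_def distrib_left scale_mult)

lemma lmap_mult_right: "lmap scale scale (\<lambda>x :: ('m::monoid_add) vec. x * y)"
  by (simp add: lmap_def distrib_right scale_mult)

lemma lmap_scale: "lmap scale scale (scale c)"
  by (simp add: lmap_def sc.scale_right_distrib mult.commute)

lemma lmap_comp: "lmap s t h \<Longrightarrow> lmap t r k \<Longrightarrow> lmap s r (\<lambda>x. k (h x))"
  by (simp add: lmap_def)

lemma lin_swap:
  assumes "vector_space s"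
  shows "lin s (\<lambda>a. lin s (\<lambda>b. F a b) y) x = lin s (\<lambda>b. lin s (\<lambda>a. F a b) x) y"
proof -
  interpret vector_space s by fact
  show ?thesis unfolding lin_def
    by (simp add: scale_sum_right scale_scale mult.commute) (rule sum.swap)
qed

lemma lin_mult_expand: "x * y = lin scale (\<lambda>a. lin scale (\<lambda>b. mon (a + b)) y) (x :: ('m::monoid_add) vec)"
proof (induction x rule: vec_induct)
  case (mon k c)
  show ?case
    by (induction y rule: vec_induct)
      (simp_all add: distrib_left mult_single sc.scale_right_distrib mult_ac)
qed (simp_all add: distrib_right)

text \<open>Choosing \<open>N = {0}\<close> turns membership into vanishing, so the same lemmas
  serve maps into a quotient and scalar functionals.\<close>

definition lsub :: "(qfield \<Rightarrow> 'v::ab_group_add \<Rightarrow> 'v) \<Rightarrow> 'v set \<Rightarrow> bool" where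
  "lsub s N \<longleftrightarrow> 0 \<in> N \<and> (\<forall>x\<in>N. \<forall>y\<in>N. x + y \<in> N) \<and> (\<forall>c. \<forall>x\<in>N. s c x \<in> N)"

lemma lsub_0: "lsub s N \<Longrightarrow> 0 \<in> N"
  by (simp add: lsub_def)

lemma lsub_add: "lsub s N \<Longrightarrow> x \<in> N \<Longrightarrow> y \<in> N \<Longrightarrow> x + y \<in> N"
  by (simp add: lsub_def)

lemma lsub_scale: "lsub s N \<Longrightarrow> x \<in> N \<Longrightarrow> s c x \<in> N"
  by (simp add: lsub_def)

lemma lsub_sum: "lsub s N \<Longrightarrow> (\<And>a. a \<in> A \<Longrightarrow> g a \<in> N) \<Longrightarrow> (\<Sum>a\<in>A. g a) \<in> N"
  by (induction A rule: infinite_finite_induct) (auto simp: lsub_def)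

lemma lsub_lin: "lsub s N \<Longrightarrow> (\<And>k. k \<in> keys x \<Longrightarrow> F k \<in> N) \<Longrightarrow> lin s F x \<in> N"
  unfolding lin_def by (rule lsub_sum) (auto intro: lsub_scale)

lemma lsub_zero: "vector_space s \<Longrightarrow> lsub s {0}"
  by (simp add: lsub_def module.scale_zero_right module_iff_vector_space)

lemma lsub_uminus: "vector_space s \<Longrightarrow> lsub s N \<Longrightarrow> x \<in> N \<Longrightarrow> - x \<in> N"
  using lsub_scale[of s N x "-1"]
  by (simp add: module.scale_minus_left module.scale_one flip: module_iff_vector_space)

lemma lsub_diff: "vector_space s \<Longrightarrow> lsub s N \<Longrightarrow> x \<in> N \<Longrightarrow> y \<in> N \<Longrightarrow> x - y \<in> N"
  by (metis lsub_uminus lsub_add diff_conv_add_uminus)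

section \<open>Two-sided ideals\<close>

inductive_set idl :: "('m::monoid_add) vec set \<Rightarrow> 'm vec set" for R where
  idl_0: "0 \<in> idl R"
| idl_add: "x \<in> idl R \<Longrightarrow> y \<in> idl R \<Longrightarrow> x + y \<in> idl R"
| idl_gen: "r \<in> R \<Longrightarrow> scale c (mon a * r * mon b) \<in> idl R"

lemma idl_scale: "x \<in> idl R \<Longrightarrow> scale c x \<in> idl R"
  by (induction rule: idl.induct) (auto simp: sc.scale_right_distrib intro: idl.intros)

lemma lsub_idl [simp, intro]: "lsub scale (idl R)"
  by (auto simp: lsub_def intro: idl.intros idl_scale)

lemma idl_uminus: "x \<in> idl R \<Longrightarrow> - x \<in> idl R"
  by (rule lsub_uminus[OF vs_scale lsub_idl])

lemma idl_diff: "x \<in> idl R \<Longrightarrow> y \<in> idl R \<Longrightarrow> x - y \<in> idl R"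
  by (rule lsub_diff[OF vs_scale lsub_idl])

lemma idl_mult_mono: "x \<in> idl R \<Longrightarrow> mon a * x \<in> idl R \<and> x * mon b \<in> idl R"
proof (induction rule: idl.induct)
  case (idl_gen r c a' b')
  have "mon a * scale c (mon a' * r * mon b') = scale c (mon (a + a') * r * mon b')"
    by (simp add: scale_mult mult.assoc[symmetric] mult_single)
  moreover have "scale c (mon a' * r * mon b') * mon b = scale c (mon a' * r * mon (b' + b))"
    by (simp add: scale_mult mult.assoc mult_single)
  ultimately show ?case using idl_gen by (auto intro: idl.idl_gen)
qed (auto simp: distrib_left distrib_right intro: idl.intros)

lemma idl_mult_left: "x \<in> idl R \<Longrightarrow> y * x \<in> idl R"
proof (induction y rule: vec_induct)
  case (mon k c) then show ?case
    by (metis idl_mult_mono scale_mult_left idl_scale)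
qed (auto simp: distrib_right intro: idl.intros)

lemma idl_mult_right: "x \<in> idl R \<Longrightarrow> x * y \<in> idl R"
proof (induction y rule: vec_induct)
  case (mon k c) then show ?case
    by (metis idl_mult_mono scale_mult_right idl_scale)
qed (auto simp: distrib_left intro: idl.intros)

lemma idl_incl: "r \<in> R \<Longrightarrow> r \<in> idl R"
  using idl_gen[of r R 1 0 0] by simp

lemma idl_mono_set:
  assumes "x \<in> idl R" "R \<subseteq> R'" shows "x \<in> idl R'"
  using assms(1) by (induction rule: idl.induct) (use assms(2) in \<open>auto intro: idl.intros\<close>)

lemma lin_sandwich:
  assumes "vector_space s"
  shows "lin s F (mon a * x * mon b) = lin s (\<lambda>w. F (a + w + b)) (x :: ('m::monoid_add) vec)"
  by (induction x rule: vec_induct)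
    (simp_all add: assms distrib_left distrib_right scale_mult mult_single add.assoc)

text \<open>The ideal is spanned by sandwiches \<open>mon a * r * mon b\<close>, on which
  \<open>lin s F\<close> is the extension of \<open>F\<close> with the context inserted. Hence a
  linear map has to be tested only on relations in context.\<close>

lemma lin_idl:
  assumes "vector_space s" "lsub s N"
    and "\<And>r a b. r \<in> R \<Longrightarrow> lin s (\<lambda>w. F (a + w + b)) r \<in> N" and "x \<in> idl R"
  shows "lin s F x \<in> N"
  using assms(4)
  by (induction rule: idl.induct)
    (use assms(1-3) in \<open>auto simp: lin_sandwich intro: lsub_0 lsub_add lsub_scale\<close>)

lemma lin_monoid_hom:
  assumes "\<And>a b. m (a + b) = m a * m b"
  shows "lin scale m ((x :: ('a::monoid_add) vec) * y) = lin scale m x * (lin scale m y :: ('b::monoid_add) vec)"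
proof (induction x rule: vec_induct)
  case (mon k c)
  show ?case
    by (induction y rule: vec_induct)
      (simp_all add: distrib_left mult_single assms scale_mult mult_ac)
qed (simp_all add: distrib_right)

section \<open>Sweedler sums over words\<close>

type_synonym 'i word = "'i bgen list"

text \<open>The coproduct of a word is a sum of pairs of words with coefficients \<open>1\<close>, so Sweedler sums
  can be taken of arbitrary functions of two words, before passing to any quotient.\<close>

fun sw :: "'i word \<Rightarrow> ('i word \<Rightarrow> 'i word \<Rightarrow> 'v::comm_monoid_add) \<Rightarrow> 'v" where
  "sw [] F = F [] []"
| "sw (GTheta i # w) F = sw w (\<lambda>u v. F (GTheta i # u) v) + sw w (\<lambda>u v. F (GH i # u) (GTheta i # v))"
| "sw (GH i # w) F = sw w (\<lambda>u v. F (GH i # u) (GH i # v))"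
| "sw (GHinv i # w) F = sw w (\<lambda>u v. F (GHinv i # u) (GHinv i # v))"

text \<open>The pairs that occur in \<open>sw w\<close>. A Sweedler sum in a bare commutative monoid
  does not show its terms, so bounds on length, letters and weight of the two factors are stated for
  this set.\<close>

fun cops :: "'i word \<Rightarrow> ('i word \<times> 'i word) set" where
  "cops [] = {([], [])}"
| "cops (GTheta i # w) = (\<lambda>(u, v). (GTheta i # u, v)) ` cops w \<union> (\<lambda>(u, v). (GH i # u, GTheta i # v)) ` cops w"
| "cops (GH i # w) = (\<lambda>(u, v). (GH i # u, GH i # v)) ` cops w"
| "cops (GHinv i # w) = (\<lambda>(u, v). (GHinv i # u, GHinv i # v)) ` cops w"

fun is_theta :: "'i bgen \<Rightarrow> bool" where
  "is_theta (GTheta i) = True" | "is_theta (GH i) = False" | "is_theta (GHinv i) = False"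

definition tfree :: "'i word \<Rightarrow> bool" where
  "tfree w \<longleftrightarrow> (\<forall>g\<in>set w. \<not> is_theta g)"

definition ntheta :: "'i word \<Rightarrow> nat" where
  "ntheta w = length (filter is_theta w)"

text \<open>The counit of the Borel algebra, lifted to words.\<close>

definition eps :: "'i word \<Rightarrow> qfield" where
  "eps w = (if tfree w then 1 else 0)"

lemma tfree_simps [simp]:
  "tfree []" "tfree (GTheta i # w) = False" "tfree (GH i # w) = tfree w" "tfree (GHinv i # w) = tfree w"
  "tfree (u @ v) = (tfree u \<and> tfree v)"
  by (auto simp: tfree_def)

lemma ntheta_simps [simp]:
  "ntheta [] = 0" "ntheta (GTheta i # w) = Suc (ntheta w)" "ntheta (GH i # w) = ntheta w"
  "ntheta (GHinv i # w) = ntheta w" "ntheta (u @ v) = ntheta u + ntheta v"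
  by (auto simp: ntheta_def)

lemma eps_simps [simp]:
  "eps [] = 1" "eps (GTheta i # w) = 0" "eps (GH i # w) = eps w" "eps (GHinv i # w) = eps w"
  "eps (u @ v) = eps u * eps v"
  by (auto simp: eps_def)

lemma sw_cong_cops:
  "(\<And>u v. (u, v) \<in> cops w \<Longrightarrow> F u v = G u v) \<Longrightarrow> sw w F = sw w G"
proof (induction w arbitrary: F G rule: cops.induct)
  case (2 i w)
  have "sw w (\<lambda>u v. F (GTheta i # u) v) = sw w (\<lambda>u v. G (GTheta i # u) v)"
    and "sw w (\<lambda>u v. F (GH i # u) (GTheta i # v)) = sw w (\<lambda>u v. G (GH i # u) (GTheta i # v))"
    by (rule "2.IH", rule "2.prems", force)+
  then show ?case by simp
next
  case (3 i w)
  show ?case unfolding sw.simps by (rule "3.IH", rule "3.prems", force)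
next
  case (4 i w)
  show ?case unfolding sw.simps by (rule "4.IH", rule "4.prems", force)
qed auto

text \<open>Lets a function recurse inside a Sweedler sum: the termination proof of
  \<open>chi\<close> may assume that the recursive argument comes from \<open>cops\<close>.\<close>

lemma sw_fundef_cong [fundef_cong]:
  "w = w' \<Longrightarrow> (\<And>u v. (u, v) \<in> cops w' \<Longrightarrow> F u v = G u v) \<Longrightarrow> sw w F = sw w' G"
  using sw_cong_cops by metis

lemma sw_closed:
  "(\<And>u v. (u, v) \<in> cops w \<Longrightarrow> F u v \<in> N) \<Longrightarrow> (\<And>x y. x \<in> N \<Longrightarrow> y \<in> N \<Longrightarrow> x + y \<in> N) \<Longrightarrow> sw w F \<in> N"
proof (induction w arbitrary: F rule: cops.induct)
  case (2 i w)
  have "sw w (\<lambda>u v. F (GTheta i # u) v) \<in> N" "sw w (\<lambda>u v. F (GH i # u) (GTheta i # v)) \<in> N"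
    by (rule "2.IH", rule "2.prems"(1), force, rule "2.prems"(2), assumption+)+
  then show ?case by (simp add: "2.prems")
next
  case (3 i w) show ?case unfolding sw.simps by (rule "3.IH", rule "3.prems"(1), force, rule "3.prems"(2))
next
  case (4 i w) show ?case unfolding sw.simps by (rule "4.IH", rule "4.prems"(1), force, rule "4.prems"(2))
qed auto

lemma cops_facts:
  "(u, v) \<in> cops w \<Longrightarrow> length u = length w \<and> length v \<le> length w \<and> ntheta u + ntheta v = ntheta w"
  by (induction w arbitrary: u v rule: cops.induct) (fastforce split: prod.splits)+

lemma cops_letters:
  "(u, v) \<in> cops w \<Longrightarrow> set u \<subseteq> set w \<union> range GH \<and> set v \<subseteq> set w"
  by (induction w arbitrary: u v rule: cops.induct) (fastforce split: prod.splits)+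

lemma sw_0 [simp]: "sw w (\<lambda>u v. 0) = 0"
  by (induction w rule: cops.induct) simp_all

lemma sw_add: "sw w (\<lambda>u v. F u v + G u v) = sw w F + sw w G"
  by (induction w arbitrary: F G rule: cops.induct) (simp_all add: add_ac)

lemma sw_hom:
  assumes "\<And>x y. h (x + y) = h x + h y"
  shows "h (sw w F) = sw w (\<lambda>u v. h (F u v))"
  by (induction w arbitrary: F rule: cops.induct) (simp_all add: assms)

lemma sw_lmap: "lmap s t h \<Longrightarrow> h (sw w F) = sw w (\<lambda>u v. h (F u v))"
  by (rule sw_hom) (simp add: lmap_def)

lemma sw_times_left: "c * sw w F = sw w (\<lambda>u v. c * F u v)" for c :: "'a::semiring_0"
  by (rule sw_hom) (simp add: distrib_left)

lemma sw_times_right: "sw w F * c = sw w (\<lambda>u v. F u v * c)" for c :: "'a::semiring_0"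
  by (rule sw_hom) (simp add: distrib_right)

lemma sw_scale: "scale c (sw w F) = sw w (\<lambda>u v. scale c (F u v))"
  by (rule sw_hom) (simp add: sc.scale_right_distrib)

lemma sw_scale_left: "scale (sw w F) x = sw w (\<lambda>u v. scale (F u v) x)"
  by (rule sw_hom[where h = "\<lambda>c. scale c x"]) (simp add: sc.scale_left_distrib)

lemma sw_lin: "vector_space s \<Longrightarrow> lin s G (sw w F) = sw w (\<lambda>u v. lin s G (F u v))"
  by (rule sw_hom) simp

lemma sw_minus: "- sw w F = sw w (\<lambda>u v. - F u v :: 'a :: ab_group_add)"
  by (rule sw_hom[where h = uminus]) simp

lemma sw_diff: "sw w (\<lambda>u v. F u v - G u v :: 'a :: ab_group_add) = sw w F - sw w G"
  using sw_add[of w F "\<lambda>u v. - G u v"] by (simp add: sw_minus)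

lemma lin_sw: "vector_space s \<Longrightarrow> lin s (\<lambda>k. sw w (\<lambda>u v. F k u v)) x = sw w (\<lambda>u v. lin s (\<lambda>k. F k u v) x)"
  by (induction w arbitrary: F rule: cops.induct) (simp_all add: lin_fun_add)

lemma sw_append: "sw (a @ b) F = sw a (\<lambda>a1 a2. sw b (\<lambda>b1 b2. F (a1 @ b1) (a2 @ b2)))"
  by (induction a arbitrary: F rule: cops.induct) simp_all

lemma sw_swap: "sw a (\<lambda>a1 a2. sw b (\<lambda>b1 b2. F a1 a2 b1 b2)) = sw b (\<lambda>b1 b2. sw a (\<lambda>a1 a2. F a1 a2 b1 b2))"
  by (induction a arbitrary: F rule: cops.induct) (simp_all add: sw_add)

text \<open>Coassociativity holds on words, before any relation is imposed: peeling off a theta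
  produces the same three terms on both sides.\<close>

lemma sw_coassoc: "sw w (\<lambda>x y. sw x (\<lambda>x1 x2. F x1 x2 y)) = sw w (\<lambda>x y. sw y (\<lambda>y1 y2. F x y1 y2))"
  by (induction w arbitrary: F rule: cops.induct) (simp_all add: sw_add add_ac)

lemma sw_eps_left: "sw w (\<lambda>u v. eps u * F v) = F w"
  by (induction w arbitrary: F rule: cops.induct) (simp_all add: sw_times_left[symmetric])

lemma sw_eps_right: "sw w (\<lambda>u v. eps v * F u) = F w"
  by (induction w arbitrary: F rule: cops.induct) (simp_all add: sw_times_left[symmetric])

lemma sw_eps_left_scale: "sw w (\<lambda>u v. scale (eps u) (F v)) = F w"
  by (induction w arbitrary: F rule: cops.induct) simp_all

lemma sw_eps_right_scale: "sw w (\<lambda>u v. scale (eps v) (F u)) = F w"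
  by (induction w arbitrary: F rule: cops.induct) simp_all

lemma sw_map_bgen: "sw (map (map_bgen t) w) F = sw w (\<lambda>u v. F (map (map_bgen t) u) (map (map_bgen t) v))"
  by (induction w arbitrary: F rule: cops.induct) simp_all

section \<open>Threefold and fourfold coproducts\<close>

definition sw3 :: "'i word \<Rightarrow> ('i word \<Rightarrow> 'i word \<Rightarrow> 'i word \<Rightarrow> 'v::comm_monoid_add) \<Rightarrow> 'v" where
  "sw3 w F = sw w (\<lambda>x y. sw y (\<lambda>y1 y2. F x y1 y2))"

lemma sw3_left: "sw w (\<lambda>x y. sw x (\<lambda>x1 x2. F x1 x2 y)) = sw3 w F"
  unfolding sw3_def by (rule sw_coassoc)

lemma sw3_right: "sw w (\<lambda>x y. sw y (\<lambda>y1 y2. F x y1 y2)) = sw3 w F"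
  unfolding sw3_def ..

lemma sw3_sw_swap: "sw3 a (\<lambda>a1 a2 a3. sw b (\<lambda>b1 b2. F a1 a2 a3 b1 b2)) = sw b (\<lambda>b1 b2. sw3 a (\<lambda>a1 a2 a3. F a1 a2 a3 b1 b2))"
proof -
  have "(\<lambda>x y. sw y (\<lambda>y1 y2. sw b (\<lambda>b1 b2. F x y1 y2 b1 b2))) = (\<lambda>x y. sw b (\<lambda>b1 b2. sw y (\<lambda>y1 y2. F x y1 y2 b1 b2)))"
    by (intro ext) (rule sw_swap)
  then show ?thesis unfolding sw3_def by (simp only:) (rule sw_swap)
qed

lemma sw3_swap: "sw3 a (\<lambda>a1 a2 a3. sw3 b (\<lambda>b1 b2 b3. F a1 a2 a3 b1 b2 b3)) = sw3 b (\<lambda>b1 b2 b3. sw3 a (\<lambda>a1 a2 a3. F a1 a2 a3 b1 b2 b3))"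
  unfolding sw3_def[of b] by (simp only: sw3_sw_swap)

text \<open>The lemmas that follow record the bracketings of a fourfold coproduct that arise when
  factors are regrouped in \<open>Phw_mult\<close>.\<close>

definition sw4 :: "'i word \<Rightarrow> ('i word \<Rightarrow> 'i word \<Rightarrow> 'i word \<Rightarrow> 'i word \<Rightarrow> 'v::comm_monoid_add) \<Rightarrow> 'v" where
  "sw4 w F = sw w (\<lambda>x r. sw r (\<lambda>y s. sw s (\<lambda>z t. F x y z t)))"

lemma sw4_mid: "sw w (\<lambda>x r. sw r (\<lambda>y z. sw y (\<lambda>y1 y2. F x y1 y2 z))) = sw4 w F"
  unfolding sw4_def by (simp only: sw_coassoc)

lemma sw4_pair: "sw w (\<lambda>p r. sw p (\<lambda>p1 p2. sw r (\<lambda>r1 r2. F p1 p2 r1 r2))) = sw4 w F"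
  unfolding sw4_def by (rule sw_coassoc)

lemma sw4_left_aux: "sw w (\<lambda>p t. sw p (\<lambda>x q. sw q (\<lambda>y z. F x y z t))) = sw4 w F"
  unfolding sw4_def by (subst sw_coassoc) (simp only: sw_coassoc)

lemma sw3_times_left: "c * sw3 w F = sw3 w (\<lambda>x y z. c * F x y z)" for c :: "'a::semiring_0"
  by (simp only: sw3_def sw_times_left)

lemma sw3_times_right: "sw3 w F * c = sw3 w (\<lambda>x y z. F x y z * c)" for c :: "'a::semiring_0"
  by (simp only: sw3_def sw_times_right)

lemma sw3_scale: "scale c (sw3 w F) = sw3 w (\<lambda>x y z. scale c (F x y z))"
  by (simp only: sw3_def sw_scale)

lemma sw4_first3: "sw w (\<lambda>x r. sw3 r (\<lambda>y z t. F x y z t)) = sw4 w F"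
  by (simp only: sw4_def sw3_def)

lemma sw4_mid3: "sw3 w (\<lambda>x y z. sw y (\<lambda>y1 y2. F x y1 y2 z)) = sw4 w F"
  unfolding sw3_def by (rule sw4_mid)

lemma sw4_last3: "sw3 w (\<lambda>x y z. sw z (\<lambda>z1 z2. F x y z1 z2)) = sw4 w F"
  by (simp only: sw4_def sw3_def)

lemma sw4_pair2: "sw w (\<lambda>p r. sw r (\<lambda>r1 r2. sw p (\<lambda>p1 p2. F p1 p2 r1 r2))) = sw4 w F"
  using sw4_pair[of w F] by (subst (asm) sw_swap)

lemma sw4_left3: "sw w (\<lambda>p t. sw3 p (\<lambda>x y z. F x y z t)) = sw4 w F"
  unfolding sw3_def by (rule sw4_left_aux)

section \<open>The pairing on words\<close>

definition vp :: "int \<Rightarrow> qfield" where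
  "vp n = vq powi n"

locale pairing =
  fixes s :: "'i \<Rightarrow> 'i \<Rightarrow> int" and kap :: "'i \<Rightarrow> qfield"
begin

text \<open>The axioms of a Hopf pairing force this shape. \<open>pl\<close> splits a word against
  one letter by the coproduct of the letter, and \<open>psi\<close> splits the second argument by
  its own coproduct. Group-like letters pair multiplicatively, so an inverse letter receives the
  inverse value.\<close>

fun pl2 :: "'i bgen \<Rightarrow> 'i bgen \<Rightarrow> qfield" where
  "pl2 (GTheta i) (GTheta j) = (if i = j then kap i else 0)"
| "pl2 (GH i) (GH j) = vp (s i j)"
| "pl2 (GHinv i) (GH j) = vp (- s i j)"
| "pl2 (GH i) (GHinv j) = vp (- s i j)"
| "pl2 (GHinv i) (GHinv j) = vp (s i j)"
| "pl2 _ _ = 0"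

fun pl :: "'i bgen \<Rightarrow> 'i word \<Rightarrow> qfield" where
  "pl (GTheta i) [] = 0"
| "pl (GH i) [] = 1"
| "pl (GHinv i) [] = 1"
| "pl (GTheta i) (g # w) = pl2 (GTheta i) g * eps w + pl2 (GH i) g * pl (GTheta i) w"
| "pl (GH i) (g # w) = pl2 (GH i) g * pl (GH i) w"
| "pl (GHinv i) (g # w) = pl2 (GHinv i) g * pl (GHinv i) w"

fun psi :: "'i word \<Rightarrow> 'i word \<Rightarrow> qfield" where
  "psi [] u = eps u"
| "psi (g # w) u = sw u (\<lambda>u1 u2. pl g u1 * psi w u2)"

lemma psi_letter: "psi [g] u = pl g u"
  using sw_eps_right[of u "pl g"] by (simp add: mult.commute)

lemma psi_append_left: "psi (a @ b) u = sw u (\<lambda>u1 u2. psi a u1 * psi b u2)"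
proof (induction a arbitrary: u)
  case Nil then show ?case by (simp add: sw_eps_left)
next
  case (Cons g a)
  have "psi ((g # a) @ b) u = sw u (\<lambda>x y. sw y (\<lambda>y1 y2. pl g x * (psi a y1 * psi b y2)))"
    by (simp add: Cons sw_times_left)
  also have "\<dots> = sw u (\<lambda>x y. sw x (\<lambda>x1 x2. pl g x1 * (psi a x2 * psi b y)))"
    by (rule sw_coassoc[symmetric])
  finally show ?case by (simp add: sw_times_right mult.assoc)
qed

lemma pl_append: "pl g (u @ u') = sw [g] (\<lambda>a b. psi a u * psi b u')"
proof -
  have H: "pl g (u @ u') = pl g u * pl g u'" if "\<not> is_theta g" for g
    using that by (induction u) (cases g; simp)+
  have T: "pl (GTheta i) (u @ u') = pl (GTheta i) u * eps u' + pl (GH i) u * pl (GTheta i) u'" for i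
    by (induction u) (simp_all add: algebra_simps)
  show ?thesis by (cases g) (simp_all add: T H psi_letter del: psi.simps(2))
qed

text \<open>\<open>psi_append_left\<close> is one multiplicativity axiom of the pairing, this is the
  other. For a single letter it is \<open>pl_append\<close>; since the coproduct respects
  concatenation, it spreads to words.\<close>

lemma psi_append_right: "psi a (u @ u') = sw a (\<lambda>a1 a2. psi a1 u * psi a2 u')"
proof (induction a arbitrary: u u')
  case (Cons g a)
  have "psi (g # a) (u @ u') =
     sw u (\<lambda>u1 u2. sw u' (\<lambda>v1 v2. sw [g] (\<lambda>g1 g2. psi g1 u1 * psi g2 v1) * sw a (\<lambda>a1 a2. psi a1 u2 * psi a2 v2)))"
    by (simp add: sw_append Cons pl_append)
  also have "\<dots> = sw u (\<lambda>u1 u2. sw u' (\<lambda>v1 v2. sw [g] (\<lambda>g1 g2. sw a (\<lambda>a1 a2. (psi g1 u1 * psi a1 u2) * (psi g2 v1 * psi a2 v2)))))"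
    by (simp only: sw_times_left sw_times_right mult_ac)
  also have "\<dots> = sw [g] (\<lambda>g1 g2. sw a (\<lambda>a1 a2. sw u (\<lambda>u1 u2. sw u' (\<lambda>v1 v2. (psi g1 u1 * psi a1 u2) * (psi g2 v1 * psi a2 v2)))))"
    by (simp only: sw_swap[where a = u' and b = "[g]"] sw_swap[where a = u' and b = a]
          sw_swap[where a = u and b = "[g]"] sw_swap[where a = u and b = a])
  also have "\<dots> = sw [g] (\<lambda>g1 g2. sw a (\<lambda>a1 a2. psi (g1 @ a1) u * psi (g2 @ a2) u'))"
    by (simp only: sw_times_left[symmetric] sw_times_right[symmetric] psi_append_left)
  also have "\<dots> = sw ([g] @ a) (\<lambda>a1 a2. psi a1 u * psi a2 u')"
    by (rule sw_append[symmetric])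
  finally show ?case by simp
qed simp

lemma psi_Nil_right: "psi a [] = eps a"
proof (induction a)
  case (Cons g a) then show ?case by (cases g) simp_all
qed simp

end

section \<open>Congruences modulo two-sided ideals\<close>

definition tsid :: "('m::monoid_add) vec set \<Rightarrow> bool" where
  "tsid N \<longleftrightarrow> lsub scale N \<and> (\<forall>x\<in>N. \<forall>y. y * x \<in> N \<and> x * y \<in> N)"

definition cg :: "'v::ab_group_add set \<Rightarrow> 'v \<Rightarrow> 'v \<Rightarrow> bool" where
  "cg N x y \<longleftrightarrow> x - y \<in> N"

lemma tsid_lsub: "tsid N \<Longrightarrow> lsub scale N"
  by (simp add: tsid_def)

lemma tsid_idl [simp, intro]: "tsid (idl R)"
  by (simp add: tsid_def idl_mult_left idl_mult_right)

lemma cg_refl: "lsub s N \<Longrightarrow> cg N x x"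
  by (simp add: cg_def lsub_def)

lemma cg_sym: "lsub scale N \<Longrightarrow> cg N x y \<Longrightarrow> cg N y x"
  unfolding cg_def using lsub_uminus[OF vs_scale, of N "x - y"] by simp

lemma cg_trans: "lsub s N \<Longrightarrow> cg N x y \<Longrightarrow> cg N y z \<Longrightarrow> cg N x z"
  unfolding cg_def by (drule (2) lsub_add) simp

lemma cg_add: "lsub s N \<Longrightarrow> cg N x y \<Longrightarrow> cg N x' y' \<Longrightarrow> cg N (x + x') (y + y')"
  unfolding cg_def by (drule (2) lsub_add) (simp add: algebra_simps)

lemma cg_scale: "lsub scale N \<Longrightarrow> cg N x y \<Longrightarrow> cg N (scale c x) (scale c y)"
  unfolding cg_def by (drule (1) lsub_scale[where c = c]) (simp add: sc.scale_right_diff_distrib)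

lemma cg_diff: "lsub scale N \<Longrightarrow> cg N x y \<Longrightarrow> cg N x' y' \<Longrightarrow> cg N (x - x') (y - y')"
  unfolding cg_def by (drule (2) lsub_diff[OF vs_scale]) (simp add: algebra_simps)

lemma cg_sum: "lsub s N \<Longrightarrow> (\<And>a. a \<in> A \<Longrightarrow> cg N (f a) (g a)) \<Longrightarrow> cg N (sum f A) (sum g A)"
  unfolding cg_def sum_subtractf[symmetric] by (rule lsub_sum) auto

lemma cg_mult: "tsid N \<Longrightarrow> cg N x y \<Longrightarrow> cg N x' y' \<Longrightarrow> cg N (x * x') (y * y')"
proof -
  assume *: "tsid N" "cg N x y" "cg N x' y'"
  have "(x - y) * x' + y * (x' - y') \<in> N"
    using * unfolding tsid_def cg_def by (intro lsub_add[of scale N]) auto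
  then show ?thesis by (simp add: cg_def algebra_simps)
qed

lemma cg_multl: "tsid N \<Longrightarrow> cg N x y \<Longrightarrow> cg N (z * x) (z * y)"
  by (rule cg_mult) (auto intro: cg_refl tsid_lsub)

lemma cg_multr: "tsid N \<Longrightarrow> cg N x y \<Longrightarrow> cg N (x * z) (y * z)"
  by (rule cg_mult) (auto intro: cg_refl tsid_lsub)

lemma cg_mem: "lsub s N \<Longrightarrow> cg N x y \<Longrightarrow> y \<in> N \<Longrightarrow> x \<in> N"
  unfolding cg_def by (drule (2) lsub_add) simp

lemma cg_sw: "lsub s N \<Longrightarrow> (\<And>u v. (u, v) \<in> cops w \<Longrightarrow> cg N (F u v) (G u v)) \<Longrightarrow> cg N (sw w F) (sw w G)"
  unfolding cg_def sw_diff[symmetric] by (rule sw_closed) (auto intro: lsub_add)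

section \<open>Tensors over words and coideals\<close>

definition tens :: "'m vec \<Rightarrow> 'n vec \<Rightarrow> ('m \<times> 'n) vec" where
  "tens x y = lin scale (\<lambda>u. lin scale (\<lambda>v. mon (u, v)) y) x"

lemma tens_add_left: "tens (x + x') y = tens x y + tens x' y"
  and tens_scale_left: "tens (scale c x) y = scale c (tens x y)"
  and tens_diff_left: "tens (x - x') y = tens x y - tens x' y"
  by (simp_all add: tens_def)

lemma tens_zero [simp]: "tens 0 y = 0" "tens x 0 = 0"
  by (simp_all add: tens_def)

lemma tens_add_right: "tens x (y + y') = tens x y + tens x y'"
  by (simp add: tens_def lin_fun_add)

lemma tens_scale_right: "tens x (scale c y) = scale c (tens x y)"
  unfolding tens_def using lmap_lin[OF lmap_scale, symmetric] by (simp add: lmap_lin[OF lmap_scale])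

lemma tens_diff_right: "tens x (y - y') = tens x y - tens x y'"
  using tens_add_right[of x "y - y'" y'] by (simp add: algebra_simps)

lemma tens_mon [simp]: "tens (mon u) (mon v) = mon (u, v)"
  by (simp add: tens_def)

lemma tens_mult: "tens x y * tens x' y' = tens (x * x') (y * y' :: ('n::monoid_add) vec)"
  for x :: "('m::monoid_add) vec"
proof (induction x rule: vec_induct)
  case (mon k c)
  show ?case
  proof (induction y rule: vec_induct)
    case m2: (mon k2 c2)
    show ?case
    proof (induction x' rule: vec_induct)
      case m3: (mon k3 c3)
      show ?case
      proof (induction y' rule: vec_induct)
        case m4: (mon k4 c4)
        show ?case
          by (simp only: scale_mult tens_scale_left tens_scale_right tens_mon mult_single plus_prod_def fst_conv snd_conv mult_1 sc.scale_scale mult_ac)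
      qed (simp_all add: tens_add_right distrib_left)
    qed (simp_all add: tens_add_left distrib_left)
  qed (simp_all add: tens_add_right distrib_left distrib_right)
qed (simp_all add: tens_add_left distrib_right)

lemma vs_one [simp]: "vector_space s \<Longrightarrow> s 1 x = x"
  by (simp add: module.scale_one flip: module_iff_vector_space)

lemma lin_tens:
  assumes "vector_space s"
  shows "lin s (\<lambda>(u, v). F u v) (tens x y) = lin s (\<lambda>u. lin s (F u) y) x"
  by (simp add: tens_def lmap_lin[OF lmap_lin_self[OF assms]] assms)

text \<open>For an ideal \<open>X\<close> of the free algebra \<open>A\<close>, the subspace
  \<open>X \<otimes> A + A \<otimes> X\<close> of \<open>A \<otimes> A\<close> in which the
  coproduct of a coideal has to lie.\<close>

inductive_set span2 :: "'m vec set \<Rightarrow> ('m \<times> 'm) vec set" for X where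
  span2_0: "0 \<in> span2 X"
| span2_add: "x \<in> span2 X \<Longrightarrow> y \<in> span2 X \<Longrightarrow> x + y \<in> span2 X"
| span2_left: "x \<in> X \<Longrightarrow> tens x y \<in> span2 X"
| span2_right: "x \<in> X \<Longrightarrow> tens y x \<in> span2 X"

lemma span2_scale: "z \<in> span2 X \<Longrightarrow> scale c z \<in> span2 X"
proof (induction rule: span2.induct)
  case (span2_left x y)
  show ?case unfolding tens_scale_right[symmetric] by (rule span2.span2_left[OF span2_left])
next
  case (span2_right x y)
  show ?case unfolding tens_scale_left[symmetric] by (rule span2.span2_right[OF span2_right])
qed (auto simp: sc.scale_right_distrib intro: span2.intros)

lemma lsub_span2 [simp, intro]: "lsub scale (span2 X)"
  by (auto simp: lsub_def intro: span2.intros span2_scale)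

lemma tens_decomp: 
  assumes "lsub scale N" "\<And>u v. z * tens (mon u) (mon v) \<in> N"
  shows "z * t \<in> (N :: ('m::monoid_add \<times> 'n::monoid_add) vec set)"
proof (induction t rule: vec_induct)
  case (mon k c)
  show ?case using assms(2)[of "fst k" "snd k"] assms(1) by (simp add: lsub_scale scale_mult del: scale_single)
qed (use assms(1) in \<open>auto simp: lsub_def distrib_left\<close>)

lemma tens_decomp': 
  assumes "lsub scale N" "\<And>u v. tens (mon u) (mon v) * z \<in> N"
  shows "t * z \<in> (N :: ('m::monoid_add \<times> 'n::monoid_add) vec set)"
proof (induction t rule: vec_induct)
  case (mon k c)
  show ?case using assms(2)[of "fst k" "snd k"] assms(1) by (simp add: lsub_scale scale_mult del: scale_single)
qed (use assms(1) in \<open>auto simp: lsub_def distrib_right\<close>)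

lemma tsid_span2 [simp, intro]:
  assumes "tsid X" shows "tsid (span2 X)"
proof -
  have "\<forall>u v. z * tens (mon u) (mon v) \<in> span2 X \<and> tens (mon u) (mon v) * z \<in> span2 X" if "z \<in> span2 X" for z
    using that
  proof (induction rule: span2.induct)
    case (span2_left x y)
    then show ?case unfolding tens_mult using assms by (auto simp: tsid_def intro!: span2.span2_left)
  next
    case (span2_right x y)
    then show ?case unfolding tens_mult using assms by (auto simp: tsid_def intro!: span2.span2_right)
  qed (auto simp: distrib_left distrib_right intro: span2.intros)
  then show ?thesis
    unfolding tsid_def using tens_decomp[OF lsub_span2] tens_decomp'[OF lsub_span2] by blast
qed

lemma span2_mono: "z \<in> span2 X \<Longrightarrow> X \<subseteq> X' \<Longrightarrow> z \<in> span2 X'"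
  by (induction rule: span2.induct) (auto intro: span2.intros)

lemma lin_span2:
  assumes "vector_space s" "lsub s N"
    and "\<And>x v. x \<in> X \<Longrightarrow> lin s (\<lambda>u. F u v) x \<in> N"
    and "\<And>x u. x \<in> X \<Longrightarrow> lin s (F u) x \<in> N"
    and "z \<in> span2 X"
  shows "lin s (\<lambda>(u, v). F u v) z \<in> N"
  using assms(5)
proof (induction rule: span2.induct)
  case (span2_left x y)
  have "lin s (\<lambda>(u, v). F u v) (tens x y) = lin s (\<lambda>v. lin s (\<lambda>u. F u v) x) y"
    unfolding lin_tens[OF assms(1)] by (rule lin_swap[OF assms(1)])
  also have "\<dots> \<in> N" by (rule lsub_lin[OF assms(2)]) (rule assms(3)[OF span2_left])
  finally show ?case .
next
  case (span2_right x y)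
  show ?case unfolding lin_tens[OF assms(1)]
    by (rule lsub_lin[OF assms(2)]) (rule assms(4)[OF span2_right])
qed (use assms(1,2) in \<open>auto simp: lsub_def\<close>)

definition Del :: "'i word vec \<Rightarrow> ('i word \<times> 'i word) vec" where
  "Del = lin scale (\<lambda>w. sw w (\<lambda>u v. mon (u, v)))"

lemma Del_mult: "Del (x * y) = Del x * Del y"
  unfolding Del_def
  by (rule lin_monoid_hom)
    (simp add: plus_list_def sw_append sw_times_left sw_times_right mult_single plus_prod_def,
     rule sw_swap)

lemma Del_linear [simp]: "Del (x + y) = Del x + Del y" "Del (x - y) = Del x - Del y"
    "Del (scale c x) = scale c (Del x)" "Del 0 = 0" "Del (mon w) = sw w (\<lambda>u v. mon (u, v))"
  by (simp_all add: Del_def)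

lemma lin_Del:
  assumes "vector_space s"
  shows "lin s (\<lambda>(u, v). F u v) (Del x) = lin s (\<lambda>w. sw w F) x"
  unfolding Del_def
  by (subst lmap_lin[OF lmap_lin_self[OF assms]])
     (simp add: sw_lin[OF assms] assms)

text \<open>The coproduct is multiplicative and \<open>span2\<close> of a two-sided ideal is again a
  two-sided ideal, so the coideal condition passes from the relations to everything they
  generate.\<close>

lemma coideal:
  assumes "\<And>r. r \<in> R \<Longrightarrow> Del r \<in> span2 (idl R)" and "x \<in> idl R"
  shows "Del x \<in> span2 (idl R)"
  using assms(2)
proof (induction rule: idl.induct)
  case (idl_gen r c a b)
  have "tsid (span2 (idl R))" by auto
  with assms(1)[OF idl_gen] have "Del (mon a * r * mon b) \<in> span2 (idl R)"
    unfolding Del_mult by (simp add: tsid_def)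
  then show ?case unfolding Del_linear by (rule span2_scale)
qed (auto intro: span2.intros)

text \<open>The mechanism by which Sweedler-type formulas descend to quotients: in
  \<open>span2 X\<close> one of the two slots carries an element of \<open>X\<close>, and
  \<open>F\<close> sends that into \<open>N\<close> whatever stands in the other slot.\<close>

lemma conv_kill:
  assumes "vector_space s" "lsub s N" "Del x \<in> span2 X"
    and "\<And>v z. z \<in> X \<Longrightarrow> lin s (\<lambda>u. F u v) z \<in> N"
    and "\<And>u z. z \<in> X \<Longrightarrow> lin s (F u) z \<in> N"
  shows "lin s (\<lambda>w. sw w F) x \<in> N"
  unfolding lin_Del[OF assms(1), symmetric] using lin_span2[of s N X F, OF assms(1,2,4,5,3)] .

section \<open>The coproduct of a quantum Serre element\<close>

text \<open>Gaussian binomial coefficients in the normalisation with nonnegative powers of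
  \<open>p\<close>, which is the one that commuting \<open>th\<close> past \<open>H\<close>
  produces. The truncated difference \<open>k - l\<close> is harmless, as
  \<open>gbin p k l = 0\<close> when \<open>k < l\<close>.\<close>

fun gbin :: "qfield \<Rightarrow> nat \<Rightarrow> nat \<Rightarrow> qfield" where
  "gbin p k 0 = 1"
| "gbin p 0 (Suc l) = 0"
| "gbin p (Suc k) (Suc l) = gbin p k (Suc l) + p ^ (k - l) * gbin p k l"

lemma gbin_zero: "k < l \<Longrightarrow> gbin p k l = 0"
  by (induction p k l rule: gbin.induct) simp_all

lemma gbin_diag: "gbin p k k = 1"
  by (induction k) (simp_all add: gbin_zero)

text \<open>The mirror image of the defining Pascal rule; \<open>al_Suc\<close> combines the
  two.\<close>

lemma gbin_pascal2: "gbin p (Suc k) (Suc l) = p ^ Suc l * gbin p k (Suc l) + gbin p k l"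
proof (induction k arbitrary: l)
  case 0 then show ?case by (cases l) simp_all
next
  case (Suc k)
  show ?case
  proof (cases l)
    case 0
    have "gbin p (Suc (Suc k)) (Suc 0) = gbin p (Suc k) (Suc 0) + p ^ Suc k" by simp
    also have "\<dots> = p * gbin p k (Suc 0) + 1 + p * p ^ k" using Suc[of 0] by simp
    also have "\<dots> = p * gbin p (Suc k) (Suc 0) + 1" by (simp add: algebra_simps)
    finally show ?thesis using 0 by simp
  next
    case l: (Suc l')
    show ?thesis
    proof (cases "l \<le> k")
      case True
      then obtain e where e: "k = l + e" using le_Suc_ex by blast
      have "gbin p (Suc (Suc k)) (Suc l) = gbin p (Suc k) (Suc l) + p ^ Suc e * gbin p (Suc k) l"
        using e by (simp add: Suc_diff_le del: gbin.simps(3)) (simp add: gbin.simps(3)[of p "Suc k"] e)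
      also have "\<dots> = p ^ Suc l * gbin p k (Suc l) + gbin p k l + p ^ Suc e * (p ^ l * gbin p k l + gbin p k l')"
        unfolding Suc[of l] using Suc[of l'] l by simp
      also have "\<dots> = p ^ Suc l * (gbin p k (Suc l) + p ^ e * gbin p k l) + (gbin p k l + p ^ Suc e * gbin p k l')"
        by (simp add: algebra_simps power_add)
      also have "gbin p k (Suc l) + p ^ e * gbin p k l = gbin p (Suc k) (Suc l)" using e by simp
      also have "gbin p k l + p ^ Suc e * gbin p k l' = gbin p (Suc k) l" using e l by (simp add: Suc_diff_le)
      finally show ?thesis .
    next
      case False
      then have "gbin p k l = 0" "gbin p k (Suc l) = 0" "gbin p (Suc k) (Suc l) = 0" by (simp_all add: gbin_zero)
      with False show ?thesis by (simp add: gbin.simps(3)[of p "Suc k"] del: gbin.simps(3))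
    qed
  qed
qed

text \<open>In the application \<open>th\<close>, \<open>th'\<close> are
  \<open>\<vartheta>\<^sub>i\<close>, \<open>\<vartheta>\<^sub>j\<close>, and \<open>H\<close>,
  \<open>H'\<close> are \<open>h\<^sub>i\<close>, \<open>h\<^sub>j\<close>; \<open>Q\<close> is
  \<open>v\<^sub>i\<^sup>2\<close>, \<open>Z\<close> is \<open>v\<^sub>i\<close> to the power
  \<open>c\<^sub>i\<^sub>j\<close>, and the congruences are torus relations.\<close>

locale serre_coproduct =
  fixes N :: "('m::monoid_add) vec set" and th th' H H' :: "'m vec" and Q Z :: qfield
  assumes N: "tsid N"
    and H_th: "cg N (H * th) (scale Q (th * H))"
    and H_th': "cg N (H * th') (scale Z (th' * H))"
    and H'_th: "cg N (H' * th) (scale Z (th * H'))"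
    and H_H': "cg N (H' * H) (H * H')"
begin

text \<open>The factor \<open>Z * Q ^ k\<close> is the scalar by which \<open>H\<close> passes
  \<open>Y k\<close> (see \<open>HY\<close>). With it the cross terms
  \<open>Y k * H \<otimes> th\<close> and \<open>H * Y k \<otimes> th\<close> cancel in the
  coproduct.\<close>

fun Y :: "nat \<Rightarrow> 'm vec" where
  "Y 0 = th'"
| "Y (Suc k) = scale (Z * Q ^ k) (Y k * th) - th * Y k"

fun DY :: "nat \<Rightarrow> ('m \<times> 'm) vec" where
  "DY 0 = tens th' 1 + tens H' th'"
| "DY (Suc k) = scale (Z * Q ^ k) (DY k * (tens th 1 + tens H th)) - (tens th 1 + tens H th) * DY k"

definition U :: "nat \<Rightarrow> nat \<Rightarrow> ('m \<times> 'm) vec" where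
  "U k l = tens (th ^ (k - l) * H ^ l * H') (Y l)"

text \<open>The coefficients in the coproduct of \<open>Y k\<close>. When
  \<open>Z ^ 2 * Q ^ k = 1\<close>, a zero factor enters every \<open>al (Suc k) l\<close> with
  \<open>l \<le> k\<close>; this is what makes the Serre element skew-primitive.\<close>

definition al :: "nat \<Rightarrow> nat \<Rightarrow> qfield" where
  "al k l = gbin Q k l * (\<Prod>t = l..<k. Z ^ 2 * Q ^ t - 1)"

lemmas Nl = tsid_lsub[OF N]
lemmas cr = cg_refl[OF Nl]
lemmas ct = cg_trans[OF Nl]

lemma al_Suc: "al (Suc k) (Suc l) = (Z ^ 2 * Q ^ (k + Suc l) - 1) * al k (Suc l) + Q ^ (k - l) * al k l"
proof (cases "l < k")
  case True
  define P where "P = (\<Prod>t = Suc l..<k. Z ^ 2 * Q ^ t - 1)"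
  have P0: "(\<Prod>t = l..<k. Z ^ 2 * Q ^ t - 1) = (Z ^ 2 * Q ^ l - 1) * P"
    unfolding P_def using True by (simp add: prod.atLeast_Suc_lessThan)
  have P1: "(\<Prod>t = Suc l..<Suc k. Z ^ 2 * Q ^ t - 1) = (Z ^ 2 * Q ^ k - 1) * P"
    unfolding P_def using True by (simp add: mult.commute)
  obtain e where e: "k = l + e" using True less_imp_add_positive by blast
  have g1: "gbin Q (Suc k) (Suc l) = gbin Q k (Suc l) + Q ^ e * gbin Q k l" using e by simp
  have g2: "gbin Q (Suc k) (Suc l) = Q ^ Suc l * gbin Q k (Suc l) + gbin Q k l" by (rule gbin_pascal2)
  \<comment> \<open>Multiply the mirror Pascal rule by \<open>Z ^ 2 * Q ^ k\<close> and subtract the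
    defining one.\<close>
  have "gbin Q (Suc k) (Suc l) * (Z ^ 2 * Q ^ k - 1)
      = Z ^ 2 * Q ^ k * (Q ^ Suc l * gbin Q k (Suc l) + gbin Q k l) - (gbin Q k (Suc l) + Q ^ e * gbin Q k l)"
    unfolding g2[symmetric] g1[symmetric] by (simp add: algebra_simps)
  also have "\<dots> = (Z ^ 2 * Q ^ (k + Suc l) - 1) * gbin Q k (Suc l) + Q ^ e * ((Z ^ 2 * Q ^ l - 1) * gbin Q k l)"
    using e by (simp add: algebra_simps power_add)
  finally have "gbin Q (Suc k) (Suc l) * (Z ^ 2 * Q ^ k - 1) * P
      = ((Z ^ 2 * Q ^ (k + Suc l) - 1) * gbin Q k (Suc l) + Q ^ e * ((Z ^ 2 * Q ^ l - 1) * gbin Q k l)) * P"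
    by simp
  then show ?thesis
    unfolding al_def P0 P1 P_def[symmetric] using e by (simp only: mult.assoc distrib_right add_diff_cancel_left')
      (simp only: mult_ac)
next
  case False
  then show ?thesis
    by (cases "l = k") (simp_all add: al_def gbin_zero gbin_diag del: gbin.simps)
qed

lemma al_0: "al (Suc k) 0 = (Z ^ 2 * Q ^ k - 1) * al k 0"
  by (simp add: al_def mult.commute)

lemma H_pow: "cg N (H * th ^ n) (scale (Q ^ n) (th ^ n * H))"
proof (induction n)
  case (Suc n)
  have "cg N (H * th * th ^ n) (scale Q (th * H) * th ^ n)" by (rule cg_multr[OF N H_th])
  moreover have "cg N (scale Q (th * H) * th ^ n) (scale Q (th * scale (Q ^ n) (th ^ n * H)))"
    using cg_scale[OF Nl cg_multl[OF N Suc, of th], of Q] by (simp add: scale_mult mult.assoc)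
  ultimately have "cg N (H * th * th ^ n) (scale Q (th * scale (Q ^ n) (th ^ n * H)))" by (rule ct)
  then show ?case by (simp add: scale_mult mult.assoc)
qed (simp add: cr)

lemma HY: "cg N (H * Y k) (scale (Z * Q ^ k) (Y k * H))"
proof (induction k)
  case (Suc k)
  let ?c = "Z * Q ^ k"
  have a: "cg N (H * Y k * th) (scale (?c * Q) (Y k * th * H))"
  proof (rule ct)
    show "cg N (H * Y k * th) (scale ?c (Y k * H) * th)" by (rule cg_multr[OF N Suc])
    show "cg N (scale ?c (Y k * H) * th) (scale (?c * Q) (Y k * th * H))"
      using cg_scale[OF Nl cg_multl[OF N H_th, of "Y k"], of ?c] by (simp add: scale_mult mult.assoc)
  qed
  have b: "cg N (H * th * Y k) (scale (?c * Q) (th * Y k * H))"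
  proof (rule ct)
    show "cg N (H * th * Y k) (scale Q (th * H) * Y k)" by (rule cg_multr[OF N H_th])
    show "cg N (scale Q (th * H) * Y k) (scale (?c * Q) (th * Y k * H))"
      using cg_scale[OF Nl cg_multl[OF N Suc, of th], of Q] by (simp add: scale_mult mult_ac)
  qed
  have "cg N (scale ?c (H * Y k * th) - H * th * Y k) (scale ?c (scale (?c * Q) (Y k * th * H)) - scale (?c * Q) (th * Y k * H))"
    by (rule cg_diff[OF Nl cg_scale[OF Nl a] b])
  then show ?case
    by (simp add: algebra_simps scale_mult sc.scale_right_diff_distrib)
qed (simp add: H_th')

lemma HlH': "cg N (H ^ l * H' * th) (scale (Z * Q ^ l) (th * H ^ l * H'))"
proof (induction l)
  case (Suc l)
  have "cg N (H * (H ^ l * H' * th)) (H * scale (Z * Q ^ l) (th * H ^ l * H'))" by (rule cg_multl[OF N Suc])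
  moreover have "cg N (H * scale (Z * Q ^ l) (th * H ^ l * H')) (scale (Z * Q ^ l) (scale Q (th * H) * (H ^ l * H')))"
    using cg_scale[OF Nl cg_multr[OF N H_th, of "H ^ l * H'"], of "Z * Q ^ l"] by (simp add: scale_mult mult.assoc)
  ultimately have "cg N (H * (H ^ l * H' * th)) (scale (Z * Q ^ l) (scale Q (th * H) * (H ^ l * H')))" by (rule ct)
  then show ?case by (simp add: scale_mult mult_ac)
qed (simp add: H'_th)

lemma H'H: "cg N (H ^ l * H' * H) (H ^ Suc l * H')"
proof -
  have "cg N (H ^ l * (H' * H)) (H ^ l * (H * H'))" by (rule cg_multl[OF N H_H'])
  then show ?thesis by (simp add: power_Suc2 mult.assoc del: power_Suc)
qed

lemma cg_tens_left: "cg N x x' \<Longrightarrow> cg (span2 N) (tens x y) (tens x' y)"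
  unfolding cg_def tens_diff_left[symmetric] by (rule span2_left)

lemmas N2 = tsid_span2[OF N]
lemmas Nl2 = tsid_lsub[OF N2]

lemma U_th: "l \<le> k \<Longrightarrow> cg (span2 N) (scale (Z * Q ^ k) (U k l * tens th 1) - tens th 1 * U k l)
   (scale (Z ^ 2 * Q ^ (k + l) - 1) (U (Suc k) l))"
proof -
  assume l: "l \<le> k"
  have "cg N (th ^ (k - l) * (H ^ l * H' * th)) (th ^ (k - l) * scale (Z * Q ^ l) (th * H ^ l * H'))"
    by (rule cg_multl[OF N HlH'])
  then have "cg N (th ^ (k - l) * H ^ l * H' * th) (scale (Z * Q ^ l) (th ^ Suc (k - l) * H ^ l * H'))"
    by (simp add: scale_mult mult.assoc power_Suc2 del: power_Suc)
  from cg_scale[OF Nl this, of "Z * Q ^ k"]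
  have "cg N (scale (Z * Q ^ k) (th ^ (k - l) * H ^ l * H' * th) - th * (th ^ (k - l) * H ^ l * H'))
    (scale (Z ^ 2 * Q ^ (k + l) - 1) (th ^ Suc (k - l) * H ^ l * H'))"
    by (simp add: cg_def sc.scale_left_diff_distrib mult.assoc power_add power2_eq_square)
       (simp add: mult_ac)
  from cg_tens_left[OF this, of "Y l"] show ?thesis
    using l by (simp add: U_def tens_mult tens_diff_left tens_scale_left Suc_diff_le)
qed

lemma U_H: "l \<le> k \<Longrightarrow> cg (span2 N) (scale (Z * Q ^ k) (U k l * tens H th) - tens H th * U k l)
   (scale (Q ^ (k - l)) (U (Suc k) (Suc l)))"
proof -
  assume l: "l \<le> k"
  have a: "cg N (th ^ (k - l) * H ^ l * H' * H) (th ^ (k - l) * H ^ Suc l * H')"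
    using cg_multl[OF N H'H, of "th ^ (k - l)" l] by (simp add: mult.assoc)
  have b: "cg N (H * (th ^ (k - l) * H ^ l * H')) (scale (Q ^ (k - l)) (th ^ (k - l) * H ^ Suc l * H'))"
    using cg_multr[OF N H_pow, of "k - l" "H ^ l * H'"] by (simp add: scale_mult mult.assoc)
  have c: "Z * Q ^ k = Q ^ (k - l) * (Z * Q ^ l)"
    using l by (simp flip: power_add)
  have "cg (span2 N) (scale (Z * Q ^ k) (tens (th ^ (k - l) * H ^ l * H' * H) (Y l * th)) - tens (H * (th ^ (k - l) * H ^ l * H')) (th * Y l))
     (scale (Z * Q ^ k) (tens (th ^ (k - l) * H ^ Suc l * H') (Y l * th)) - tens (scale (Q ^ (k - l)) (th ^ (k - l) * H ^ Suc l * H')) (th * Y l))"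
    by (intro cg_diff[OF Nl2] cg_scale[OF Nl2] cg_tens_left a b)
  also have "(scale (Z * Q ^ k) (tens (th ^ (k - l) * H ^ Suc l * H') (Y l * th)) - tens (scale (Q ^ (k - l)) (th ^ (k - l) * H ^ Suc l * H')) (th * Y l))
     = scale (Q ^ (k - l)) (tens (th ^ (k - l) * H ^ Suc l * H') (Y (Suc l)))"
    unfolding c by (simp add: tens_diff_right tens_scale_right tens_scale_left sc.scale_right_diff_distrib)
  finally show ?thesis using l by (simp add: U_def tens_mult)
qed

text \<open>Commuting with \<open>th \<otimes> 1\<close> keeps the index \<open>l\<close> and
  commuting with \<open>H \<otimes> th\<close> raises it by one. Collecting both contributions gives
  the recursion \<open>al_Suc\<close>.\<close>

lemma DY: "cg (span2 N) (DY k) (tens (Y k) 1 + (\<Sum>l\<le>k. scale (al k l) (U k l)))"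
proof (induction k)
  case 0
  show ?case by (simp add: U_def al_def cg_refl[OF Nl2])
next
  case (Suc k)
  let ?c = "Z * Q ^ k" and ?X = "tens th 1 + tens H th"
  let ?op = "\<lambda>z. scale ?c (z * ?X) - ?X * z"
  have op_add: "?op (x + y) = ?op x + ?op y" for x y
    by (simp add: algebra_simps sc.scale_right_distrib)
  have op_scale: "?op (scale a x) = scale a (?op x)" for a x
    by (simp add: scale_mult sc.scale_right_diff_distrib mult.commute)
  have op_sum: "?op (sum g A) = (\<Sum>a\<in>A. ?op (g a))" for g and A :: "nat set"
    by (simp add: sum_distrib_left sum_distrib_right sc.scale_sum_right sum_subtractf)
  have 1: "cg (span2 N) (?op (tens (Y k) 1)) (tens (Y (Suc k)) 1)"
  proof -
    have "cg N (scale ?c (Y k * H) - H * Y k) 0"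
      using cg_sym[OF Nl HY[of k]] by (simp add: cg_def)
    from cg_tens_left[OF this, of th]
    have "cg (span2 N) (tens (Y (Suc k)) 1 + tens (scale ?c (Y k * H) - H * Y k) th) (tens (Y (Suc k)) 1)"
      by (simp add: cg_def)
    then show ?thesis
      by (simp add: distrib_left distrib_right tens_mult tens_diff_left tens_scale_left sc.scale_right_distrib algebra_simps)
  qed
  have 2: "cg (span2 N) (?op (U k l)) (scale (Z ^ 2 * Q ^ (k + l) - 1) (U (Suc k) l) + scale (Q ^ (k - l)) (U (Suc k) (Suc l)))"
    if "l \<le> k" for l
    using cg_add[OF Nl2 U_th[OF that] U_H[OF that]]
    by (simp add: distrib_left distrib_right sc.scale_right_distrib algebra_simps)
  have 3: "cg (span2 N) (?op (DY k)) (?op (tens (Y k) 1 + (\<Sum>l\<le>k. scale (al k l) (U k l))))"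
    by (intro cg_diff[OF Nl2] cg_scale[OF Nl2] cg_multr[OF N2] cg_multl[OF N2] Suc)
  have 4: "cg (span2 N) (?op (tens (Y k) 1 + (\<Sum>l\<le>k. scale (al k l) (U k l))))
     (tens (Y (Suc k)) 1 + (\<Sum>l\<le>k. scale (al k l) (scale (Z ^ 2 * Q ^ (k + l) - 1) (U (Suc k) l) + scale (Q ^ (k - l)) (U (Suc k) (Suc l)))))"
    unfolding op_add op_sum op_scale
    by (intro cg_add[OF Nl2] 1 cg_sum[OF Nl2] cg_scale[OF Nl2] 2) auto
  have 5: "(\<Sum>l\<le>k. scale (al k l) (scale (Z ^ 2 * Q ^ (k + l) - 1) (U (Suc k) l) + scale (Q ^ (k - l)) (U (Suc k) (Suc l))))
     = (\<Sum>l\<le>Suc k. scale (al (Suc k) l) (U (Suc k) l))"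
  proof -
    have "(\<Sum>l\<le>Suc k. scale (al (Suc k) l) (U (Suc k) l))
       = scale (al (Suc k) 0) (U (Suc k) 0) + (\<Sum>l\<le>k. scale (al (Suc k) (Suc l)) (U (Suc k) (Suc l)))"
      by (rule sum.atMost_Suc_shift)
    also have "\<dots> = (scale ((Z ^ 2 * Q ^ k - 1) * al k 0) (U (Suc k) 0)
         + (\<Sum>l\<le>k. scale ((Z ^ 2 * Q ^ (k + Suc l) - 1) * al k (Suc l)) (U (Suc k) (Suc l))))
         + (\<Sum>l\<le>k. scale (Q ^ (k - l) * al k l) (U (Suc k) (Suc l)))"
      by (simp only: al_0 al_Suc sc.scale_left_distrib sum.distrib add.assoc)
    also have "scale ((Z ^ 2 * Q ^ k - 1) * al k 0) (U (Suc k) 0)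
         + (\<Sum>l\<le>k. scale ((Z ^ 2 * Q ^ (k + Suc l) - 1) * al k (Suc l)) (U (Suc k) (Suc l)))
       = (\<Sum>l\<le>Suc k. scale ((Z ^ 2 * Q ^ (k + l) - 1) * al k l) (U (Suc k) l))"
      by (subst sum.atMost_Suc_shift) simp
    also have "\<dots> = (\<Sum>l\<le>k. scale ((Z ^ 2 * Q ^ (k + l) - 1) * al k l) (U (Suc k) l))"
      by (simp add: al_def gbin_zero del: gbin.simps)
    finally show ?thesis
      by (simp add: sc.scale_right_distrib sum.distrib mult.commute)
  qed
  show ?case
    using cg_trans[OF Nl2 3 4] unfolding 5 DY.simps(2) .
qed

lemma DY_Serre:
  assumes "Z ^ 2 * Q ^ k = 1"
  shows "cg (span2 N) (DY (Suc k)) (tens (Y (Suc k)) 1 + tens (H ^ Suc k * H') (Y (Suc k)))"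
proof -
  have "al (Suc k) l = 0" if "l \<le> k" for l
    using that assms by (simp add: al_def)
  moreover have "al (Suc k) (Suc k) = 1" by (simp add: al_def gbin_diag del: gbin.simps)
  ultimately have "(\<Sum>l\<le>Suc k. scale (al (Suc k) l) (U (Suc k) l)) = tens (H ^ Suc k * H') (Y (Suc k))"
    by (simp add: U_def del: Y.simps)
  with DY[of "Suc k"] show ?thesis by (simp del: DY.simps Y.simps)
qed

end

section \<open>Powers of the quantum parameter\<close>

lemma vhalf_power: "vhalf ^ n = Fraction_Field.Fract (monom 1 n) 1"
  unfolding vhalf_def by (induction n) (simp_all add: One_fract_def monom_Suc)

lemma vq_power_neq_1: "n > 0 \<Longrightarrow> vq ^ n \<noteq> 1"
proof -
  assume "n > 0"
  then have "Polynomial.degree (monom (1::rat) (2 * n)) \<noteq> Polynomial.degree (1 :: rat poly)"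
    by (simp add: degree_monom_eq)
  then have "monom (1::rat) (2 * n) \<noteq> 1" by metis
  then have "vhalf ^ (2 * n) \<noteq> 1"
    unfolding vhalf_power by (simp add: One_fract_def eq_fract)
  then show ?thesis by (simp add: vq_def power_mult)
qed

lemma vhalf_nonzero: "vhalf \<noteq> 0"
  by (simp add: vhalf_def eq_fract Zero_fract_def)

lemma vq_nonzero [simp]: "vq \<noteq> 0"
  by (simp add: vq_def vhalf_nonzero)

lemma vp_0 [simp]: "vp 0 = 1"
  by (simp add: vp_def)

lemma vp_nonzero [simp]: "vp n \<noteq> 0"
  by (simp add: vp_def)

lemma vp_add: "vp (m + n) = vp m * vp n"
  by (simp add: vp_def power_int_add)

lemma vp_minus: "vp (- n) = inverse (vp n)"
  by (simp add: vp_def power_int_minus)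

lemma vp_cancel [simp]: "vp n * vp (- n) = 1" "vp (- n) * vp n = 1"
  by (simp_all flip: vp_add)

lemma vp_neq_1: "n > 0 \<Longrightarrow> vp n \<noteq> 1"
  using vq_power_neq_1[of "nat n"] by (simp add: vp_def power_int_def)

lemma vi_vp: "vi d i = vp (int (d i))"
  by (simp add: vi_def vp_def)

lemma vi_powi: "vi d i powi c = vp (int (d i) * c)"
  by (simp add: vi_def vp_def power_int_mult)

lemma vp_power: "vp n ^ k = vp (n * int k)"
  by (simp add: vp_def power_int_mult)

text \<open>No positive power of \<open>v\<close> equals \<open>1\<close>, so the denominators of
  the quantum binomials do not vanish.\<close>

lemma qint_vp_nonzero:
  assumes "m > 0" "n > 0" shows "qint (vp m) n \<noteq> 0"
proof -
  have "vp m ^ n \<noteq> inverse (vp m) ^ n"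
  proof
    assume "vp m ^ n = inverse (vp m) ^ n"
    then have "vp m ^ n * vp m ^ n = 1" by (simp add: field_simps)
    then have "vp (m * int n + m * int n) = 1" unfolding vp_add vp_power .
    then show False using vp_neq_1[of "m * int n + m * int n"] assms by simp
  qed
  moreover have "vp m \<noteq> inverse (vp m)"
  proof
    assume "vp m = inverse (vp m)"
    then have "vp m * vp m = 1" by (metis vp_nonzero right_inverse)
    then have "vp (m + m) = 1" unfolding vp_add .
    then show False using vp_neq_1[of "m + m"] assms by simp
  qed
  ultimately show ?thesis by (simp add: qint_def)
qed

section \<open>Quantum Serre elements as iterated commutators\<close>

definition srr :: "qfield \<Rightarrow> nat \<Rightarrow> 'g \<Rightarrow> 'g \<Rightarrow> 'g list vec" where
  "srr q m a b = (\<Sum>r\<in>{0..m}. scale ((- 1) ^ r * qbinomial q m r)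
     (mon (replicate r a @ [b] @ replicate (m - r) a)))"

lemma qfact_Suc: "qfact q (Suc n) = qint q (Suc n) * qfact q n"
  by (simp add: qfact_def)

context
  fixes q :: qfield
  assumes q0: "q \<noteq> 0" and qn: "\<And>n. n > 0 \<Longrightarrow> qint q n \<noteq> 0"
begin

lemma qfact_nonzero: "qfact q n \<noteq> 0"
  unfolding qfact_def using qn by simp

lemma qint_add: "qint q (a + b) = q ^ a * qint q b + inverse q ^ b * qint q a"
proof (cases "q - inverse q = 0")
  case True
  then show ?thesis using qn[of 1] by (simp add: qint_def)
next
  case False
  have "q ^ (a + b) - inverse q ^ (a + b)
      = q ^ a * (q ^ b - inverse q ^ b) + inverse q ^ b * (q ^ a - inverse q ^ a)"
    by (simp add: algebra_simps power_add)
  then show ?thesis by (simp add: qint_def add_divide_distrib)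
qed

lemma qbinomial_pascal:
  assumes "k = e + Suc r"
  shows "qbinomial q (Suc k) (Suc r) = q ^ Suc r * qbinomial q k (Suc r) + inverse q ^ Suc e * qbinomial q k r"
proof -
  let ?f = "qfact q"
  have nz: "?f n \<noteq> 0" for n by (rule qfact_nonzero)
  have nz': "qint q (Suc n) \<noteq> 0" for n by (rule qn) simp
  have "qint q (Suc k) = q ^ Suc r * qint q (Suc e) + inverse q ^ Suc e * qint q (Suc r)"
    using qint_add[of "Suc r" "Suc e"] assms by (simp add: add_ac)
  then show ?thesis
    using assms nz nz'
    by (simp add: qbinomial_def qfact_Suc Suc_diff_le field_simps)
qed

lemma qbinomial_0: "qbinomial q k 0 = 1" and qbinomial_diag: "qbinomial q k k = 1"
  using qfact_nonzero[of k] by (simp_all add: qbinomial_def qfact_def)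

text \<open>Up to the sign \<open>(- 1) ^ r\<close>, the coefficient in \<open>Y k\<close> of the
  word with \<open>r\<close> letters in front of \<open>th'\<close>, for \<open>Q = q ^ 2\<close>.
  The truncated \<open>k - 1\<close> is harmless, since for \<open>k = 0\<close> the outer exponent
  is zero.\<close>

definition bco :: "qfield \<Rightarrow> nat \<Rightarrow> nat \<Rightarrow> qfield" where
  "bco Z k r = (if r \<le> k then qbinomial q k r * (Z * q ^ (k - 1)) ^ (k - r) else 0)"

lemma bco_0: "bco Z (Suc k) 0 = Z * (q ^ 2) ^ k * bco Z k 0"
proof -
  have "(q ^ k) ^ Suc k = (q ^ 2) ^ k * (q ^ (k - 1)) ^ k"
  proof -
    have "k * Suc k = 2 * k + (k - 1) * k" by (cases k) simp_all
    then show ?thesis unfolding power_mult[symmetric] power_add[symmetric] by (rule arg_cong)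
  qed
  then show ?thesis
    by (simp add: bco_def qbinomial_0 power_mult_distrib mult_ac del: power_Suc) (simp add: mult_ac)
qed

lemma bco_Suc: "bco Z (Suc k) (Suc r) = Z * (q ^ 2) ^ k * bco Z k (Suc r) + bco Z k r"
proof (cases "Suc r \<le> k")
  case True
  then obtain e where e: "k = e + Suc r" by (metis add.commute le_Suc_ex)
  have 1: "(Z * q ^ k) ^ Suc e * q ^ Suc r = Z * (q ^ 2) ^ k * (Z * q ^ (k - 1)) ^ e"
  proof -
    have "(q ^ k) ^ Suc e * q ^ Suc r = (q ^ 2) ^ k * (q ^ (k - 1)) ^ e"
      unfolding power_mult[symmetric] power_add[symmetric]
      by (rule arg_cong[where f = "(^) q"]) (simp add: e algebra_simps)
    then show ?thesis by (simp add: power_mult_distrib mult_ac del: power_Suc) (simp add: mult_ac)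
  qed
  have 2: "(Z * q ^ k) ^ Suc e * inverse q ^ Suc e = (Z * q ^ (k - 1)) ^ Suc e"
  proof -
    have "Z * q ^ k * inverse q = Z * q ^ (k - 1)" using e q0 by simp
    then show ?thesis unfolding power_mult_distrib[symmetric] by (rule arg_cong)
  qed
  have "bco Z (Suc k) (Suc r) = (Z * q ^ k) ^ Suc e * (q ^ Suc r * qbinomial q k (Suc r) + inverse q ^ Suc e * qbinomial q k r)"
  proof -
    have "bco Z (Suc k) (Suc r) = qbinomial q (Suc k) (Suc r) * (Z * q ^ k) ^ Suc e"
      using e by (simp add: bco_def)
    then show ?thesis unfolding qbinomial_pascal[OF e] by (simp only: mult.commute)
  qed
  also have "\<dots> = (Z * q ^ k) ^ Suc e * q ^ Suc r * qbinomial q k (Suc r)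
      + (Z * q ^ k) ^ Suc e * inverse q ^ Suc e * qbinomial q k r"
    by (simp only: distrib_left mult.assoc)
  also have "\<dots> = Z * (q ^ 2) ^ k * bco Z k (Suc r) + bco Z k r"
    unfolding 1 2 using e by (simp add: bco_def Suc_diff_le mult_ac)
  finally show ?thesis .
next
  case False
  then show ?thesis by (cases "r = k") (simp_all add: bco_def qbinomial_diag)
qed

lemma bco_zero: "r > k \<Longrightarrow> bco Z k r = 0"
  by (simp add: bco_def)

text \<open>Expanding one more commutator reproduces \<open>bco_Suc\<close>. At
  \<open>Z * q ^ k = 1\<close> the power in \<open>bco\<close> for \<open>Suc k\<close> disappears,
  which leaves the Serre coefficients.\<close>

lemma serre_iterated:
  assumes "serre_coproduct N (mon [a]) (mon [b]) H H' (q ^ 2) Z" "Z * q ^ k = 1"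
  shows "serre_coproduct.Y (mon [a]) (mon [b]) (q ^ 2) Z (Suc k) = srr q (Suc k) a b"
proof -
  interpret serre_coproduct N "mon [a]" "mon [b]" H H' "q ^ 2" Z by fact
  define W where "W k r = mon (replicate r a @ [b] @ replicate (k - r) a)" for k r
  have Yk: "Y k = (\<Sum>r\<le>k. scale ((- 1) ^ r * bco Z k r) (W k r))" for k
  proof (induction k)
    case 0
    show ?case by (simp add: bco_def qbinomial_0 W_def)
  next
    case (Suc k)
    have W1: "W k r * mon [a] = W (Suc k) r" if "r \<le> k" for r
      using that by (simp add: W_def mono_mult Suc_diff_le replicate_append_same)
    have W2: "mon [a] * W k r = W (Suc k) (Suc r)" for r
      by (simp add: W_def mono_mult)
    have "Y (Suc k) = (\<Sum>r\<le>k. scale (Z * (q ^ 2) ^ k * ((- 1) ^ r * bco Z k r)) (W (Suc k) r))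
        - (\<Sum>r\<le>k. scale ((- 1) ^ r * bco Z k r) (W (Suc k) (Suc r)))"
      by (simp add: Suc sum_distrib_right sum_distrib_left sc.scale_sum_right scale_mult W1 W2 del: scale_single)
    also have "(\<Sum>r\<le>k. scale (Z * (q ^ 2) ^ k * ((- 1) ^ r * bco Z k r)) (W (Suc k) r))
       = (\<Sum>r\<le>Suc k. scale (Z * (q ^ 2) ^ k * ((- 1) ^ r * bco Z k r)) (W (Suc k) r))"
      by (simp add: bco_zero del: scale_single)
    also have "\<dots> = scale (bco Z (Suc k) 0) (W (Suc k) 0)
       + (\<Sum>r\<le>k. scale (Z * (q ^ 2) ^ k * ((- 1) ^ Suc r * bco Z k (Suc r))) (W (Suc k) (Suc r)))"
      by (subst sum.atMost_Suc_shift) (simp add: bco_0 del: scale_single)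
    also have "\<dots> - (\<Sum>r\<le>k. scale ((- 1) ^ r * bco Z k r) (W (Suc k) (Suc r)))
       = scale (bco Z (Suc k) 0) (W (Suc k) 0)
       + (\<Sum>r\<le>k. scale ((- 1) ^ Suc r * (Z * (q ^ 2) ^ k * bco Z k (Suc r) + bco Z k r)) (W (Suc k) (Suc r)))"
      unfolding add_diff_eq[symmetric] sum_subtractf[symmetric] sc.scale_left_diff_distrib[symmetric]
      by (intro arg_cong2[of _ _ _ _ "(+)"] sum.cong) (simp_all add: algebra_simps)
    finally have "Y (Suc k) = \<dots>" .
    then show ?case
      unfolding bco_Suc[symmetric] by (subst sum.atMost_Suc_shift) (simp del: scale_single)
  qed
  show ?thesis
    unfolding Yk srr_def W_def using assms(2) by (intro sum.cong) (auto simp: bco_def)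
qed

end

section \<open>The relations of the Borel part\<close>

locale satake =
  fixes C :: "'i::finite \<Rightarrow> 'i \<Rightarrow> int" and d :: "'i \<Rightarrow> nat" and \<tau> :: "'i \<Rightarrow> 'i"
  assumes gcm: "symmetrizable_gcm C d" and qss: "quasi_split_satake C d \<tau>"
begin

text \<open>The symmetrised Cartan form; \<open>vp (s i j)\<close> is \<open>v\<^sub>i\<close> to
  the power \<open>c\<^sub>i\<^sub>j\<close>.\<close>

definition s :: "'i \<Rightarrow> 'i \<Rightarrow> int" where "s i j = int (d i) * C i j"

definition kap :: "'i \<Rightarrow> qfield" where "kap i = vi d i - inverse (vi d i)"

sublocale pairing s kap .

lemma s_sym: "s i j = s j i"
  using gcm by (simp add: s_def symmetrizable_gcm_def)

lemma s_diag: "s i i > 0"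
  using gcm by (simp add: s_def symmetrizable_gcm_def)

lemma tau_tau [simp]: "\<tau> (\<tau> i) = i"
  using qss unfolding quasi_split_satake_def by (metis comp_apply id_apply)

lemma s_tau [simp]: "s (\<tau> i) (\<tau> j) = s i j"
  using qss by (simp add: s_def quasi_split_satake_def)

lemma s_tau': "s (\<tau> i) j = s i (\<tau> j)"
  using s_tau[of i "\<tau> j"] by simp

lemma d_tau [simp]: "d (\<tau> i) = d i"
  using qss by (simp add: quasi_split_satake_def)

lemma kap_tau [simp]: "kap (\<tau> i) = kap i"
  by (simp add: kap_def vi_def)

text \<open>The Serre relations are kept apart because the torus relations have a coideal property
  of their own (\<open>Del_torus\<close>): the arguments about the pairing and about
  \<open>chi\<close> treat \<open>Jt\<close> first and then the Serre elements modulo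
  \<open>Jt\<close>.\<close>

definition torus_rels :: "'i word vec set" where
  "torus_rels =
     {mon [GH i, GH j] - mon [GH j, GH i] | i j. True}
   \<union> {mon [GH i, GTheta j] - scale (vp (s i j)) (mon [GTheta j, GH i]) | i j. True}
   \<union> {mon [GH i, GHinv i] - 1 | i. True}
   \<union> {mon [GHinv i, GH i] - 1 | i. True}"

definition sr :: "'i \<Rightarrow> 'i \<Rightarrow> 'i word vec" where
  "sr i j = srr (vi d i) (nat (1 - C i j)) (GTheta i) (GTheta j)"

definition serre_rels :: "'i word vec set" where
  "serre_rels = {sr i j | i j. i \<noteq> j}"

definition borel_rels :: "'i word vec set" where
  "borel_rels = torus_rels \<union> serre_rels"

abbreviation "Jt \<equiv> idl torus_rels"
abbreviation "J \<equiv> idl borel_rels"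

lemma torus_cases [consumes 1, case_names HH HT HI IH]:
  assumes "r \<in> torus_rels"
  obtains i j where "r = mon [GH i, GH j] - mon [GH j, GH i]"
  | i j where "r = mon [GH i, GTheta j] - scale (vp (s i j)) (mon [GTheta j, GH i])"
  | i where "r = mon [GH i, GHinv i] - 1"
  | i where "r = mon [GHinv i, GH i] - 1"
  using assms unfolding torus_rels_def by blast

lemma Jt_J: "x \<in> Jt \<Longrightarrow> x \<in> J"
  by (erule idl_mono_set) (simp add: borel_rels_def)

lemma Del_torus:
  assumes "r \<in> torus_rels" shows "Del r \<in> span2 torus_rels"
  using assms
proof (cases r rule: torus_cases)
  case (HH i j)
  then have "Del r = tens r (mon [GH i, GH j]) + tens (mon [GH j, GH i]) r"
    by (simp add: tens_diff_left tens_diff_right)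
  then show ?thesis using assms by (auto intro: span2.intros)
next
  case (HT i j)
  let ?r = "mon [GH i, GH j] - mon [GH j, GH i]"
  have "Del r = tens r (mon [GH i]) + tens ?r (mon [GH i, GTheta j]) + tens (mon [GH j, GH i]) r"
    unfolding HT by (simp add: tens_diff_left tens_diff_right tens_scale_left tens_scale_right algebra_simps
        flip: single_add del: scale_single)
  moreover have "?r \<in> torus_rels" by (auto simp: torus_rels_def)
  ultimately show ?thesis using assms by (auto intro: span2.intros)
next
  case (HI i)
  then have "Del r = tens r (mon [GH i, GHinv i]) + tens (mon []) r"
    by (simp add: tens_diff_left tens_diff_right flip: mono_Nil)
  then show ?thesis using assms by (auto intro: span2.intros)
next
  case (IH i)
  then have "Del r = tens r (mon [GHinv i, GH i]) + tens (mon []) r"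
    by (simp add: tens_diff_left tens_diff_right flip: mono_Nil)
  then show ?thesis using assms by (auto intro: span2.intros)
qed

lemma cg_torus:
  "cg Jt (mon [GH i] * mon [GTheta j]) (scale (vp (s i j)) (mon [GTheta j] * mon [GH i]))"
  "cg Jt (mon [GH i] * mon [GH j]) (mon [GH j] * mon [GH i])"
  unfolding cg_def mono_mult by (rule idl_incl; force simp: torus_rels_def)+

text \<open>With \<open>k = - c\<^sub>i\<^sub>j\<close> one has
  \<open>Z * v\<^sub>i ^ k = 1\<close>. This identifies \<open>Y (Suc k)\<close> with the Serre
  element and, squared, is the condition of \<open>DY_Serre\<close>.\<close>

lemma Del_serre:
  assumes "i \<noteq> j"
  obtains h where "tfree h" "cg (span2 Jt) (Del (sr i j)) (tens (sr i j) 1 + tens (mon h) (sr i j))"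
proof -
  define k where "k = nat (- C i j)"
  have Cij: "C i j \<le> 0" "d i > 0" "C i i = 2" using gcm assms by (auto simp: symmetrizable_gcm_def)
  have k: "nat (1 - C i j) = Suc k" "int k = - C i j" using Cij by (simp_all add: k_def)
  let ?th = "mon [GTheta i]" and ?Z = "vp (s i j)" and ?Q = "(vi d i)\<^sup>2"
  have Q: "?Q = vp (s i i)" using Cij by (simp add: vi_vp vp_power s_def)
  interpret S: serre_coproduct Jt "mon [GTheta i]" "mon [GTheta j]" "mon [GH i]" "mon [GH j]" "?Q" "?Z"
    unfolding Q using cg_torus(1)[of i i] cg_torus(1)[of i j] cg_torus(1)[of j i] cg_torus(2)[of j i]
    by unfold_locales (simp_all add: s_sym[of j i])
  have ZQ: "?Z * (vi d i) ^ k = 1"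
    using k by (simp add: vi_vp vp_power s_def flip: vp_add)
  have Y: "S.Y (Suc k) = sr i j"
    unfolding sr_def k using S.serre_coproduct_axioms ZQ Cij
    by (intro serre_iterated[where N = Jt and H = "mon [GH i]" and H' = "mon [GH j]"])
       (simp_all add: vi_vp qint_vp_nonzero)
  have D1: "Del (mon [GTheta l]) = tens (mon [GTheta l]) 1 + tens (mon [GH l]) (mon [GTheta l])" for l
    by (simp flip: mono_Nil)
  have DY: "Del (S.Y n) = S.DY n" for n
  proof (induction n)
    case 0 show ?case unfolding S.Y.simps S.DY.simps by (rule D1)
  next
    case (Suc n)
    then show ?case unfolding S.Y.simps S.DY.simps Del_linear(2) Del_linear(3) Del_mult D1 by simp
  qed
  have Hpow: "mon [GH i] ^ n * mon [GH j] = mon (replicate n (GH i) @ [GH j])" for n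
    by (induction n) (simp_all add: mono_mult mult.assoc)
  have "?Z ^ 2 * ?Q ^ k = (?Z * (vi d i) ^ k) ^ 2"
    by (simp add: power_mult_distrib power2_eq_square mult_ac)
  then have "?Z ^ 2 * ?Q ^ k = 1" unfolding ZQ by simp
  from S.DY_Serre[OF this]
  have "cg (span2 Jt) (Del (sr i j)) (tens (sr i j) 1 + tens (mon (replicate (Suc k) (GH i) @ [GH j])) (sr i j))"
    unfolding DY[symmetric] Y Hpow .
  moreover have "tfree (replicate (Suc k) (GH i) @ [GH j])" by (auto simp: tfree_def)
  ultimately show thesis using that by blast
qed

lemma Del_J: "x \<in> J \<Longrightarrow> Del x \<in> span2 J"
proof (rule coideal)
  fix r assume "r \<in> borel_rels"
  then consider "r \<in> torus_rels" | i j where "i \<noteq> j" "r = sr i j"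
    by (auto simp: borel_rels_def serre_rels_def)
  then show "Del r \<in> span2 J"
  proof cases
    case 1
    from span2_mono[OF Del_torus[OF this]] show ?thesis using idl_incl[of _ borel_rels] by (auto simp: borel_rels_def)
  next
    case 2
    obtain h where h: "cg (span2 Jt) (Del r) (tens r 1 + tens (mon h) r)" using Del_serre 2 by metis
    have "r \<in> J" using 2 by (auto intro!: idl_incl simp: borel_rels_def serre_rels_def)
    then have "tens r 1 + tens (mon h) r \<in> span2 J" by (auto intro: span2.intros)
    moreover from h have "cg (span2 J) (Del r) (tens r 1 + tens (mon h) r)"
      unfolding cg_def by (rule span2_mono) (auto intro: Jt_J)
    ultimately show ?thesis by (rule cg_mem[OF lsub_span2, rotated])
  qed
qed

end

section \<open>The pairing descends to the quotient\<close>

lemma lin_times_left: "lin (*) (\<lambda>k. c * F k) x = c * lin (*) F x" for c :: qfield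
  unfolding lin_def sum_distrib_left by (rule sum.cong) simp_all

lemma lin_times_right: "lin (*) (\<lambda>k. F k * c) x = lin (*) F x * c" for c :: qfield
  unfolding lin_def sum_distrib_right by (rule sum.cong) simp_all

lemma vs_zero [simp]: "vector_space s \<Longrightarrow> s c 0 = 0"
  by (simp add: module.scale_zero_right module_iff_vector_space)

section \<open>Weights of words and the radical of the pairing\<close>

definition cnt :: "'i \<Rightarrow> 'i word \<Rightarrow> nat" where
  "cnt k w = count_list w (GTheta k)"

lemma cnt_simps [simp]:
  "cnt k [] = 0" "cnt k (GTheta i # w) = (if i = k then Suc (cnt k w) else cnt k w)"
  "cnt k (GH i # w) = cnt k w" "cnt k (GHinv i # w) = cnt k w" "cnt k (u @ v) = cnt k u + cnt k v"
  by (simp_all add: cnt_def)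

lemma cnt_cops: "(u, v) \<in> cops w \<Longrightarrow> cnt k u + cnt k v = cnt k w"
  by (induction w arbitrary: u v rule: cops.induct) (fastforce split: prod.splits)+

lemma tfree_cnt: "tfree w \<Longrightarrow> cnt k w = 0"
  unfolding tfree_def cnt_def by (intro count_notin) auto

lemma sw_neq_0:
  assumes "sw w F \<noteq> 0" obtains u v where "(u, v) \<in> cops w" "F u v \<noteq> 0"
  using sw_cong_cops[of w F "\<lambda>_ _. 0"] assms by force

context pairing
begin

text \<open>A theta pairs only with a theta of the same index, so the pairing preserves weight. This
  is aimed at Serre elements, all of whose words contain two different thetas.\<close>

lemma pl_cnt: "pl g u \<noteq> 0 \<Longrightarrow> cnt k u = cnt k [g]"
proof (induction u)
  case Nil then show ?case by (cases g) simp_all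
next
  case (Cons a u)
  then show ?case
    by (cases g; cases a) (auto simp: eps_def tfree_cnt split: if_splits)
qed

lemma psi_cnt: "psi w u \<noteq> 0 \<Longrightarrow> cnt k w = cnt k u"
proof (induction w arbitrary: u)
  case Nil then show ?case by (auto simp: eps_def tfree_cnt split: if_splits)
next
  case (Cons g w)
  from Cons.prems obtain u1 u2 where u: "(u1, u2) \<in> cops u" "pl g u1 * psi w u2 \<noteq> 0"
    by (auto elim: sw_neq_0)
  then have "cnt k u1 = cnt k [g]" "cnt k w = cnt k u2" using pl_cnt Cons.IH by auto
  moreover have "cnt k (g # w) = cnt k [g] + cnt k w" by (simp flip: cnt_simps(5))
  ultimately show ?case using cnt_cops[OF u(1), of k] by simp
qed

lemma psi_two: "psi [g, g'] u = sw u (\<lambda>x y. pl g x * pl g' y)"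
  by (simp only: psi.simps(2)[of g "[g']"] psi_letter)

text \<open>Induction on the length of \<open>u\<close>. Splitting off its first letter turns the
  claim into a Sweedler sum over \<open>x\<close>, where the coideal condition leaves a pairing with
  one letter or with the shorter word. Hence \<open>X\<close> needs testing only against letters and
  the empty word; \<open>Y\<close> holds elements already known to pair to zero.\<close>

lemma kill_left:
  assumes "\<And>x. x \<in> X \<Longrightarrow> Del x \<in> span2 (X \<union> Y)"
    and Y: "\<And>y u. y \<in> Y \<Longrightarrow> lin (*) (\<lambda>w. psi w u) y = 0"
    and eps: "\<And>x. x \<in> X \<Longrightarrow> lin (*) eps x = 0"
    and g: "\<And>x g. x \<in> X \<Longrightarrow> lin (*) (\<lambda>w. psi w [g]) x = 0"
  shows "x \<in> X \<Longrightarrow> lin (*) (\<lambda>w. psi w u) x = 0"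
proof (induction u arbitrary: x)
  case Nil then show ?case by (simp add: psi_Nil_right eps)
next
  case (Cons a u)
  have "lin (*) (\<lambda>w. sw w (\<lambda>w1 w2. psi w1 [a] * psi w2 u)) x \<in> {0}"
    by (rule conv_kill[OF vs_times lsub_zero[OF vs_times] assms(1)[OF Cons.prems]])
       (use Y g Cons.IH in \<open>auto simp: lin_times_left lin_times_right\<close>)
  then show ?case using psi_append_right[of _ "[a]" u] by simp
qed

lemma kill_right:
  assumes "\<And>x. x \<in> X \<Longrightarrow> Del x \<in> span2 (X \<union> Y)"
    and Y: "\<And>y w. y \<in> Y \<Longrightarrow> lin (*) (psi w) y = 0"
    and eps: "\<And>x. x \<in> X \<Longrightarrow> lin (*) eps x = 0"
    and g: "\<And>x g. x \<in> X \<Longrightarrow> lin (*) (pl g) x = 0"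
  shows "x \<in> X \<Longrightarrow> lin (*) (psi w) x = 0"
proof (induction w arbitrary: x)
  case Nil then show ?case using eps by (simp add: eps fun_eq_iff cong: lin_cong)
next
  case (Cons a w)
  have "lin (*) (pl a) y = 0" if "y \<in> Y" for y
  proof -
    have "psi [a] = pl a" by (rule ext) (rule psi_letter)
    then show ?thesis using Y[OF that, of "[a]"] by simp
  qed
  then have "lin (*) (\<lambda>u. sw u (\<lambda>u1 u2. pl a u1 * psi w u2)) x \<in> {0}"
    by (intro conv_kill[OF vs_times lsub_zero[OF vs_times] assms(1)[OF Cons.prems]])
       (use Y g Cons.IH in \<open>auto simp: lin_times_left lin_times_right\<close>)
  then show ?case by simp
qed

lemma kill_left_ideal:
  assumes "\<And>r u. r \<in> R \<Longrightarrow> lin (*) (\<lambda>w. psi w u) r = 0" and "x \<in> idl R"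
  shows "lin (*) (\<lambda>w. psi w u) x = 0"
proof -
  have "lin (*) (\<lambda>w. psi w u) x \<in> {0}"
  proof (rule lin_idl[OF vs_times lsub_zero[OF vs_times] _ assms(2)])
    fix r a b assume "r \<in> R"
    then show "lin (*) (\<lambda>w. psi (a + w + b) u) r \<in> {0}"
      by (simp add: plus_list_def psi_append_left lin_sw lin_times_left lin_times_right assms(1))
  qed
  then show ?thesis by simp
qed

lemma kill_right_ideal:
  assumes "\<And>r w. r \<in> R \<Longrightarrow> lin (*) (psi w) r = 0" and "x \<in> idl R"
  shows "lin (*) (psi w) x = 0"
proof -
  have "lin (*) (psi w) x \<in> {0}"
  proof (rule lin_idl[OF vs_times lsub_zero[OF vs_times] _ assms(2)])
    fix r a b assume "r \<in> R"
    then show "lin (*) (\<lambda>u. psi w (a + u + b)) r \<in> {0}"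
      by (simp add: plus_list_def psi_append_right lin_sw lin_times_left lin_times_right assms(1))
  qed
  then show ?thesis by simp
qed

end

lemma lin_mono_one: "vector_space s \<Longrightarrow> lin s F 1 = F []"
  by (simp flip: mono_Nil)

context satake
begin

lemma sr_m: "i \<noteq> j \<Longrightarrow> nat (1 - C i j) \<ge> 1"
  using gcm by (force simp: symmetrizable_gcm_def)

lemma lin_sr_0:
  assumes "vector_space t"
    and "\<And>r. r \<le> nat (1 - C i j) \<Longrightarrow> F (replicate r (GTheta i) @ [GTheta j] @ replicate (nat (1 - C i j) - r) (GTheta i)) = 0"
  shows "lin t F (sr i j) = 0"
  using assms unfolding sr_def srr_def by simp

lemma cnt_replicate [simp]: "cnt k (replicate r (GTheta i)) = (if k = i then r else 0)"
  by (induction r) auto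

text \<open>Every word of the Serre element contains both thetas, \<open>\<vartheta>\<^sub>i\<close>
  because \<open>1 - c\<^sub>i\<^sub>j\<close> is at least \<open>1\<close>, whereas the weight of a
  single letter involves at most one index.\<close>

lemma pl_sr: "i \<noteq> j \<Longrightarrow> lin (*) (pl g) (sr i j) = 0"
proof (rule lin_sr_0[OF vs_times])
  fix r assume ij: "i \<noteq> j" and r: "r \<le> nat (1 - C i j)"
  let ?w = "replicate r (GTheta i) @ [GTheta j] @ replicate (nat (1 - C i j) - r) (GTheta i)"
  have "cnt i ?w \<noteq> 0" "cnt j ?w \<noteq> 0" using ij r sr_m[OF ij] by simp_all
  then have *: "pl g ?w \<noteq> 0 \<Longrightarrow> cnt i [g] \<noteq> 0 \<and> cnt j [g] \<noteq> 0"
    using pl_cnt[of g ?w i] pl_cnt[of g ?w j] by metis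
  show "pl g ?w = 0"
  proof (rule ccontr)
    assume "pl g ?w \<noteq> 0"
    from *[OF this] show False using ij by (cases g) (auto split: if_splits)
  qed
qed

lemma psi_sr: "i \<noteq> j \<Longrightarrow> lin (*) (\<lambda>w. psi w [g]) (sr i j) = 0"
proof (rule lin_sr_0[OF vs_times])
  fix r assume ij: "i \<noteq> j" and r: "r \<le> nat (1 - C i j)"
  let ?w = "replicate r (GTheta i) @ [GTheta j] @ replicate (nat (1 - C i j) - r) (GTheta i)"
  have "cnt i ?w \<noteq> 0" "cnt j ?w \<noteq> 0" using ij r sr_m[OF ij] by simp_all
  then have *: "psi ?w [g] \<noteq> 0 \<Longrightarrow> cnt i [g] \<noteq> 0 \<and> cnt j [g] \<noteq> 0"
    using psi_cnt[of ?w "[g]" i] psi_cnt[of ?w "[g]" j] by metis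
  show "psi ?w [g] = 0"
  proof (rule ccontr)
    assume "psi ?w [g] \<noteq> 0"
    from *[OF this] show False using ij by (cases g) (auto split: if_splits)
  qed
qed

lemma eps_sr: "lin (*) eps (sr i j) = 0"
  by (rule lin_sr_0[OF vs_times]) simp

lemma torus_base:
  assumes "r \<in> torus_rels"
  shows "lin (*) eps r = 0" "lin (*) (pl g) r = 0" "lin (*) (\<lambda>w. psi w [g]) r = 0"
  using assms by (cases r rule: torus_cases; cases g; simp add: lin_mono_one vp_minus s_sym mult_ac)+

lemma Jt_left: "x \<in> Jt \<Longrightarrow> lin (*) (\<lambda>w. psi w u) x = 0"
  by (rule kill_left_ideal[rotated], assumption, rule kill_left[of torus_rels "{}"])
     (auto simp: torus_base Del_torus simp del: psi.simps)

lemma Jt_right: "x \<in> Jt \<Longrightarrow> lin (*) (psi w) x = 0"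
  by (rule kill_right_ideal[rotated], assumption, rule kill_right[of torus_rels "{}"])
     (auto simp: torus_base Del_torus simp del: psi.simps)

lemma Del_serre_span: "r \<in> serre_rels \<Longrightarrow> Del r \<in> span2 (serre_rels \<union> Jt)"
proof -
  assume r: "r \<in> serre_rels"
  then obtain i j where ij: "i \<noteq> j" "r = sr i j" by (auto simp: serre_rels_def)
  obtain h where h: "cg (span2 Jt) (Del r) (tens r 1 + tens (mon h) r)" using Del_serre ij by metis
  then have "cg (span2 (serre_rels \<union> Jt)) (Del r) (tens r 1 + tens (mon h) r)"
    unfolding cg_def by (rule span2_mono) auto
  moreover have "tens r 1 + tens (mon h) r \<in> span2 (serre_rels \<union> Jt)" using r by (auto intro: span2.intros)
  ultimately show ?thesis by (rule cg_mem[OF lsub_span2])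
qed

text \<open>Two stages: the torus ideal pairs to zero by itself, and the Serre elements satisfy the
  hypotheses of \<open>kill_left\<close> with \<open>Y = Jt\<close>.\<close>

lemma psi_J_left: "x \<in> J \<Longrightarrow> lin (*) (\<lambda>w. psi w u) x = 0"
proof (rule kill_left_ideal[of borel_rels])
  fix r u assume "r \<in> borel_rels"
  then consider "r \<in> torus_rels" | "r \<in> serre_rels" by (auto simp: borel_rels_def)
  then show "lin (*) (\<lambda>w. psi w u) r = 0"
  proof cases
    case 1 then show ?thesis by (intro Jt_left idl_incl)
  next
    case 2 then show ?thesis
      by (rule kill_left[of serre_rels Jt, rotated -1])
        (auto simp: Del_serre_span Jt_left, auto simp: serre_rels_def psi_sr eps_sr simp del: psi.simps)
  qed
qed

lemma psi_J_right: "x \<in> J \<Longrightarrow> lin (*) (psi w) x = 0"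
proof (rule kill_right_ideal[of borel_rels])
  fix r w assume "r \<in> borel_rels"
  then consider "r \<in> torus_rels" | "r \<in> serre_rels" by (auto simp: borel_rels_def)
  then show "lin (*) (psi w) r = 0"
  proof cases
    case 1 then show ?thesis by (intro Jt_right idl_incl)
  next
    case 2 then show ?thesis
      by (rule kill_right[of serre_rels Jt, rotated -1])
        (auto simp: Del_serre_span Jt_right, auto simp: serre_rels_def pl_sr eps_sr)
  qed
qed

lemma eps_J: "x \<in> J \<Longrightarrow> lin (*) eps x = 0"
  using psi_J_left[of x "[]"] by (simp add: psi_Nil_right)

section \<open>The twisted product on words\<close>

abbreviation tw :: "'i word \<Rightarrow> 'i word" where "tw \<equiv> map (map_bgen \<tau>)"

text \<open>The involution preserves the Cartan matrix and the symmetrizer, so it permutes the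
  relations of each kind.\<close>

lemma tw_idl_borel: "x \<in> J \<Longrightarrow> lin scale (\<lambda>w. mon (tw w)) x \<in> J"
proof (rule lin_idl[OF vs_scale lsub_idl])
  fix r a b assume "r \<in> borel_rels"
  then have r: "lin scale (\<lambda>w. mon (tw w)) r \<in> borel_rels"
  proof -
    assume "r \<in> borel_rels"
    then consider "r \<in> torus_rels" | i j where "i \<noteq> j" "r = sr i j" by (auto simp: borel_rels_def serre_rels_def)
    then show ?thesis
    proof cases
      case 1
      have "lin scale (\<lambda>w. mon (tw w)) r \<in> torus_rels" using 1
      proof (cases r rule: torus_cases)
        case (HT i j)
        then have "lin scale (\<lambda>w. mon (tw w)) r
          = mon [GH (\<tau> i), GTheta (\<tau> j)] - scale (vp (s (\<tau> i) (\<tau> j))) (mon [GTheta (\<tau> j), GH (\<tau> i)])"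
          by simp
        then show ?thesis unfolding torus_rels_def by blast
      qed (auto simp: torus_rels_def lin_mono_one mono_Nil)
      then show ?thesis by (simp add: borel_rels_def)
    next
      case 2
      have "lin scale (\<lambda>w. mon (tw w)) r = sr (\<tau> i) (\<tau> j)"
        using qss unfolding 2 sr_def srr_def by (simp add: vi_def quasi_split_satake_def)
      moreover have "\<tau> i \<noteq> \<tau> j" using 2 tau_tau by metis
      ultimately show ?thesis by (auto simp: borel_rels_def serre_rels_def)
    qed
  qed
  have "lin scale (\<lambda>w. mon (tw (a + w + b))) r = mon (tw a) * lin scale (\<lambda>w. mon (tw w)) r * mon (tw b)"
    by (simp add: plus_list_def lmap_lin[OF lmap_mult_left] lmap_lin[OF lmap_mult_right] mono_mult)
  then show "lin scale (\<lambda>w. mon (tw (a + w + b))) r \<in> J"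
    using r by (auto intro: idl_incl idl_mult_left idl_mult_right)
qed

definition pt :: "'i word \<Rightarrow> 'i word \<Rightarrow> qfield" where
  "pt w u = psi (tw w) u"

lemma pt_append_left: "pt (a @ b) u = sw u (\<lambda>u1 u2. pt a u1 * pt b u2)"
  by (simp add: pt_def psi_append_left)

lemma pt_append_right: "pt a (u @ u') = sw a (\<lambda>a1 a2. pt a1 u * pt a2 u')"
  by (simp add: pt_def psi_append_right sw_map_bgen)

lemma pt_Nil: "pt [] u = eps u"
  by (simp add: pt_def)

lemma pt_J_left: "x \<in> J \<Longrightarrow> lin (*) (\<lambda>w. pt w u) x = 0"
  using psi_J_left[OF tw_idl_borel, of x u] by (simp add: pt_def lmap_lin[OF lmap_lin_self])

lemma pt_J_right: "x \<in> J \<Longrightarrow> lin (*) (pt w) x = 0"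
  using psi_J_right[of x "tw w"] by (simp add: pt_def[abs_def])

definition star :: "'i word \<Rightarrow> 'i word \<Rightarrow> 'i word vec" where
  "star a b = sw a (\<lambda>a1 a2. sw b (\<lambda>b1 b2. scale (pt b2 a1) (mon (a2 @ b1))))"

definition STAR :: "'i word vec \<Rightarrow> 'i word vec \<Rightarrow> 'i word vec" where
  "STAR x y = lin scale (\<lambda>a. lin scale (star a) y) x"

lemma STAR_mon: "STAR (mon a) (mon b) = star a b"
  by (simp add: STAR_def)

lemma STAR_linear:
  "STAR (x + x') y = STAR x y + STAR x' y" "STAR (scale c x) y = scale c (STAR x y)" "STAR 0 y = 0"
  "STAR x (y + y') = STAR x y + STAR x y'" "STAR x (scale c y) = scale c (STAR x y)" "STAR x 0 = 0"
  by (simp_all add: STAR_def lin_fun_add lmap_lin[OF lmap_scale])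

end

context satake
begin

text \<open>Both sides are the sum over threefold coproducts of
  \<open>a\<^sub>3 b\<^sub>2 c\<^sub>1\<close> with coefficient \<open>\<phi> (\<tau> b\<^sub>3,
  a\<^sub>1) \<phi> (\<tau> c\<^sub>2, a\<^sub>2) \<phi> (\<tau> c\<^sub>3, b\<^sub>1)\<close>. The
  left side gets it from the pairing axiom for a product in the second argument, the right side from
  the one in the first.\<close>

lemma star_assoc_words:
  "STAR (star a b) (mon c) = STAR (mon a) (star b c)"
proof -
  let ?G = "\<lambda>a1 a2 a3 b1 b2 b3 c1 c2 c3. scale (pt b3 a1 * (pt c2 a2 * pt c3 b1)) (mon (a3 @ b2 @ c1))"
  have "STAR (star a b) (mon c) = sw a (\<lambda>a1 a'. sw b (\<lambda>b' b3. scale (pt b3 a1) (star (a' @ b') c)))"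
    by (simp add: STAR_def star_def[of a b] sw_lin)
  also have "\<dots> = sw a (\<lambda>a1 a'. sw b (\<lambda>b' b3. sw a' (\<lambda>a2 a3. sw b' (\<lambda>b1 b2. sw c (\<lambda>c1 c'. sw c' (\<lambda>c2 c3. ?G a1 a2 a3 b1 b2 b3 c1 c2 c3))))))"
    by (simp add: star_def sw_append pt_append_right sw_scale sw_scale_left mult.commute sw_times_left sw_times_right mult_ac del: scale_single)
  also have "\<dots> = sw a (\<lambda>a1 a'. sw a' (\<lambda>a2 a3. sw b (\<lambda>b' b3. sw b' (\<lambda>b1 b2. sw c (\<lambda>c1 c'. sw c' (\<lambda>c2 c3. ?G a1 a2 a3 b1 b2 b3 c1 c2 c3))))))"
    by (simp only: sw_swap[where a = b])
  also have "\<dots> = sw3 a (\<lambda>a1 a2 a3. sw3 b (\<lambda>b1 b2 b3. sw3 c (\<lambda>c1 c2 c3. ?G a1 a2 a3 b1 b2 b3 c1 c2 c3)))"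
    by (simp only: sw3_left sw3_right)
  finally have L: "STAR (star a b) (mon c) = \<dots>" .
  have "STAR (mon a) (star b c) = sw b (\<lambda>b1 b'. sw c (\<lambda>c' c3. scale (pt c3 b1) (star a (b' @ c'))))"
    by (simp add: STAR_def star_def[of b c] sw_lin)
  also have "\<dots> = sw b (\<lambda>b1 b'. sw c (\<lambda>c' c3. sw a (\<lambda>a' a3. sw b' (\<lambda>b2 b3. sw c' (\<lambda>c1 c2. sw a' (\<lambda>a1 a2. ?G a1 a2 a3 b1 b2 b3 c1 c2 c3))))))"
    by (simp add: star_def sw_append pt_append_left sw_scale sw_scale_left sw_times_left sw_times_right mult_ac del: scale_single)
  also have "\<dots> = sw b (\<lambda>b1 b'. sw a (\<lambda>a' a3. sw b' (\<lambda>b2 b3. sw c (\<lambda>c' c3. sw c' (\<lambda>c1 c2. sw a' (\<lambda>a1 a2. ?G a1 a2 a3 b1 b2 b3 c1 c2 c3))))))"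
    by (simp only: sw_swap[where a = c])
  also have "\<dots> = sw b (\<lambda>b1 b'. sw b' (\<lambda>b2 b3. sw c (\<lambda>c' c3. sw c' (\<lambda>c1 c2. sw a (\<lambda>a' a3. sw a' (\<lambda>a1 a2. ?G a1 a2 a3 b1 b2 b3 c1 c2 c3))))))"
    by (simp only: sw_swap[where a = a])
  also have "\<dots> = sw3 b (\<lambda>b1 b2 b3. sw3 c (\<lambda>c1 c2 c3. sw3 a (\<lambda>a1 a2 a3. ?G a1 a2 a3 b1 b2 b3 c1 c2 c3)))"
    by (simp only: sw3_left sw3_right)
  also have "\<dots> = sw3 a (\<lambda>a1 a2 a3. sw3 b (\<lambda>b1 b2 b3. sw3 c (\<lambda>c1 c2 c3. ?G a1 a2 a3 b1 b2 b3 c1 c2 c3)))"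
    by (simp only: sw3_swap[where b = a])
  finally show ?thesis unfolding L ..
qed

lemma STAR_assoc: "STAR (STAR x y) z = STAR x (STAR y z)"
proof -
  have 1: "STAR (STAR (mon a) (mon b)) z = STAR (mon a) (STAR (mon b) z)" for a b
    by (induction z rule: vec_induct) (simp_all only: STAR_linear STAR_mon star_assoc_words)
  have 2: "STAR (STAR (mon a) y) z = STAR (mon a) (STAR y z)" for a
    by (induction y rule: vec_induct) (simp_all only: STAR_linear 1)
  show ?thesis
    by (induction x rule: vec_induct) (simp_all only: STAR_linear 2)
qed

text \<open>Pairing with a group-like letter kills every coproduct term whose left factor contains a
  theta. The one remaining term has the whole word \<open>w\<close> on the right, so the sum is
  diagonal in \<open>w\<close>.\<close>

lemma pl_torus_scale:
  assumes "\<not> is_theta g"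
  obtains c where "c \<noteq> 0" "\<And>F :: 'i word \<Rightarrow> 'i word vec. sw w (\<lambda>u v. scale (pl g u) (F v)) = scale c (F w)"
  using assms
proof (induction w arbitrary: thesis rule: cops.induct)
  case 1
  show ?case by (rule "1"(1)[of 1]) (use 1(2) in \<open>cases g; simp\<close>)+
next
  case (2 i w)
  obtain c where c: "c \<noteq> 0" "\<And>F :: 'i word \<Rightarrow> 'i word vec. sw w (\<lambda>u v. scale (pl g u) (F v)) = scale c (F w)"
    using "2.IH"(1) 2(4) by blast
  have g: "pl g (GTheta i # u) = 0" "pl g (GH i # u) = pl2 g (GH i) * pl g u" for u
    using 2(4) by (cases g; simp)+
  show ?case
  proof (rule "2.prems"(1)[of "pl2 g (GH i) * c"])
    show "pl2 g (GH i) * c \<noteq> 0" using c(1) 2(4) by (cases g; simp)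
  next
    fix F :: "'i word \<Rightarrow> 'i word vec"
    show "sw (GTheta i # w) (\<lambda>u v. scale (pl g u) (F v)) = scale (pl2 g (GH i) * c) (F (GTheta i # w))"
      by (simp add: g c(2)[of "\<lambda>v. F (GTheta i # v)"] sw_scale[symmetric] sc.scale_scale[symmetric] del: sc.scale_scale)
  qed
next
  case (3 i w)
  obtain c where c: "c \<noteq> 0" "\<And>F :: 'i word \<Rightarrow> 'i word vec. sw w (\<lambda>u v. scale (pl g u) (F v)) = scale c (F w)"
    using "3.IH"(1) 3(3) by blast
  have g: "pl g (GH i # u) = pl2 g (GH i) * pl g u" for u
    using 3(3) by (cases g; simp)
  show ?case
  proof (rule "3.prems"(1)[of "pl2 g (GH i) * c"])
    show "pl2 g (GH i) * c \<noteq> 0" using c(1) 3(3) by (cases g; simp)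
  next
    fix F :: "'i word \<Rightarrow> 'i word vec"
    show "sw (GH i # w) (\<lambda>u v. scale (pl g u) (F v)) = scale (pl2 g (GH i) * c) (F (GH i # w))"
      by (simp add: g c(2)[of "\<lambda>v. F (GH i # v)"] sw_scale[symmetric] sc.scale_scale[symmetric] del: sc.scale_scale)
  qed
next
  case (4 i w)
  obtain c where c: "c \<noteq> 0" "\<And>F :: 'i word \<Rightarrow> 'i word vec. sw w (\<lambda>u v. scale (pl g u) (F v)) = scale c (F w)"
    using "4.IH"(1) 4(3) by blast
  have g: "pl g (GHinv i # u) = pl2 g (GHinv i) * pl g u" for u
    using 4(3) by (cases g; simp)
  show ?case
  proof (rule "4.prems"(1)[of "pl2 g (GHinv i) * c"])
    show "pl2 g (GHinv i) * c \<noteq> 0" using c(1) 4(3) by (cases g; simp)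
  next
    fix F :: "'i word \<Rightarrow> 'i word vec"
    show "sw (GHinv i # w) (\<lambda>u v. scale (pl g u) (F v)) = scale (pl2 g (GHinv i) * c) (F (GHinv i # w))"
      by (simp add: g c(2)[of "\<lambda>v. F (GHinv i # v)"] sw_scale[symmetric] sc.scale_scale[symmetric] del: sc.scale_scale)
  qed
qed

lemma pt_letter: "pt [g] u = pl (map_bgen \<tau> g) u"
  by (simp add: pt_def psi_letter del: psi.simps)

text \<open>The two terms of the coproduct of \<open>\<vartheta>\<^sub>i\<close> give the two
  summands. The second replaces the appended theta by \<open>h\<^sub>i\<close>, which is why
  \<open>star_induct\<close> asks for all \<open>h\<^sub>i\<close> in its alphabet.\<close>

lemma star_theta: "star w [GTheta i] = mon (w @ [GTheta i]) + sw w (\<lambda>u v. scale (pl (GTheta (\<tau> i)) u) (mon (v @ [GH i])))"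
  unfolding star_def by (simp add: pt_Nil pt_letter sw_add sw_eps_left_scale del: scale_single)

lemma star_torus:
  assumes "\<not> is_theta g"
  shows "star w [g] = sw w (\<lambda>u v. scale (pl (map_bgen \<tau> g) u) (mon (v @ [g])))"
  using assms unfolding star_def by (cases g) (simp_all add: pt_letter)

text \<open>Every word is obtained from the empty word by twisted right multiplication with letters,
  because \<open>w \<ast> g\<close> is a nonzero multiple of \<open>wg\<close> up to words with fewer \<open>\<vartheta>\<close>'s.\<close>

lemma star_induct:
  assumes A: "range GH \<subseteq> A" and P: "lsub scale P" "mon [] \<in> P"
    and step: "\<And>x g. x \<in> P \<Longrightarrow> g \<in> A \<Longrightarrow> STAR x (mon [g]) \<in> P"
  shows "set w \<subseteq> A \<Longrightarrow> mon w \<in> P"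
\<comment> \<open>Removing a torus letter shortens the word at equal theta count, while removing a
  theta and the correction terms both lower that count; the lexicographic order covers these
  cases.\<close>
proof (induction "(ntheta w, length w)" arbitrary: w rule: wf_induct_rule[OF wf_lex_prod[OF wf_less_than wf_less_than]])
  case 1
  note IH = 1(1)
  show ?case
  proof (cases w rule: rev_cases)
    case Nil then show ?thesis using P by simp
  next
    case (snoc w' g)
    then have set: "set w' \<subseteq> A" "g \<in> A" using 1(2) by auto
    have w': "mon w' \<in> P" using set snoc by (intro IH) (cases g; auto)+
    have st: "star w' [g] \<in> P" using step[OF w' set(2)] by (simp add: STAR_mon)
    show ?thesis
    proof (cases "is_theta g")
      case True
      then obtain i where g: "g = GTheta i" by (cases g) auto
      have "mon (v @ [GH i]) \<in> P" if "(u, v) \<in> cops w'" for u v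
        using that set A snoc g cops_facts[OF that] cops_letters[OF that] by (intro IH) auto
      then have "sw w' (\<lambda>u v. scale (pl (GTheta (\<tau> i)) u) (mon (v @ [GH i]))) \<in> P"
        by (intro sw_closed lsub_scale[OF P(1)] lsub_add[OF P(1)])
      from lsub_diff[OF vs_scale P(1) st this] show ?thesis
        unfolding g star_theta by (simp add: snoc g)
    next
      case False
      obtain c where c: "c \<noteq> 0" "\<And>F :: 'i word \<Rightarrow> 'i word vec. sw w' (\<lambda>u v. scale (pl (map_bgen \<tau> g) u) (F v)) = scale c (F w')"
      proof -
        have "\<not> is_theta (map_bgen \<tau> g)" using False by (cases g) auto
        from pl_torus_scale[OF this, of w'] that show thesis by blast
      qed
      have "star w' [g] = scale c (mon w)" unfolding star_torus[OF False] c(2) snoc ..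
      then have "mon w = scale (inverse c) (star w' [g])" using c(1) by simp
      then show ?thesis using lsub_scale[OF P(1) st] by simp
    qed
  qed
qed

section \<open>A character of the twisted product\<close>

text \<open>The values \<open>ug g\<close> are forced by requiring \<open>\<chi> (w \<ast> g) = \<chi> w * \<chi> g\<close>, with \<open>\<chi> \<vartheta>\<^sub>i = 0\<close> and \<open>\<chi> h\<^sub>i = 1\<close>.\<close>

definition ug :: "'i bgen \<Rightarrow> 'i word \<Rightarrow> qfield" where
  "ug g a = (case g of
      GTheta i \<Rightarrow> - psi [GTheta (\<tau> i), GHinv (\<tau> i)] a
    | GH i \<Rightarrow> pl (GHinv (\<tau> i)) a
    | GHinv i \<Rightarrow> vp (- s i (\<tau> i)) * pl (GH (\<tau> i)) a)"

text \<open>Pairing with \<open>h\<close> and with its inverse are convolution inverses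
  (\<open>pl_inv\<close>), so the equation for \<open>\<chi> (w \<ast> h)\<close> can be solved for
  the value at \<open>w h\<close>. For a theta the twisted product is \<open>w \<vartheta>\<close>
  plus terms ending in \<open>h\<close>, whose values are then known; this is the source of the
  minus sign in \<open>ug\<close>.\<close>

function chi :: "'i word \<Rightarrow> qfield" where
  "chi w = (if w = [] then 1 else sw (butlast w) (\<lambda>u v. ug (last w) u * chi v))"
  by auto
termination
proof (relation "measure length")
  fix w :: "'i word" and u v assume "w \<noteq> []" "(u, v) \<in> cops (butlast w)"
  then show "(v, w) \<in> measure length"
    by (cases w rule: rev_cases) (auto dest: cops_facts)
qed simp

declare chi.simps [simp del]

lemma chi_Nil: "chi [] = 1"
  by (simp add: chi.simps)

lemma chi_snoc: "chi (w @ [g]) = sw w (\<lambda>u v. ug g u * chi v)"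
  by (subst chi.simps) simp

lemma vp_cancel2: "vp a * x * (vp (- a) * y) = x * y" "vp (- a) * x * (vp a * y) = x * y"
proof -
  have "vp a * x * (vp (- a) * y) = (vp a * vp (- a)) * (x * y)" for a by (simp only: mult_ac)
  from this[of a] this[of "- a"] show "vp a * x * (vp (- a) * y) = x * y" "vp (- a) * x * (vp a * y) = x * y"
    by simp_all
qed

lemma pl_inv:
  "sw u (\<lambda>x y. pl (GH i) x * pl (GHinv i) y) = eps u"
  "sw u (\<lambda>x y. pl (GHinv i) x * pl (GH i) y) = eps u"
  by (induction u rule: cops.induct) (simp_all add: vp_cancel2)

lemma chi_letter:
  "chi [GTheta i] = 0" "chi [GH i] = 1" "chi [GHinv i] = vp (- s i (\<tau> i))"
  using chi_snoc[of "[]"] by (simp_all add: chi_Nil ug_def)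

lemma chi_star_letter: "lin (*) chi (star a [g]) = chi a * chi [g]"
proof (cases g)
  case (GTheta i)
  have "sw a (\<lambda>u v. pl (GTheta (\<tau> i)) u * chi (v @ [GH i])) = sw a (\<lambda>u v. sw v (\<lambda>v1 v2. pl (GTheta (\<tau> i)) u * pl (GHinv (\<tau> i)) v1 * chi v2))"
    by (simp add: chi_snoc sw_times_left ug_def mult.assoc)
  also have "\<dots> = sw a (\<lambda>u v. psi [GTheta (\<tau> i), GHinv (\<tau> i)] u * chi v)"
    unfolding sw_coassoc[symmetric] by (simp only: psi_two sw_times_right)
  finally have 1: "sw a (\<lambda>u v. pl (GTheta (\<tau> i)) u * chi (v @ [GH i])) = \<dots>" .
  have "chi (a @ [GTheta i]) = - sw a (\<lambda>u v. psi [GTheta (\<tau> i), GHinv (\<tau> i)] u * chi v)"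
    by (simp add: chi_snoc ug_def sw_minus del: psi.simps)
  then have "lin (*) chi (star a [g]) = 0"
    unfolding GTheta star_theta by (simp add: sw_lin 1 del: psi.simps)
  then show ?thesis by (simp add: GTheta chi_letter)
next
  case (GH i)
  have "lin (*) chi (star a [g]) = sw a (\<lambda>u v. sw v (\<lambda>v1 v2. pl (GH (\<tau> i)) u * pl (GHinv (\<tau> i)) v1 * chi v2))"
    unfolding GH by (simp add: star_torus sw_lin chi_snoc sw_times_left ug_def mult.assoc)
  also have "\<dots> = sw a (\<lambda>u v. eps u * chi v)"
    unfolding sw_coassoc[symmetric] by (simp only: sw_times_right[symmetric] pl_inv)
  finally show ?thesis by (simp add: GH chi_letter sw_eps_left)
next
  case (GHinv i)
  have "lin (*) chi (star a [g]) = sw a (\<lambda>u v. sw v (\<lambda>v1 v2. pl (GHinv (\<tau> i)) u * pl (GH (\<tau> i)) v1 * (vp (- s i (\<tau> i)) * chi v2)))"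
    unfolding GHinv by (simp add: star_torus sw_lin chi_snoc sw_times_left ug_def mult_ac)
  also have "\<dots> = sw a (\<lambda>u v. eps u * (vp (- s i (\<tau> i)) * chi v))"
    unfolding sw_coassoc[symmetric] by (simp only: sw_times_right[symmetric] pl_inv)
  finally show ?thesis by (simp add: GHinv chi_letter sw_eps_left)
qed

text \<open>The case of a letter on the right is built into the recursion of \<open>chi\<close>. The
  set of \<open>y\<close> that satisfy the claim for all \<open>x\<close> is closed under twisted
  multiplication by letters, by associativity, so \<open>star_induct\<close> reaches every
  word.\<close>

lemma chi_STAR: "lin (*) chi (STAR x y) = lin (*) chi x * lin (*) chi y"
proof -
  let ?P = "{y. \<forall>x. lin (*) chi (STAR x y) = lin (*) chi x * lin (*) chi y}"
  have P: "lsub (scale :: qfield \<Rightarrow> 'i word vec \<Rightarrow> _) ?P"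
    by (auto simp: lsub_def STAR_linear algebra_simps)
  have s1: "lin (*) chi (STAR x (mon [g])) = lin (*) chi x * chi [g]" for x g
    by (induction x rule: vec_induct) (simp_all add: STAR_linear STAR_mon chi_star_letter algebra_simps del: scale_single)
  have "STAR x (mon []) = x" for x
    by (induction x rule: vec_induct) (simp_all add: STAR_linear STAR_mon star_def pt_Nil sw_eps_left_scale del: scale_single)
  then have 1: "mon [] \<in> ?P" by (simp add: chi_Nil)
  have "mon w \<in> ?P" for w
  proof (rule star_induct[where A = UNIV, OF _ P 1])
    fix y g assume "y \<in> ?P"
    then show "STAR y (mon [g]) \<in> ?P"
      by (simp add: STAR_assoc[symmetric] s1 mult.assoc)
  qed auto
  then have "y \<in> ?P"
  proof (induction y rule: vec_induct)
    case (mon k c) then show ?case by (intro lsub_scale[OF P])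
  qed (use P in \<open>auto simp: lsub_def\<close>)
  then show ?thesis by blast
qed

end

context pairing
begin

lemma pl_append_torus: "\<not> is_theta g \<Longrightarrow> pl g (u @ u') = pl g u * pl g u'"
  by (induction u) (cases g; simp)+

lemma sw_factor: "sw w (\<lambda>u v. A * p u * (B * q v)) = A * B * sw w (\<lambda>u v. p u * q v)" for A B :: qfield
  by (simp add: sw_times_left mult_ac)

lemma psi_torus_commute:
  assumes "\<not> is_theta g" "\<not> is_theta g'"
  shows "psi [g, g'] u = psi [g', g] u"
proof -
  have *: "pl h (GTheta i # w) = 0" "pl h (GH i # w) = pl2 h (GH i) * pl h w" "pl h (GHinv i # w) = pl2 h (GHinv i) * pl h w"
    if "\<not> is_theta h" for h i w using that by (cases h; simp)+
  show ?thesis unfolding psi_two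
  proof (induction u rule: cops.induct)
    case 1 show ?case using assms by simp
  next
    case (3 i w) then show ?case
      by (simp only: sw.simps *[OF assms(1)] *[OF assms(2)] sw_factor) (simp only: mult_ac)
  next
    case (4 i w) then show ?case
      by (simp only: sw.simps *[OF assms(1)] *[OF assms(2)] sw_factor) (simp only: mult_ac)
  qed (use assms in \<open>simp_all add: *\<close>)
qed

lemma psi_inv_theta: "psi [GHinv k, GTheta l] u = vp (- s k l) * psi [GTheta l, GHinv k] u"
  unfolding psi_two
proof (induction u rule: cops.induct)
  case (2 j w)
  have "sw w (\<lambda>u v. vp (- s k j) * pl (GHinv k) u * (pl2 (GTheta l) (GTheta j) * eps v))
     = vp (- s k j) * pl2 (GTheta l) (GTheta j) * pl (GHinv k) w"
    unfolding sw_factor using sw_eps_right[of w "pl (GHinv k)"] by (simp add: mult.commute)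
  moreover have "sw w (\<lambda>u v. pl2 (GTheta l) (GTheta j) * eps u * pl (GHinv k) v) = pl2 (GTheta l) (GTheta j) * pl (GHinv k) w"
    by (simp add: sw_times_left[symmetric] sw_eps_left mult.assoc)
  ultimately show ?case by simp
next
  case (3 j w) then show ?case by (simp add: sw_factor)
next
  case (4 j w) then show ?case by (simp add: sw_factor)
qed simp

end

context satake
begin

lemma vp_cancel3 [simp]: "vp a * (vp (- a) * x) = x" "vp (- a) * (vp a * x) = x"
  by (simp_all flip: mult.assoc)

lemma lin_uminus_fun: "lin (*) (\<lambda>k. - F k) x = - lin (*) F x"
  using lin_times_left[of "-1" F x] by simp

text \<open>Merges a functional in front of \<open>chi (v @ [g])\<close> with the recursion into one
  convolution, so that relations between the last two letters become identities between
  functionals.\<close>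

lemma chi_conv: "sw a (\<lambda>u v. p u * chi (v @ [g])) = sw a (\<lambda>x y. sw x (\<lambda>x1 x2. p x1 * ug g x2) * chi y)"
proof -
  have "sw a (\<lambda>u v. p u * chi (v @ [g])) = sw a (\<lambda>u v. sw v (\<lambda>v1 v2. p u * ug g v1 * chi v2))"
    by (simp add: chi_snoc sw_times_left mult.assoc)
  also have "\<dots> = sw a (\<lambda>x y. sw x (\<lambda>x1 x2. p x1 * ug g x2) * chi y)"
    unfolding sw_coassoc[symmetric] by (simp only: sw_times_right)
  finally show ?thesis .
qed

lemma chi_two: "chi (a @ [g, g']) = sw a (\<lambda>u v. sw [g] (\<lambda>g1 g2. ug g' (u @ g1) * chi (v @ g2)))"
  using chi_snoc[of "a @ [g]" g'] by (simp add: sw_append)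

lemma ug_torus: "ug (GH i) = pl (GHinv (\<tau> i))" "ug (GHinv i) = (\<lambda>u. vp (- s i (\<tau> i)) * pl (GH (\<tau> i)) u)"
  "ug (GTheta i) = (\<lambda>u. - psi [GTheta (\<tau> i), GHinv (\<tau> i)] u)"
  by (auto simp: ug_def fun_eq_iff simp del: psi.simps)

lemma chi_HH_aux: "chi (a @ [GH i, GH j]) = vp (- s (\<tau> j) i) * sw a (\<lambda>x y. psi [GHinv (\<tau> j), GHinv (\<tau> i)] x * chi y)"
  unfolding chi_two psi_two
  by (simp add: ug_torus pl_append_torus sw_times_left chi_conv[of a "\<lambda>u. pl (GHinv (\<tau> j)) u * vp (- s (\<tau> j) i)"])
     (simp add: sw_times_left sw_times_right mult_ac)

lemma chi_HH: "chi (a @ [GH i, GH j]) = chi (a @ [GH j, GH i])"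
  unfolding chi_HH_aux using psi_torus_commute[of "GHinv (\<tau> j)" "GHinv (\<tau> i)"] s_tau'[of j i] s_sym[of "\<tau> i" j]
  by (simp del: psi.simps)

lemma chi_HI: "chi (a @ [GH i, GHinv i]) = chi a" "chi (a @ [GHinv i, GH i]) = chi a"
proof -
  have s: "s (\<tau> i) i = s i (\<tau> i)" by (rule s_sym)
  have "chi (a @ [GH i, GHinv i]) = sw a (\<lambda>u v. pl (GH (\<tau> i)) u * chi (v @ [GH i]))"
    by (simp add: chi_two ug_torus pl_append_torus s mult_ac)
  also have "\<dots> = chi a" unfolding chi_conv by (simp add: ug_torus pl_inv sw_eps_left)
  finally show "chi (a @ [GH i, GHinv i]) = chi a" .
  have "chi (a @ [GHinv i, GH i]) = vp (s i (\<tau> i)) * sw a (\<lambda>u v. pl (GHinv (\<tau> i)) u * chi (v @ [GHinv i]))"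
    by (simp add: chi_two ug_torus pl_append_torus s sw_times_left mult_ac)
  also have "sw a (\<lambda>u v. pl (GHinv (\<tau> i)) u * chi (v @ [GHinv i])) = vp (- s i (\<tau> i)) * sw a (\<lambda>x y. sw x (\<lambda>x1 x2. pl (GHinv (\<tau> i)) x1 * pl (GH (\<tau> i)) x2) * chi y)"
    unfolding chi_conv by (simp add: ug_torus sw_times_left sw_times_right mult_ac)
  also have "\<dots> = vp (- s i (\<tau> i)) * chi a" by (simp add: pl_inv sw_eps_left)
  finally show "chi (a @ [GHinv i, GH i]) = chi a" by (simp flip: mult.assoc)
qed

lemma chi_HT: "chi (a @ [GH i, GTheta j]) = vp (s i j) * chi (a @ [GTheta j, GH i])"
proof -
  let ?X = "sw a (\<lambda>x y. psi [GTheta (\<tau> j), GHinv (\<tau> j), GHinv (\<tau> i)] x * chi y)"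
  have e: "psi [GTheta (\<tau> j), GHinv (\<tau> j)] (u @ [GH i]) = vp (- s (\<tau> j) i) * psi [GTheta (\<tau> j), GHinv (\<tau> j)] u" for u
    unfolding psi_append_right[of _ u] by simp
  have "chi (a @ [GH i, GTheta j]) = - (vp (- s (\<tau> j) i) * sw a (\<lambda>u v. psi [GTheta (\<tau> j), GHinv (\<tau> j)] u * chi (v @ [GH i])))"
    by (simp add: chi_two ug_torus e sw_times_left sw_minus mult_ac del: psi.simps)
  also have "\<dots> = - (vp (- s (\<tau> j) i) * ?X)"
    unfolding chi_conv using psi_append_left[of "[GTheta (\<tau> j), GHinv (\<tau> j)]" "[GHinv (\<tau> i)]"]
    by (simp add: ug_torus psi_letter del: psi.simps)
  finally have 1: "chi (a @ [GH i, GTheta j]) = - (vp (- s (\<tau> j) i) * ?X)" .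
  have "psi [GHinv (\<tau> i), GTheta (\<tau> j), GHinv (\<tau> j)] x = vp (- s i j) * psi [GTheta (\<tau> j), GHinv (\<tau> j), GHinv (\<tau> i)] x" for x
  proof -
    have "psi [GHinv (\<tau> i), GTheta (\<tau> j), GHinv (\<tau> j)] x = vp (- s i j) * psi [GTheta (\<tau> j), GHinv (\<tau> i), GHinv (\<tau> j)] x"
      using psi_append_left[of "[GHinv (\<tau> i), GTheta (\<tau> j)]" "[GHinv (\<tau> j)]" x]
        psi_append_left[of "[GTheta (\<tau> j), GHinv (\<tau> i)]" "[GHinv (\<tau> j)]" x]
      by (simp only: append.simps psi_inv_theta s_tau sw_times_left mult.assoc)
    also have "psi [GTheta (\<tau> j), GHinv (\<tau> i), GHinv (\<tau> j)] x = psi [GTheta (\<tau> j), GHinv (\<tau> j), GHinv (\<tau> i)] x"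
      unfolding psi.simps(2)[of "GTheta (\<tau> j)"] by (subst psi_torus_commute) simp_all
    finally show ?thesis .
  qed
  note 2 = this
  have "chi (a @ [GTheta j, GH i]) = vp (- s (\<tau> i) j) * sw a (\<lambda>u v. pl (GHinv (\<tau> i)) u * chi (v @ [GTheta j]))"
    by (simp add: chi_two ug_torus pl_append_torus sw_times_left mult_ac)
  also have "sw a (\<lambda>u v. pl (GHinv (\<tau> i)) u * chi (v @ [GTheta j])) = - sw a (\<lambda>x y. psi [GHinv (\<tau> i), GTheta (\<tau> j), GHinv (\<tau> j)] x * chi y)"
    unfolding chi_conv psi.simps(2)[of "GHinv (\<tau> i)"] by (simp add: ug_torus del: psi.simps flip: sw_minus)
  also have "sw a (\<lambda>x y. psi [GHinv (\<tau> i), GTheta (\<tau> j), GHinv (\<tau> j)] x * chi y) = vp (- s i j) * ?X"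
    unfolding 2 by (simp only: sw_times_left mult.assoc)
  finally have 3: "vp (s i j) * chi (a @ [GTheta j, GH i]) = - (vp (- s (\<tau> i) j) * ((vp (s i j) * vp (- s i j)) * ?X))"
    by (simp only: mult_ac mult_minus_right)
  show ?thesis unfolding 1 3 using s_tau'[of i j] s_sym[of "\<tau> j" i] by simp
qed

lemma chi_torus: "r \<in> torus_rels \<Longrightarrow> lin (*) (\<lambda>w. chi (a @ w)) r = 0"
  by (cases r rule: torus_cases) (auto simp: chi_HH chi_HI chi_HT lin_mono_one)

lemma ug_J: "x \<in> J \<Longrightarrow> lin (*) (\<lambda>w. ug g (a @ w @ b)) x = 0"
proof -
  assume "x \<in> J"
  then have "mon a * x * mon b \<in> J" by (rule idl_mult_right[OF idl_mult_left])
  moreover have "lin (*) (pl l) y = 0" if "y \<in> J" for l y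
  proof -
    have "psi [l] = pl l" by (rule ext) (rule psi_letter)
    then show ?thesis using psi_J_right[OF that, of "[l]"] by simp
  qed
  ultimately have "lin (*) (ug g) (mon a * x * mon b) = 0"
    by (cases g) (simp_all add: ug_torus lin_times_left lin_uminus_fun psi_J_right del: psi.simps)
  then show ?thesis by (simp add: lin_sandwich plus_list_def)
qed

text \<open>Peel the last letter off the right context with the recursion of \<open>chi\<close>. In
  the resulting Sweedler sum the coideal condition puts a relation into the left slot, where
  \<open>ug\<close> vanishes because the pairing kills \<open>J\<close>, or into the right slot,
  where the context is shorter. What remains is a relation at the very end of a word.\<close>

lemma chi_kill:
  assumes X: "X \<subseteq> J" "\<And>x. x \<in> X \<Longrightarrow> Del x \<in> span2 (X \<union> idl Y)" and YJ: "idl Y \<subseteq> J"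
    and Y: "\<And>y. y \<in> idl Y \<Longrightarrow> lin (*) chi y = 0"
    and base: "\<And>x a. x \<in> X \<Longrightarrow> lin (*) (\<lambda>w. chi (a @ w)) x = 0"
  shows "x \<in> idl X \<Longrightarrow> lin (*) chi x = 0"
proof -
  have *: "lin (*) (\<lambda>w. chi (a @ w @ b)) x = 0" if "x \<in> X" for x a b
    using that
  proof (induction b arbitrary: a x rule: length_induct)
    case (1 b)
    show ?case
    proof (cases b rule: rev_cases)
      case Nil then show ?thesis using base 1 by simp
    next
      case (snoc b' g)
      let ?F = "\<lambda>a1 a2 w1 w2. sw b' (\<lambda>b1 b2. ug g (a1 @ w1 @ b1) * chi (a2 @ w2 @ b2))"
      have "lin (*) (\<lambda>w. sw w (?F a1 a2)) x \<in> {0}" for a1 a2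
      proof (rule conv_kill[OF vs_times lsub_zero[OF vs_times] X(2)[OF 1(2)]])
        fix v z assume "z \<in> X \<union> idl Y"
        then show "lin (*) (\<lambda>u. ?F a1 a2 u v) z \<in> {0}"
          using X(1) YJ by (auto simp: lin_sw lin_times_right ug_J)
      next
        fix u z assume z: "z \<in> X \<union> idl Y"
        have "sw b' (\<lambda>b1 b2. ug g (a1 @ u @ b1) * lin (*) (\<lambda>v. chi (a2 @ v @ b2)) z) = sw b' (\<lambda>b1 b2. 0)"
        proof (rule sw_cong_cops)
          fix b1 b2 assume "(b1, b2) \<in> cops b'"
          then have "length b2 < length b" using cops_facts snoc by fastforce
          then have "lin (*) (\<lambda>v. chi (a2 @ v @ b2)) z = 0"
          proof (cases "z \<in> X")
            case False
            then have "mon a2 * z * mon b2 \<in> idl Y" using z by (intro idl_mult_right[OF idl_mult_left]) auto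
            from Y[OF this] show ?thesis by (simp add: lin_sandwich plus_list_def)
          qed (use 1 in auto)
          then show "ug g (a1 @ u @ b1) * lin (*) (\<lambda>v. chi (a2 @ v @ b2)) z = 0" by simp
        qed
        then show "lin (*) (?F a1 a2 u) z \<in> {0}" by (simp add: lin_sw lin_times_left)
      qed
      then have "sw a (\<lambda>a1 a2. lin (*) (\<lambda>w. sw w (?F a1 a2)) x) = 0" by simp
      moreover have "chi (a @ w @ b) = sw a (\<lambda>a1 a2. sw w (?F a1 a2))" for w
        using chi_snoc[of "a @ w @ b'" g] by (simp add: snoc sw_append)
      ultimately show ?thesis by (simp add: lin_sw)
    qed
  qed
  assume "x \<in> idl X"
  then have "lin (*) chi x \<in> {0}"
    by (rule lin_idl[OF vs_times lsub_zero[OF vs_times], rotated]) (simp add: plus_list_def *)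
  then show ?thesis by simp
qed

lemma chi_Jt: "x \<in> Jt \<Longrightarrow> lin (*) chi x = 0"
proof (rule chi_kill[of torus_rels "{}"])
  have e: "y = 0" if "y \<in> idl {}" for y :: "'i word vec"
    using that by (induction rule: idl.induct) auto
  show "torus_rels \<subseteq> J" using idl_incl[of _ borel_rels] by (auto simp: borel_rels_def)
  show "idl {} \<subseteq> J" by (auto dest: e intro: idl.intros)
  show "lin (*) chi y = 0" if "y \<in> idl {}" for y using e[OF that] by simp
  show "Del x \<in> span2 (torus_rels \<union> idl {})" if "x \<in> torus_rels" for x
    by (rule span2_mono[OF Del_torus[OF that]]) simp
qed (simp_all add: chi_torus)

text \<open>In the recursion a final \<open>\<vartheta>\<^sub>i\<close> has to be paired with one
  theta of index \<open>\<tau> i\<close> from the rest of the word, so thetas disappear in pairs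
  matched by \<open>\<tau>\<close>.\<close>

lemma chi_cnt:
  "chi w \<noteq> 0 \<Longrightarrow> (\<tau> j = j \<longrightarrow> even (cnt j w)) \<and> cnt j w = cnt (\<tau> j) w"
proof (induction w rule: length_induct)
  case (1 w)
  show ?case
  proof (cases w rule: rev_cases)
    case (snoc w' g)
    with 1(2) obtain u v where uv: "(u, v) \<in> cops w'" "ug g u * chi v \<noteq> 0"
      by (auto simp: chi_snoc elim: sw_neq_0)
    have len: "length v < length w" using cops_facts[OF uv(1)] snoc by simp
    have "chi v \<noteq> 0" using uv(2) by auto
    with 1(1)[rule_format, OF len] obtain p where
      IH: "cnt j v = p" "cnt (\<tau> j) v = p" "\<tau> j = j \<longrightarrow> even p" by metis
    have c: "cnt k w' = cnt k u + cnt k v" for k using cnt_cops[OF uv(1)] by simp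
    have nz: "ug g u \<noteq> 0" using uv(2) by auto
    show ?thesis
    proof (cases g)
      case (GTheta i)
      have "cnt k u = cnt k [GTheta (\<tau> i), GHinv (\<tau> i)]" for k
        using psi_cnt[of "[GTheta (\<tau> i), GHinv (\<tau> i)]" u k] nz by (simp add: GTheta ug_torus del: psi.simps)
      then have "cnt k w = cnt k v + (if \<tau> i = k then 1 else 0) + (if i = k then 1 else 0)" for k
        by (simp add: snoc c GTheta)
      moreover have "\<tau> i = j \<longleftrightarrow> i = \<tau> j" "\<tau> i = \<tau> j \<longleftrightarrow> i = j" using tau_tau by metis+
      ultimately show ?thesis using IH by auto
    next
      case (GH i)
      have "cnt k u = 0" for k using pl_cnt[of "GHinv (\<tau> i)" u k] nz by (simp add: GH ug_torus)
      then have "cnt k w = cnt k v" for k by (simp add: snoc c GH)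
      then show ?thesis using IH by simp
    next
      case (GHinv i)
      have "cnt k u = 0" for k using pl_cnt[of "GH (\<tau> i)" u k] nz by (simp add: GHinv ug_torus)
      then have "cnt k w = cnt k v" for k by (simp add: snoc c GHinv)
      then show ?thesis using IH by simp
    qed
  qed simp
qed

text \<open>Since \<open>\<vartheta>\<^sub>j\<close> occurs once, \<open>chi_cnt\<close> leaves only
  \<open>i = \<tau> j\<close> with \<open>c\<^sub>i\<^sub>j = 0\<close>. There the Serre element is
  a commutator, and both of its words have the value \<open>- kap j\<close>.\<close>

lemma chi_sr:
  assumes ij: "i \<noteq> j" shows "lin (*) chi (sr i j) = 0"
proof (cases "i = \<tau> j \<and> nat (1 - C i j) = 1")
  case False
  show ?thesis
  proof (rule lin_sr_0[OF vs_times])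
    fix r assume r: "r \<le> nat (1 - C i j)"
    let ?w = "replicate r (GTheta i) @ [GTheta j] @ replicate (nat (1 - C i j) - r) (GTheta i)"
    have "cnt j ?w = 1" "cnt (\<tau> j) ?w = (if \<tau> j = i then nat (1 - C i j) else if \<tau> j = j then 1 else 0)"
      using ij r by auto
    then show "chi ?w = 0" using chi_cnt[of ?w j] False ij by (metis odd_one zero_neq_one)
  qed
next
  case True
  have m: "nat (1 - C i j) = Suc 0" and i: "i = \<tau> j"
    using conjunct2[OF True] conjunct1[OF True] by simp_all
  have q: "qbinomial (vi d i) (Suc 0) 0 = 1" "qbinomial (vi d i) (Suc 0) (Suc 0) = 1"
    using gcm qint_vp_nonzero[of "int (d i)" 1]
    by (simp_all add: qbinomial_def qfact_def vi_vp symmetrizable_gcm_def)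
  have "sr i j = mon [GTheta j, GTheta i] - mon [GTheta i, GTheta j]"
    unfolding sr_def srr_def m by (simp add: q single_uminus)
  moreover have "chi [GTheta j, GTheta i] = - kap j" "chi [GTheta i, GTheta j] = - kap i"
    using chi_two[of "[]"] by (simp_all add: chi_letter chi_Nil ug_torus i)
  ultimately show ?thesis by (simp add: i)
qed

text \<open>Multiplicativity and \<open>\<chi> S = 0\<close> make \<open>\<chi> (a \<ast> S)\<close>
  vanish for the Serre element \<open>S\<close>. Skew-primitivity expands the same value into
  \<open>\<chi> (a S)\<close> and a term in which \<open>S\<close> sits in the pairing, which is
  zero; the error terms from \<open>Jt\<close> vanish as well.\<close>

lemma chi_a_sr:
  assumes ij: "i \<noteq> j" shows "lin (*) (\<lambda>w. chi (a @ w)) (sr i j) = 0"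
proof -
  let ?F = "\<lambda>w1 w2. sw a (\<lambda>a1 a2. pt w2 a1 * chi (a2 @ w1))"
  have J: "sr i j \<in> J" using ij by (auto intro!: idl_incl simp: borel_rels_def serre_rels_def)
  obtain h where h: "tfree h" "cg (span2 Jt) (Del (sr i j)) (tens (sr i j) 1 + tens (mon h) (sr i j))"
    using Del_serre[OF ij] by metis
  have "STAR (mon a) (sr i j) = lin scale (\<lambda>w. star a w) (sr i j)" by (simp add: STAR_def)
  then have "lin (*) chi (STAR (mon a) (sr i j)) = lin (*) (\<lambda>w. lin (*) chi (star a w)) (sr i j)"
    by (simp add: lmap_lin[OF lmap_lin_self])
  moreover have "lin (*) chi (star a w) = sw w ?F" for w
    by (simp add: star_def sw_lin) (rule sw_swap)
  ultimately have "lin (*) (\<lambda>w. sw w ?F) (sr i j) = 0"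
    by (simp add: chi_STAR chi_sr[OF ij])
  moreover have "lin (*) (\<lambda>(u, v). ?F u v) (Del (sr i j) - (tens (sr i j) 1 + tens (mon h) (sr i j))) \<in> {0}"
  proof (rule lin_span2[OF vs_times lsub_zero[OF vs_times]])
    show "Del (sr i j) - (tens (sr i j) 1 + tens (mon h) (sr i j)) \<in> span2 Jt" using h(2) by (simp add: cg_def)
  next
    fix x v assume x: "x \<in> Jt"
    have "lin (*) (\<lambda>u. chi (a2 @ u)) x = 0" for a2
      using chi_Jt[OF idl_mult_left[OF x, of "mon a2"]] lin_sandwich[OF vs_times, of chi a2 x 0]
      by (simp add: plus_list_def zero_list_def mono_Nil)
    then show "lin (*) (\<lambda>u. ?F u v) x \<in> {0}" by (simp add: lin_sw lin_times_left)
  next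
    fix x u assume "x \<in> Jt"
    then have "lin (*) (\<lambda>v. pt v a1) x = 0" for a1 by (intro pt_J_left Jt_J)
    then show "lin (*) (?F u) x \<in> {0}" by (simp add: lin_sw lin_times_right)
  qed
  moreover have "lin (*) (\<lambda>(u, v). ?F u v) (tens (mon h) (sr i j)) = 0"
    by (simp add: lin_tens lin_sw lin_times_right pt_J_left[OF J])
  moreover have "lin (*) (\<lambda>(u, v). ?F u v) (tens (sr i j) 1) = lin (*) (\<lambda>w. chi (a @ w)) (sr i j)"
    by (simp add: lin_tens lin_mono_one pt_Nil sw_eps_left[of a "\<lambda>a2. chi (a2 @ _)"])
  ultimately show ?thesis by (simp add: lin_Del)
qed

lemma chi_J: "x \<in> J \<Longrightarrow> lin (*) chi x = 0"
proof -
  have JtJ: "Jt \<subseteq> J" using Jt_J by auto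
  have S: "lin (*) chi y = 0" if "y \<in> idl serre_rels" for y
  proof (rule chi_kill[of serre_rels torus_rels, OF _ _ JtJ chi_Jt _ that])
    show "serre_rels \<subseteq> J" by (auto intro!: idl_incl simp: borel_rels_def)
  qed (auto simp: Del_serre_span, auto simp: serre_rels_def chi_a_sr)
  assume "x \<in> J"
  then have "lin (*) chi x \<in> {0}"
  proof (rule lin_idl[OF vs_times lsub_zero[OF vs_times], rotated])
    fix r a b assume "r \<in> borel_rels"
    then have "mon a * r * mon b \<in> Jt \<or> mon a * r * mon b \<in> idl serre_rels"
      using idl_mult_right[OF idl_mult_left[OF idl_incl]] by (auto simp: borel_rels_def)
    then show "lin (*) (\<lambda>w. chi (a + w + b)) r \<in> {0}"
      using chi_Jt S lin_sandwich[OF vs_times, of chi a r b] by auto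
  qed
  then show ?thesis by simp
qed

end

section \<open>Relations of the Drinfeld double\<close>

fun rpl :: "'i bgen \<Rightarrow> 'i ugen" where
  "rpl (GTheta i) = GE i" | "rpl (GH i) = GK i" | "rpl (GHinv i) = GKinv i"

fun rml :: "'i bgen \<Rightarrow> 'i ugen" where
  "rml (GTheta i) = GF i" | "rml (GH i) = GK' i" | "rml (GHinv i) = GK'inv i"

abbreviation rp :: "'i word \<Rightarrow> 'i ugen list" where "rp \<equiv> map rpl"
abbreviation rm :: "'i word \<Rightarrow> 'i ugen list" where "rm \<equiv> map rml"

definition lett :: "('a list \<Rightarrow> 'b list) \<Rightarrow> 'a list vec \<Rightarrow> 'b list vec" where
  "lett h = lin scale (\<lambda>w. mon (h w))"

lemma lett_idl:
  assumes "\<And>u v. h (u @ v) = h u @ h v" "\<And>r. r \<in> R \<Longrightarrow> lett h r \<in> idl R'" "x \<in> idl R"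
  shows "lett h x \<in> idl R'"
  unfolding lett_def
proof (rule lin_idl[OF vs_scale lsub_idl _ assms(3)])
  fix r a b assume r: "r \<in> R"
  have "lin scale (\<lambda>w. mon (h (a + w + b))) r = mon (h a) * lett h r * mon (h b)"
    by (simp add: plus_list_def assms(1) lett_def lmap_lin[OF lmap_mult_left] lmap_lin[OF lmap_mult_right] mono_mult)
  then show "lin scale (\<lambda>w. mon (h (a + w + b))) r \<in> idl R'"
    using idl_mult_right[OF idl_mult_left[OF assms(2)[OF r]]] by simp
qed

lemma cg_inverse:
  fixes x :: "('m::monoid_add) vec"
  assumes N: "tsid N" and xy: "cg N (x * y) (scale c (y * x))" and c: "c \<noteq> 0"
    and inv: "cg N (x * x') 1" "cg N (x' * x) 1"
  shows "cg N (x' * y) (scale (inverse c) (y * x'))"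
proof -
  note L = tsid_lsub[OF N]
  have 1: "cg N (x' * y * 1) (x' * y * (x * x'))"
    by (rule cg_multl[OF N cg_sym[OF L inv(1)]])
  have 2: "cg N (scale (inverse c) (x' * (scale c (y * x)) * x')) (scale (inverse c) (x' * (x * y) * x'))"
    by (rule cg_scale[OF L cg_multr[OF N cg_multl[OF N cg_sym[OF L xy]]]])
  have 3: "cg N (scale (inverse c) (x' * x * (y * x'))) (scale (inverse c) (1 * (y * x')))"
    by (rule cg_scale[OF L cg_multr[OF N inv(2)]])
  have e: "scale (inverse c) (x' * (scale c (y * x)) * x') = x' * y * (x * x')"
    using c by (simp add: scale_mult mult.assoc)
  have "x' * (x * y) * x' = x' * x * (y * x')" by (simp only: mult.assoc)
  with 2 have "cg N (x' * y * (x * x')) (scale (inverse c) (x' * x * (y * x')))" unfolding e by simp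
  from cg_trans[OF L cg_trans[OF L 1 this] 3] show ?thesis by simp
qed

context satake
begin

text \<open>Together with the images of the Borel relations under the two embeddings these present
  the double. The commutators of \<open>K\<close> and \<open>K'\<close> are listed in both orders so
  that \<open>double_rels\<close> agrees literally with \<open>U_tilde_rels\<close>.\<close>

definition cross_rels :: "'i ugen list vec set" where
  "cross_rels =
     {mon [GE i, GF j] - mon [GF j, GE i] - scale (if i = j then - kap i else 0) (mon [GK i] - mon [GK' i]) | i j. True}
   \<union> {mon [GK i, GF j] - scale (vp (- s i j)) (mon [GF j, GK i]) | i j. True}
   \<union> {mon [GK' i, GE j] - scale (vp (- s i j)) (mon [GE j, GK' i]) | i j. True}
   \<union> {mon [GK i, GK' j] - mon [GK' j, GK i] | i j. True}
   \<union> {mon [GK' i, GK j] - mon [GK j, GK' i] | i j. True}"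

definition double_rels :: "'i ugen list vec set" where
  "double_rels = lett rp ` borel_rels \<union> lett rm ` borel_rels \<union> cross_rels"

abbreviation "JU \<equiv> idl double_rels"

lemma rp_J: "x \<in> J \<Longrightarrow> lett rp x \<in> JU" and rm_J: "x \<in> J \<Longrightarrow> lett rm x \<in> JU"
  by (rule lett_idl[of _ borel_rels]; auto simp: double_rels_def intro: idl_incl)+

lemma JUc: "cg JU (mon [GK i] * mon [GF j]) (scale (vp (- s i j)) (mon [GF j] * mon [GK i]))"
  "cg JU (mon [GK' i] * mon [GE j]) (scale (vp (- s i j)) (mon [GE j] * mon [GK' i]))"
  "cg JU (mon [GK i] * mon [GK' j]) (scale 1 (mon [GK' j] * mon [GK i]))"
  "cg JU (mon [GK' i] * mon [GK j]) (scale 1 (mon [GK j] * mon [GK' i]))"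
  unfolding cg_def mono_mult by (rule idl_incl; simp add: double_rels_def cross_rels_def; blast)+

lemma JUi: "cg JU (mon [GK i] * mon [GKinv i]) 1" "cg JU (mon [GKinv i] * mon [GK i]) 1"
  "cg JU (mon [GK' i] * mon [GK'inv i]) 1" "cg JU (mon [GK'inv i] * mon [GK' i]) 1"
proof -
  have r: "mon [GH i, GHinv i] - 1 \<in> J" "mon [GHinv i, GH i] - 1 \<in> J"
    by (rule idl_incl; force simp: borel_rels_def torus_rels_def)+
  show "cg JU (mon [GK i] * mon [GKinv i]) 1" "cg JU (mon [GKinv i] * mon [GK i]) 1"
    "cg JU (mon [GK' i] * mon [GK'inv i]) 1" "cg JU (mon [GK'inv i] * mon [GK' i]) 1"
    using rp_J[OF r(1)] rp_J[OF r(2)] rm_J[OF r(1)] rm_J[OF r(2)]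
    by (simp_all add: cg_def mono_mult lett_def lin_mono_one mono_Nil)
qed

lemmas cr = cg_refl[OF lsub_idl]
lemmas ct = cg_trans[OF lsub_idl]

text \<open>The two sides of the exchange relation between the halves of the Drinfeld double.\<close>

definition Lh :: "'i word \<Rightarrow> 'i word \<Rightarrow> 'i ugen list vec" where
  "Lh a b = sw a (\<lambda>a1 a2. sw b (\<lambda>b1 b2. scale (psi b1 a2) (mon (rm a1 @ rp b2))))"

definition Rh :: "'i word \<Rightarrow> 'i word \<Rightarrow> 'i ugen list vec" where
  "Rh a b = sw a (\<lambda>a1 a2. sw b (\<lambda>b1 b2. scale (psi b2 a1) (mon (rp b1 @ rm a2))))"

lemma kk_inv:
  "cg JU (mon [GK i] * mon [GK'inv j]) (mon [GK'inv j] * mon [GK i])"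
  "cg JU (mon [GKinv i] * mon [GK' j]) (mon [GK' j] * mon [GKinv i])"
  "cg JU (mon [GKinv i] * mon [GK'inv j]) (mon [GK'inv j] * mon [GKinv i])"
proof -
  show 1: "cg JU (mon [GK i] * mon [GK'inv j]) (mon [GK'inv j] * mon [GK i])"
  proof -
    have "cg JU (mon [GK'inv j] * mon [GK i]) (mon [GK i] * mon [GK'inv j])"
      using cg_inverse[OF tsid_idl JUc(4)[of j i] _ JUi(3,4)] by simp
    then show ?thesis by (rule cg_sym[OF lsub_idl])
  qed
  show "cg JU (mon [GKinv i] * mon [GK' j]) (mon [GK' j] * mon [GKinv i])"
    using cg_inverse[OF tsid_idl JUc(3)[of i j] _ JUi(1,2)] by simp
  have "cg JU (mon [GK i] * mon [GK'inv j]) (scale 1 (mon [GK'inv j] * mon [GK i]))" using 1 by simp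
  from cg_inverse[OF tsid_idl this _ JUi(1,2)]
  show "cg JU (mon [GKinv i] * mon [GK'inv j]) (mon [GK'inv j] * mon [GKinv i])" by simp
qed

lemma kinv_F: "cg JU (mon [GKinv i] * mon [GF j]) (scale (vp (s i j)) (mon [GF j] * mon [GKinv i]))"
  using cg_inverse[OF tsid_idl JUc(1) _ JUi(1,2)] by (simp add: vp_minus)

lemma k'inv_E: "cg JU (mon [GK'inv i] * mon [GE j]) (scale (vp (s i j)) (mon [GE j] * mon [GK'inv i]))"
  using cg_inverse[OF tsid_idl JUc(2) _ JUi(3,4)] by (simp add: vp_minus)

lemma vp_flip: "cg JU x (scale (vp n) y) \<Longrightarrow> cg JU (scale (vp (- n)) x) y"
  using cg_scale[OF lsub_idl, of double_rels x "scale (vp n) y" "vp (- n)"] by simp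

text \<open>For two thetas this is the commutator relation of \<open>E\<close> and \<open>F\<close>,
  in the mixed cases a weight relation, and for two torus letters commutativity; inverse letters are
  covered by \<open>cg_inverse\<close>.\<close>

lemma D_letters: "cg JU (Lh [l] [g]) (Rh [l] [g])"
proof (cases l)
  case (GTheta i)
  show ?thesis
  proof (cases g)
    case g: (GTheta j)
    have "mon [GE j, GF i] - mon [GF i, GE j] - scale (if j = i then - kap j else 0) (mon [GK j] - mon [GK' j]) \<in> JU"
      by (rule idl_incl) (simp add: double_rels_def cross_rels_def, blast)
    from idl_uminus[OF this] show ?thesis
      by (auto simp: GTheta g Lh_def Rh_def cg_def sc.scale_right_diff_distrib single_uminus algebra_simps)
  next
    case g: (GH j)
    show ?thesis using cg_sym[OF lsub_idl vp_flip[OF JUc(1)[of j i]]]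
      by (simp add: GTheta g Lh_def Rh_def mono_mult)
  next
    case g: (GHinv j)
    show ?thesis using cg_sym[OF lsub_idl vp_flip[OF kinv_F[of j i]]]
      by (simp add: GTheta g Lh_def Rh_def mono_mult)
  qed
next
  case (GH i)
  show ?thesis
  proof (cases g)
    case g: (GTheta j)
    show ?thesis using vp_flip[OF JUc(2)[of i j]]
      by (simp add: GH g Lh_def Rh_def mono_mult s_sym)
  next
    case g: (GH j)
    show ?thesis using cg_scale[OF lsub_idl JUc(4)[of i j], of "vp (s j i)"]
      by (simp add: GH g Lh_def Rh_def mono_mult)
  next
    case g: (GHinv j)
    show ?thesis using cg_scale[OF lsub_idl cg_sym[OF lsub_idl kk_inv(2)[of j i]], of "vp (- s j i)"]
      by (simp add: GH g Lh_def Rh_def mono_mult)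
  qed
next
  case (GHinv i)
  show ?thesis
  proof (cases g)
    case g: (GTheta j)
    show ?thesis using vp_flip[OF k'inv_E[of i j]]
      by (simp add: GHinv g Lh_def Rh_def mono_mult s_sym)
  next
    case g: (GH j)
    show ?thesis using cg_scale[OF lsub_idl cg_sym[OF lsub_idl kk_inv(1)[of j i]], of "vp (- s j i)"]
      by (simp add: GHinv g Lh_def Rh_def mono_mult)
  next
    case g: (GHinv j)
    show ?thesis using cg_scale[OF lsub_idl cg_sym[OF lsub_idl kk_inv(3)[of j i]], of "vp (s j i)"]
      by (simp add: GHinv g Lh_def Rh_def mono_mult)
  qed
qed

lemma D_Nil: "Lh [] b = Rh [] b" "Lh a [] = Rh a []"
  by (simp_all add: Lh_def Rh_def psi_Nil_right sw_eps_left_scale sw_eps_right_scale del: scale_single)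

lemma length_le_1: "length b \<le> Suc 0 \<Longrightarrow> b = [] \<or> (\<exists>g. b = [g])"
  by (cases b) auto

lemma D_short: "length a \<le> 1 \<Longrightarrow> length b \<le> 1 \<Longrightarrow> cg JU (Lh a b) (Rh a b)"
  using length_le_1[of a] length_le_1[of b] by (auto simp: D_letters D_Nil cr)

section \<open>The exchange relation for words\<close>

lemma Lh_append: "Lh (l @ a) b = sw l (\<lambda>l1 l2. sw b (\<lambda>b1 b'. scale (psi b1 l2) (mon (rm l1) * Lh a b')))"
proof -
  have "Lh (l @ a) b = sw l (\<lambda>l1 l2. sw a (\<lambda>a1 a2. sw b (\<lambda>b' b3. sw b' (\<lambda>b1 b2. scale (psi b1 l2 * psi b2 a2) (mon (rm l1 @ rm a1 @ rp b3))))))"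
    by (simp add: Lh_def sw_append psi_append_right sw_scale_left del: scale_single)
  also have "\<dots> = sw l (\<lambda>l1 l2. sw b (\<lambda>b1 b'. sw a (\<lambda>a1 a2. sw b' (\<lambda>b2 b3. scale (psi b1 l2 * psi b2 a2) (mon (rm l1 @ rm a1 @ rp b3))))))"
    by (simp only: sw_coassoc sw_swap[where a = a])
  also have "\<dots> = sw l (\<lambda>l1 l2. sw b (\<lambda>b1 b'. scale (psi b1 l2) (mon (rm l1) * Lh a b')))"
    by (simp add: Lh_def sw_scale sw_times_left scale_mult mono_mult del: scale_single)
  finally show ?thesis .
qed

lemma Rh_append: "Rh (l @ a) b = sw a (\<lambda>a1 a2. sw b (\<lambda>b' b3. scale (psi b3 a1) (Rh l b' * mon (rm a2))))"
proof -
  have "Rh (l @ a) b = sw l (\<lambda>l1 l2. sw a (\<lambda>a1 a2. sw b (\<lambda>b1 b'. sw b' (\<lambda>b2 b3. scale (psi b2 l1 * psi b3 a1) (mon (rp b1 @ rm l2 @ rm a2))))))"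
    by (simp add: Rh_def sw_append psi_append_right sw_scale_left del: scale_single)
  also have "\<dots> = sw a (\<lambda>a1 a2. sw b (\<lambda>b' b3. sw l (\<lambda>l1 l2. sw b' (\<lambda>b1 b2. scale (psi b2 l1 * psi b3 a1) (mon (rp b1 @ rm l2 @ rm a2))))))"
    by (simp only: sw_coassoc[symmetric] sw_swap[where a = l])
  also have "\<dots> = sw a (\<lambda>a1 a2. sw b (\<lambda>b' b3. scale (psi b3 a1) (Rh l b' * mon (rm a2))))"
    by (simp add: Rh_def sw_scale sw_times_right scale_mult mono_mult mult.commute del: scale_single)
  finally show ?thesis .
qed

text \<open>Once the tail \<open>a\<close> has been exchanged, regrouping yields the expression in
  which only the head \<open>l\<close> still has to be exchanged.\<close>

lemma LR_mid: "sw l (\<lambda>l1 l2. sw b (\<lambda>b1 b'. scale (psi b1 l2) (mon (rm l1) * Rh a b')))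
   = sw a (\<lambda>a1 a2. sw b (\<lambda>b' b3. scale (psi b3 a1) (Lh l b' * mon (rm a2))))"
proof -
  have "sw l (\<lambda>l1 l2. sw b (\<lambda>b1 b'. scale (psi b1 l2) (mon (rm l1) * Rh a b')))
    = sw l (\<lambda>l1 l2. sw b (\<lambda>b1 b'. sw a (\<lambda>a1 a2. sw b' (\<lambda>b2 b3. scale (psi b1 l2 * psi b3 a1) (mon (rm l1 @ rp b2 @ rm a2))))))"
    by (simp add: Rh_def sw_scale sw_times_left scale_mult mono_mult del: scale_single)
  also have "\<dots> = sw l (\<lambda>l1 l2. sw a (\<lambda>a1 a2. sw b (\<lambda>b1 b'. sw b' (\<lambda>b2 b3. scale (psi b1 l2 * psi b3 a1) (mon (rm l1 @ rp b2 @ rm a2))))))"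
    by (simp only: sw_swap[where a = b])
  also have "\<dots> = sw a (\<lambda>a1 a2. sw b (\<lambda>b' b3. sw l (\<lambda>l1 l2. sw b' (\<lambda>b1 b2. scale (psi b1 l2 * psi b3 a1) (mon (rm l1 @ rp b2 @ rm a2))))))"
    by (simp only: sw_coassoc[symmetric] sw_swap[where a = l])
  also have "\<dots> = sw a (\<lambda>a1 a2. sw b (\<lambda>b' b3. scale (psi b3 a1) (Lh l b' * mon (rm a2))))"
    by (simp add: Lh_def sw_scale sw_times_right scale_mult mono_mult mult.commute del: scale_single)
  finally show ?thesis .
qed

text \<open>Exchange the tail of the first word, regroup by \<open>LR_mid\<close>, then exchange the
  head. Coproduct factors of a word of length at most one have length at most one, so the induction
  stays within the bound, which is the range that \<open>star_induct\<close> calls for.\<close>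

lemma D_rel: "length b \<le> 1 \<Longrightarrow> cg JU (Lh a b) (Rh a b)"
proof (induction a arbitrary: b)
  case Nil then show ?case by (simp add: D_Nil cr)
next
  case (Cons l a)
  have "cg JU (sw [l] (\<lambda>l1 l2. sw b (\<lambda>b1 b'. scale (psi b1 l2) (mon (rm l1) * Lh a b'))))
     (sw [l] (\<lambda>l1 l2. sw b (\<lambda>b1 b'. scale (psi b1 l2) (mon (rm l1) * Rh a b'))))"
  proof (intro cg_sw[OF lsub_idl] cg_scale[OF lsub_idl] cg_multl[OF tsid_idl])
    fix b1 b' assume "(b1, b') \<in> cops b"
    then show "cg JU (Lh a b') (Rh a b')" using cops_facts[of b1 b' b] Cons.prems by (intro Cons.IH) simp
  qed
  moreover have "cg JU (sw a (\<lambda>a1 a2. sw b (\<lambda>b' b3. scale (psi b3 a1) (Lh [l] b' * mon (rm a2)))))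
     (sw a (\<lambda>a1 a2. sw b (\<lambda>b' b3. scale (psi b3 a1) (Rh [l] b' * mon (rm a2)))))"
  proof (intro cg_sw[OF lsub_idl] cg_scale[OF lsub_idl] cg_multr[OF tsid_idl])
    fix b1 b' assume "(b1, b') \<in> cops b"
    then show "cg JU (Lh [l] b1) (Rh [l] b1)" using cops_facts[of b1 b' b] Cons.prems by (intro D_short) simp_all
  qed
  ultimately have "cg JU (Lh ([l] @ a) b) (Rh ([l] @ a) b)"
    unfolding Lh_append Rh_append LR_mid by (rule ct)
  then show ?case by simp
qed

section \<open>The algebra homomorphism into the Drinfeld double\<close>

definition Phw :: "'i word \<Rightarrow> 'i ugen list vec" where
  "Phw w = sw3 w (\<lambda>w1 w2 w3. scale (chi w2) (mon (rp (tw w3) @ rm w1)))"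

definition Phi :: "'i word vec \<Rightarrow> 'i ugen list vec" where
  "Phi = lin scale Phw"

lemma Phi_linear: "Phi (x + y) = Phi x + Phi y" "Phi (scale c x) = scale c (Phi x)" "Phi 0 = 0" "Phi (mon w) = Phw w"
  "Phi (x - y) = Phi x - Phi y"
  by (simp_all add: Phi_def)

text \<open>The threefold coproduct \<open>\<vartheta>\<^sub>i \<otimes> 1 \<otimes> 1 + h\<^sub>i
  \<otimes> \<vartheta>\<^sub>i \<otimes> 1 + h\<^sub>i \<otimes> h\<^sub>i \<otimes>
  \<vartheta>\<^sub>i\<close> explains the normalisation of \<open>\<chi>\<close>: with
  \<open>0\<close> on thetas and \<open>1\<close> on \<open>h\<^sub>i\<close> it yields
  \<open>B\<^sub>i\<close>. The scalar for an inverse letter arises because \<open>h\<^sub>i\<close>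
  and its inverse multiply to a power of \<open>v\<close> in the twisted product.\<close>

lemma Phw_letters: "Phw [] = 1" "Phw [GTheta i] = mon [GF i] + mon [GE (\<tau> i), GK' i]"
  "Phw [GH i] = mon [GK (\<tau> i), GK' i]" "Phw [GHinv i] = scale (vp (- s i (\<tau> i))) (mon [GKinv (\<tau> i), GK'inv i])"
  by (simp_all add: Phw_def sw3_def chi_letter chi_Nil mono_Nil)

text \<open>Each of the three slots of \<open>Phw\<close> respects \<open>J\<close>: the first
  through \<open>\<rho>\<^sup>-\<close>, the second by \<open>chi_J\<close>, the third through
  \<open>\<tau>\<close> and \<open>\<rho>\<^sup>+\<close>. The coideal property, applied twice,
  combines them.\<close>

lemma Phi_J: "x \<in> J \<Longrightarrow> Phi x \<in> JU"
proof -
  assume x: "x \<in> J"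
  have A: "lin scale (\<lambda>w1. scale c (mon (p @ rm w1))) z \<in> JU" if "z \<in> J" for c p z
  proof -
    have "lin scale (\<lambda>w1. scale c (mon (p @ rm w1))) z = scale c (mon p * lett rm z)"
      by (simp add: lett_def lmap_lin[OF lmap_mult_left] lmap_lin[OF lmap_scale] mono_mult del: scale_single)
    then show ?thesis using rm_J[OF that] by (simp add: idl_scale idl_mult_left)
  qed
  have B: "lin scale (\<lambda>w3. scale c (mon (rp (tw w3) @ p))) z \<in> JU" if "z \<in> J" for c p z
  proof -
    have "lin scale (\<lambda>w3. scale c (mon (rp (tw w3) @ p))) z = scale c (lett rp (lin scale (\<lambda>w. mon (tw w)) z) * mon p)"
      by (simp add: lett_def lmap_lin[OF lmap_mult_right] lmap_lin[OF lmap_scale] lmap_lin[OF lmap_lin_self] mono_mult del: scale_single)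
    then show ?thesis using rp_J[OF tw_idl_borel[OF that]] by (simp add: idl_scale idl_mult_right)
  qed
  have M: "lin scale (\<lambda>w2. scale (chi w2) y) z \<in> JU" if "z \<in> J" for y z
  proof -
    have "lmap (*) scale (\<lambda>c. scale c y)" by (simp add: lmap_def sc.scale_left_distrib)
    from lmap_lin[OF this, of chi z] show ?thesis using chi_J[OF that] by (simp add: idl_0)
  qed
  show ?thesis unfolding Phi_def Phw_def[abs_def] sw3_def
  proof (rule conv_kill[OF vs_scale lsub_idl Del_J[OF x]])
    fix v z assume "z \<in> J"
    then show "lin scale (\<lambda>u. sw v (\<lambda>y1 y2. scale (chi y1) (mon (rp (tw y2) @ rm u)))) z \<in> JU"
      unfolding lin_sw[OF vs_scale] by (intro sw_closed A idl_add)
  next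
    fix u z assume z: "z \<in> J"
    show "lin scale (\<lambda>v. sw v (\<lambda>y1 y2. scale (chi y1) (mon (rp (tw y2) @ rm u)))) z \<in> JU"
      by (rule conv_kill[OF vs_scale lsub_idl Del_J[OF z]]) (auto intro: M B simp del: scale_single map_map)
  qed
qed

lemma sw3_append: "sw3 (a @ b) F = sw3 a (\<lambda>x y z. sw3 b (\<lambda>x' y' z'. F (x @ x') (y @ y') (z @ z')))"
  unfolding sw3_def sw_append by (simp only: sw_swap[where a = b])

lemma Lh_tw: "Lh a (tw b) = sw a (\<lambda>a1 a2. sw b (\<lambda>b1 b2. scale (pt b1 a2) (mon (rm a1 @ rp (tw b2)))))"
  and Rh_tw: "Rh a (tw b) = sw a (\<lambda>a1 a2. sw b (\<lambda>b1 b2. scale (pt b2 a1) (mon (rp (tw b1) @ rm a2))))"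
  by (simp_all add: Lh_def Rh_def sw_map_bgen pt_def)

lemma Phw_mult:
  assumes b: "length b \<le> 1" shows "cg JU (Phi (star a b)) (Phw a * Phw b)"
proof -
  let ?M = "\<lambda>X a' y a3 b1 u b'. scale (chi (y @ u)) (mon (rp (tw a3)) * X a' (tw b') * mon (rm b1))"
  let ?L = "\<lambda>a1 x y a3 b1 u v b3. scale (chi (y @ u) * pt v x) (mon (rp (tw a3) @ rm a1 @ rp (tw b3) @ rm b1))"
  let ?R = "\<lambda>a1 a2 y a3 b1 u b3 b4. scale (chi (y @ u) * pt b4 a1) (mon (rp (tw a3) @ rp (tw b3) @ rm a2 @ rm b1))"
  let ?E = "\<lambda>X. sw a (\<lambda>a' r. sw r (\<lambda>y a3. sw3 b (\<lambda>b1 u b'. ?M X a' y a3 b1 u b')))"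
  \<comment> \<open>The character property on words. The factor \<open>pt v x\<close> that it
    produces completes \<open>\<rho>\<^sup>- a\<^sub>1 \<rho>\<^sup>+ (\<tau> b\<^sub>3)\<close> to
    the left side \<open>Lh\<close> of the exchange relation.\<close>
  have chi2: "chi p * chi q = sw p (\<lambda>x y. sw q (\<lambda>u v. pt v x * chi (y @ u)))" for p q
    using chi_STAR[of "mon p" "mon q"] by (simp add: STAR_mon star_def sw_lin)
  have "Phw a * Phw b = sw3 a (\<lambda>a1 a2 a3. sw3 b (\<lambda>b1 b2 b3. scale (chi a2 * chi b2) (mon (rp (tw a3) @ rm a1 @ rp (tw b3) @ rm b1))))"
    unfolding Phw_def
    by (simp only: sw3_times_right, simp only: sw3_times_left scale_mult sc.scale_scale mono_mult append.assoc mult.commute)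
  also have "\<dots> = sw3 a (\<lambda>a1 a2 a3. sw3 b (\<lambda>b1 b2 b3. sw a2 (\<lambda>x y. sw b2 (\<lambda>u v. ?L a1 x y a3 b1 u v b3))))"
    by (simp only: chi2 sw_scale_left mult.commute)
  also have "\<dots> = sw4 a (\<lambda>a1 x y a3. sw4 b (\<lambda>b1 u v b3. ?L a1 x y a3 b1 u v b3))"
    by (simp only: sw3_sw_swap[where a = b] sw4_mid3)
  also have "\<dots> = ?E Lh"
    unfolding Lh_tw
    by (simp only: sw_times_left sw_times_right sw_scale scale_mult sc.scale_scale mono_mult append.assoc
        sw3_sw_swap[where a = b] sw4_last3 sw4_pair2)
  finally have 1: "Phw a * Phw b = ?E Lh" .
  have "cg JU (?E Lh) (?E Rh)"
    unfolding sw3_def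
  proof (intro cg_sw[OF lsub_idl] cg_scale[OF lsub_idl] cg_multr[OF tsid_idl] cg_multl[OF tsid_idl])
    fix b1 r u b' assume "(b1, r) \<in> cops b" "(u, b') \<in> cops r"
    then have "length (tw b') \<le> 1" using cops_facts[of b1 r b] cops_facts[of u b' r] b by simp
    then show "cg JU (Lh a' (tw b')) (Rh a' (tw b'))" for a' by (rule D_rel)
  qed
  \<comment> \<open>On the right side of the exchange relation the pairing joins the first part of
    \<open>a\<close> to the last part of \<open>b\<close>, as in the definition of
    \<open>star\<close>.\<close>
  moreover have "?E Rh = sw4 a (\<lambda>a1 a2 y a3. sw4 b (\<lambda>b1 u b3 b4. ?R a1 a2 y a3 b1 u b3 b4))"
    unfolding Rh_tw
    by (simp only: sw_times_left sw_times_right sw_scale scale_mult sc.scale_scale mono_mult append.assoc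
        sw3_sw_swap[where a = b] sw4_last3 sw4_pair2)
  moreover have "Phi (star a b) = \<dots>"
  proof -
    have "Phi (star a b) = sw a (\<lambda>a1 r. sw b (\<lambda>b' b4. scale (pt b4 a1) (Phw (r @ b'))))"
      by (simp add: Phi_def star_def sw_lin)
    also have "\<dots> = sw a (\<lambda>a1 r. sw b (\<lambda>b' b4. sw3 r (\<lambda>a2 y a3. sw3 b' (\<lambda>b1 u b3. ?R a1 a2 y a3 b1 u b3 b4))))"
      by (simp only: Phw_def sw3_append sw3_scale sc.scale_scale map_append append.assoc mult.commute)
    also have "\<dots> = sw a (\<lambda>a1 r. sw3 r (\<lambda>a2 y a3. sw b (\<lambda>b' b4. sw3 b' (\<lambda>b1 u b3. ?R a1 a2 y a3 b1 u b3 b4))))"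
      by (simp only: sw3_sw_swap)
    also have "\<dots> = sw4 a (\<lambda>a1 a2 y a3. sw4 b (\<lambda>b1 u b3 b4. ?R a1 a2 y a3 b1 u b3 b4))"
      by (simp only: sw4_left3 sw4_first3)
    finally show ?thesis .
  qed
  ultimately have "cg JU (Phw a * Phw b) (Phi (star a b))" using 1 by simp
  then show ?thesis by (rule cg_sym[OF lsub_idl])
qed

text \<open>As for \<open>chi_STAR\<close>: the case of a letter on the right propagates to all
  words through \<open>star_induct\<close> and the associativity of both products.\<close>

lemma Phi_STAR: "cg JU (Phi (STAR x y)) (Phi x * Phi y)"
proof -
  let ?P = "{y. \<forall>x. cg JU (Phi (STAR x y)) (Phi x * Phi y)}"
  have P: "lsub scale ?P"
  proof -
    have "cg JU (Phi x * Phi (scale c y)) (scale c (Phi x * Phi y))" for x c y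
      by (simp add: Phi_linear scale_mult cr)
    then show ?thesis
      by (auto simp: lsub_def STAR_linear Phi_linear distrib_left scale_mult cr intro: cg_add[OF lsub_idl] cg_scale[OF lsub_idl])
  qed
  have s0: "cg JU (Phi (STAR x (mon b))) (Phi x * Phw b)" if "length b \<le> 1" for x b
    by (induction x rule: vec_induct)
       (auto simp: STAR_linear Phi_linear STAR_mon distrib_right scale_mult cr simp del: scale_single
         intro: cg_add[OF lsub_idl] cg_scale[OF lsub_idl] Phw_mult that)
  have 1: "mon [] \<in> ?P" using s0[of "[]"] by (simp add: Phi_linear)
  have "mon w \<in> ?P" for w
  proof (rule star_induct[where A = UNIV, OF _ P 1])
    fix y and g :: "'i bgen" assume y: "y \<in> ?P"
    have "cg JU (Phi (STAR (STAR x y) (mon [g]))) (Phi x * Phi (STAR y (mon [g])))" for x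
    proof (rule ct[OF s0])
      have "cg JU (Phi (STAR x y) * Phw [g]) (Phi x * Phi y * Phw [g])"
        using y by (intro cg_multr[OF tsid_idl]) auto
      moreover have "cg JU (Phi x * (Phi y * Phw [g])) (Phi x * Phi (STAR y (mon [g])))"
        by (rule cg_multl[OF tsid_idl cg_sym[OF lsub_idl s0]]) simp
      ultimately show "cg JU (Phi (STAR x y) * Phw [g]) (Phi x * Phi (STAR y (mon [g])))"
        unfolding mult.assoc by (rule ct)
    qed simp
    then show "STAR y (mon [g]) \<in> ?P" by (simp add: STAR_assoc)
  qed auto
  then have "y \<in> ?P"
  proof (induction y rule: vec_induct)
    case (mon k c) then show ?case by (intro lsub_scale[OF P])
  qed (use P in \<open>auto simp: lsub_def\<close>)
  then show ?thesis by blast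
qed

end

section \<open>A faithful module\<close>

text \<open>\<open>F\<close> and \<open>K'\<close> act on functions \<open>\<xi>\<close> from the Borel part to itself through the opposite coproduct by
  right multiplication on the argument and left multiplication on the value; \<open>E\<close> and \<open>K\<close> act by
  the adjoints of these multiplications with respect to the pairing.\<close>

context satake
begin

definition Lop :: "'i word \<Rightarrow> 'i word vec \<Rightarrow> 'i word vec" where
  "Lop x = lin scale (\<lambda>w. sw w (\<lambda>u v. scale (psi x u) (mon v)))"

definition Rop :: "'i word \<Rightarrow> 'i word vec \<Rightarrow> 'i word vec" where
  "Rop x = lin scale (\<lambda>w. sw w (\<lambda>u v. scale (psi x v) (mon u)))"

lemma op_linear [simp]:
  "Lop x (a + b) = Lop x a + Lop x b" "Lop x (scale c a) = scale c (Lop x a)" "Lop x 0 = 0"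
  "Rop x (a + b) = Rop x a + Rop x b" "Rop x (scale c a) = scale c (Rop x a)" "Rop x 0 = 0"
  by (simp_all add: Lop_def Rop_def)

lemma op_lmap: "lmap scale scale (Lop x)" "lmap scale scale (Rop x)"
  by (simp_all add: lmap_def)

lemma op_mon: "Lop x (mon w) = sw w (\<lambda>u v. scale (psi x u) (mon v))" "Rop x (mon w) = sw w (\<lambda>u v. scale (psi x v) (mon u))"
  by (simp_all add: Lop_def Rop_def)

lemma op_Nil: "Lop [] a = a" "Rop [] a = a"
  by (induction a rule: vec_induct) (simp_all add: op_mon sw_eps_left_scale sw_eps_right_scale del: scale_single)

lemma op_one: "Lop x 1 = scale (eps x) 1"
  by (simp add: op_mon psi_Nil_right flip: mono_Nil)

text \<open>For a group-like letter the operator is thus multiplicative and for a theta a skew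
  derivation, which reduces the cross relations to values on letters.\<close>

lemma Lop_mult: "Lop x (a * b) = sw x (\<lambda>x1 x2. Lop x1 a * Lop x2 b)"
proof (induction a rule: vec_induct)
  case (mon k c)
  show ?case
  proof (induction b rule: vec_induct)
    case m2: (mon l e)
    have "Lop x (mon k * mon l) = sw k (\<lambda>u v. sw l (\<lambda>u' v'. sw x (\<lambda>x1 x2. scale (psi x1 u * psi x2 u') (mon (v @ v')))))"
      by (simp only: mono_mult op_mon sw_append psi_append_right sw_scale_left)
    also have "\<dots> = sw x (\<lambda>x1 x2. sw k (\<lambda>u v. sw l (\<lambda>u' v'. scale (psi x1 u * psi x2 u') (mon (v @ v')))))"
      by (simp only: sw_swap[where b = x])
    also have "\<dots> = sw x (\<lambda>x1 x2. Lop x1 (mon k) * Lop x2 (mon l))"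
      by (simp only: op_mon sw_times_right) (simp only: sw_times_left scale_mult sw_scale sc.scale_scale mono_mult mult.commute)
    finally show ?case by (simp add: scale_mult sw_scale[symmetric] del: scale_single)
  qed (simp_all add: distrib_left sw_add)
qed (simp_all add: distrib_right sw_add)

lemma Rop_mult: "Rop x (a * b) = sw x (\<lambda>x1 x2. Rop x1 a * Rop x2 b)"
proof (induction a rule: vec_induct)
  case (mon k c)
  show ?case
  proof (induction b rule: vec_induct)
    case m2: (mon l e)
    have "Rop x (mon k * mon l) = sw k (\<lambda>u v. sw l (\<lambda>u' v'. sw x (\<lambda>x1 x2. scale (psi x1 v * psi x2 v') (mon (u @ u')))))"
      by (simp only: mono_mult op_mon sw_append psi_append_right sw_scale_left)
    also have "\<dots> = sw x (\<lambda>x1 x2. sw k (\<lambda>u v. sw l (\<lambda>u' v'. scale (psi x1 v * psi x2 v') (mon (u @ u')))))"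
      by (simp only: sw_swap[where b = x])
    also have "\<dots> = sw x (\<lambda>x1 x2. Rop x1 (mon k) * Rop x2 (mon l))"
      by (simp only: op_mon sw_times_right) (simp only: sw_times_left scale_mult sw_scale sc.scale_scale mono_mult mult.commute)
    finally show ?case by (simp add: scale_mult sw_scale[symmetric] del: scale_single)
  qed (simp_all add: distrib_left sw_add)
qed (simp_all add: distrib_right sw_add)

lemma Lop_append: "Lop y (Lop x a) = Lop (x @ y) a"
proof (induction a rule: vec_induct)
  case (mon w c)
  have "Lop y (Lop x (mon w)) = sw w (\<lambda>u v. sw v (\<lambda>v1 v2. scale (psi x u * psi y v1) (mon v2)))"
    by (simp only: op_mon sw_lmap[OF op_lmap(1)] op_linear sw_scale sc.scale_scale)
  also have "\<dots> = Lop (x @ y) (mon w)"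
    by (simp only: op_mon psi_append_left sw_scale_left sw_coassoc)
  finally show ?case by (simp del: scale_single)
qed simp_all

lemma Rop_append: "Rop x (Rop y a) = Rop (x @ y) a"
proof (induction a rule: vec_induct)
  case (mon w c)
  have "Rop x (Rop y (mon w)) = sw w (\<lambda>u v. sw u (\<lambda>u1 u2. scale (psi y v * psi x u2) (mon u1)))"
    by (simp only: op_mon sw_lmap[OF op_lmap(2)] op_linear sw_scale sc.scale_scale)
  also have "\<dots> = Rop (x @ y) (mon w)"
    by (simp only: op_mon psi_append_left sw_scale_left sw_coassoc mult.commute)
  finally show ?case by (simp del: scale_single)
qed simp_all

lemma lin_scale_vec: "lin scale (\<lambda>k. scale (p k) y) z = scale (lin (*) p z) y"
  by (simp add: lin_def sc.scale_sum_left)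

lemma op_J: "z \<in> J \<Longrightarrow> Lop x z \<in> J" "z \<in> J \<Longrightarrow> Rop x z \<in> J"
  unfolding Lop_def Rop_def
  by (rule conv_kill[OF vs_scale lsub_idl Del_J];
      simp add: lin_scale_vec psi_J_right idl_0 lmap_lin[OF lmap_scale, symmetric] idl_scale del: scale_single)+

lemma op_kill: "z \<in> J \<Longrightarrow> lin scale (\<lambda>x. Lop x a) z = 0" "z \<in> J \<Longrightarrow> lin scale (\<lambda>x. Rop x a) z = 0"
  unfolding Lop_def Rop_def
  by (subst lin_swap[OF vs_scale]; simp add: lin_sw lin_scale_vec psi_J_left del: scale_single)+

definition bact :: "'i word \<Rightarrow> ('i word vec \<Rightarrow> 'i word vec) \<Rightarrow> 'i word vec \<Rightarrow> 'i word vec" where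
  "bact b \<xi> = (\<lambda>a. sw b (\<lambda>b1 b2. Rop b1 (\<xi> (Lop b2 a))))"

definition yact :: "'i word \<Rightarrow> ('i word vec \<Rightarrow> 'i word vec) \<Rightarrow> 'i word vec \<Rightarrow> 'i word vec" where
  "yact y \<xi> = (\<lambda>a. sw y (\<lambda>y1 y2. mon y2 * \<xi> (a * mon y1)))"

fun act :: "'i ugen \<Rightarrow> ('i word vec \<Rightarrow> 'i word vec) \<Rightarrow> 'i word vec \<Rightarrow> 'i word vec" where
  "act (GE i) = bact [GTheta i]" | "act (GK i) = bact [GH i]" | "act (GKinv i) = bact [GHinv i]"
| "act (GF i) = yact [GTheta i]" | "act (GK' i) = yact [GH i]" | "act (GK'inv i) = yact [GHinv i]"

abbreviation "actw \<equiv> foldr act"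

lemma bact_append: "bact (b @ b') \<xi> = bact b (bact b' \<xi>)"
proof
  fix a
  show "bact (b @ b') \<xi> a = bact b (bact b' \<xi>) a"
    unfolding bact_def by (simp only: sw_append sw_lmap[OF op_lmap(2)] Lop_append Rop_append)
qed

lemma yact_append: "yact (y @ y') \<xi> = yact y (yact y' \<xi>)"
  unfolding yact_def by (simp only: sw_append sw_times_left mult.assoc[symmetric] mono_mult) (simp only: mult.assoc mono_mult)

lemma actw_rp: "lmap scale scale \<xi> \<Longrightarrow> actw (rp b) \<xi> = bact b \<xi>"
proof (induction b)
  case Nil then show ?case by (simp add: bact_def op_Nil)
next
  case (Cons g b)
  then show ?case using bact_append[of "[g]" b \<xi>] by (cases g) simp_all
qed

lemma actw_rm: "actw (rm y) \<xi> = yact y \<xi>"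
proof (induction y)
  case Nil then show ?case by (simp add: yact_def mono_Nil)
next
  case (Cons g y)
  then show ?case using yact_append[of "[g]" y \<xi>] by (cases g) simp_all
qed

text \<open>Words act on functions of the free algebra; the good ones are linear and descend to the
  quotient by \<open>J\<close>. The action preserves this class, so that a relation can be tested in
  any context.\<close>

definition good :: "('i word vec \<Rightarrow> 'i word vec) \<Rightarrow> bool" where
  "good \<xi> \<longleftrightarrow> lmap scale scale \<xi> \<and> (\<forall>x\<in>J. \<xi> x \<in> J)"

lemma lmap_sw_sum: "(\<And>u v. lmap scale scale (F u v)) \<Longrightarrow> lmap scale scale (\<lambda>a. sw w (\<lambda>u v. F u v a))"
  unfolding lmap_def by (simp add: sw_add sw_scale)

lemma good_bact: "good \<xi> \<Longrightarrow> good (bact b \<xi>)"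
  unfolding good_def bact_def
  by (auto intro!: lmap_sw_sum sw_closed op_J idl_add lmap_comp[OF op_lmap(1) lmap_comp[OF _ op_lmap(2)]])

lemma good_yact: "good \<xi> \<Longrightarrow> good (yact b \<xi>)"
  unfolding good_def yact_def
  by (auto intro!: lmap_sw_sum sw_closed idl_mult_left idl_add lmap_comp[OF lmap_mult_right lmap_comp[OF _ lmap_mult_left]])
     (metis idl_mult_right)

lemma good_actw: "good \<xi> \<Longrightarrow> good (actw w \<xi>)"
proof (induction w)
  case (Cons g w) then show ?case by (cases g) (simp_all add: good_bact good_yact)
qed simp

lemma null_actw: "(\<And>a. \<eta> a \<in> J) \<Longrightarrow> actw w \<eta> a \<in> J"
proof (induction w arbitrary: a)
  case (Cons g w)
  have "actw w \<eta> c \<in> J" for c by (rule Cons.IH[OF Cons.prems])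
  then have "bact b (actw w \<eta>) a \<in> J" "yact b (actw w \<eta>) a \<in> J" for b
    unfolding bact_def yact_def by (auto intro!: sw_closed idl_add op_J idl_mult_left)
  then show ?case by (cases g) simp_all
qed simp

lemma lin_actw: "lin scale (\<lambda>k. actw w (\<eta> k) a) z = actw w (\<lambda>c. lin scale (\<lambda>k. \<eta> k c) z) a"
proof (induction w arbitrary: a)
  case (Cons g w)
  have "lin scale (\<lambda>k. bact b (actw w (\<eta> k)) a) z = bact b (\<lambda>c. lin scale (\<lambda>k. actw w (\<eta> k) c) z) a"
    "lin scale (\<lambda>k. yact b (actw w (\<eta> k)) a) z = yact b (\<lambda>c. lin scale (\<lambda>k. actw w (\<eta> k) c) z) a" for b
    unfolding bact_def yact_def by (simp_all add: lin_sw lmap_lin[OF op_lmap(2)] lmap_lin[OF lmap_mult_left])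
  then show ?case using Cons by (cases g) simp_all
qed simp

lemma op_letters:
  "Lop [GTheta i] (mon [GTheta j]) = scale (if i = j then kap i else 0) 1" "Lop [GTheta i] (mon [GH j]) = 0"
  "Lop [GH i] (mon [GTheta j]) = scale (vp (s i j)) (mon [GTheta j])" "Lop [GH i] (mon [GH j]) = scale (vp (s i j)) (mon [GH j])"
  "Rop [GTheta i] (mon [GTheta j]) = scale (if i = j then kap i else 0) (mon [GH j])" "Rop [GTheta i] (mon [GH j]) = 0"
  "Rop [GH i] (mon [GTheta j]) = mon [GTheta j]" "Rop [GH i] (mon [GH j]) = scale (vp (s i j)) (mon [GH j])"
  by (simp_all add: op_mon flip: mono_Nil)

lemma act_letters:
  "bact [GTheta i] \<xi> a = Rop [GTheta i] (\<xi> a) + Rop [GH i] (\<xi> (Lop [GTheta i] a))"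
  "bact [GH i] \<xi> a = Rop [GH i] (\<xi> (Lop [GH i] a))"
  "yact [GTheta j] \<xi> a = \<xi> (a * mon [GTheta j]) + mon [GTheta j] * \<xi> (a * mon [GH j])"
  "yact [GH j] \<xi> a = mon [GH j] * \<xi> (a * mon [GH j])"
  by (simp_all add: bact_def yact_def op_Nil mono_Nil)

text \<open>The skew-derivation rules rewrite every term through \<open>\<xi>\<close> at the same
  few arguments. These relations hold exactly for every linear \<open>\<xi>\<close>.\<close>

lemma act_cross:
  assumes "lmap scale scale \<xi>" "r \<in> cross_rels"
  shows "lin scale (\<lambda>w. actw w \<xi> a) r = 0"
proof -
  have x: "\<xi> (x + y) = \<xi> x + \<xi> y" "\<xi> (scale c x) = scale c (\<xi> x)" "\<xi> 0 = 0" for x y c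
    using assms(1) lmap_0 by (auto simp: lmap_def)
  note simps = act_letters Lop_mult Rop_mult op_letters op_Nil x scale_mult distrib_left sc.scale_right_distrib s_sym
  from assms(2) consider
      i j where "r = mon [GE i, GF j] - mon [GF j, GE i] - scale (if i = j then - kap i else 0) (mon [GK i] - mon [GK' i])"
    | i j where "r = mon [GK i, GF j] - scale (vp (- s i j)) (mon [GF j, GK i])"
    | i j where "r = mon [GK' i, GE j] - scale (vp (- s i j)) (mon [GE j, GK' i])"
    | i j where "r = mon [GK i, GK' j] - mon [GK' j, GK i]"
    | i j where "r = mon [GK' i, GK j] - mon [GK j, GK' i]"
    unfolding cross_rels_def by blast
  then show ?thesis
  proof cases
    case 1 show ?thesis unfolding 1
      by (simp add: simps sc.scale_right_diff_distrib del: scale_single)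
  next
    case 2 show ?thesis unfolding 2 by (simp add: simps del: scale_single)
  next
    case 3 show ?thesis unfolding 3 by (simp add: simps del: scale_single)
  next
    case 4 show ?thesis unfolding 4 by (simp add: simps del: scale_single)
  next
    case 5 show ?thesis unfolding 5 by (simp add: simps del: scale_single)
  qed
qed

text \<open>A relation in the \<open>E\<close>, \<open>K\<close> half acts by zero, because the
  pairing kills \<open>J\<close> in its first argument (\<open>op_kill\<close>). A relation in the
  \<open>F\<close>, \<open>K'\<close> half multiplies the argument or the value by an element of
  \<open>J\<close>, and a good \<open>\<xi>\<close> keeps that inside \<open>J\<close>.\<close>

lemma act_rel:
  assumes "good \<xi>" "r \<in> double_rels"
  shows "lin scale (\<lambda>w. actw w \<xi> a) r \<in> J"
proof -
  have x: "lmap scale scale \<xi>" "\<And>z. z \<in> J \<Longrightarrow> \<xi> z \<in> J" using assms(1) by (auto simp: good_def)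
  consider r0 where "r0 \<in> J" "r = lett rp r0" | r0 where "r0 \<in> J" "r = lett rm r0" | "r \<in> cross_rels"
    using assms(2) by (auto simp: double_rels_def intro: idl_incl)
  then show ?thesis
  proof cases
    case 1
    have "lin scale (\<lambda>w. actw w \<xi> a) r = lin scale (\<lambda>b. sw b (\<lambda>b1 b2. Rop b1 (\<xi> (Lop b2 a)))) r0"
      unfolding 1 lett_def by (simp add: lmap_lin[OF lmap_lin_self] actw_rp[OF x(1)] bact_def)
    also have "\<dots> \<in> {0}"
    proof (rule conv_kill[OF vs_scale lsub_zero[OF vs_scale] Del_J[OF 1(1)]])
      fix u z assume z: "z \<in> J"
      have "lin scale (\<lambda>b2. Rop u (\<xi> (Lop b2 a))) z = Rop u (\<xi> (lin scale (\<lambda>b2. Lop b2 a) z))"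
        by (simp add: lmap_lin[OF op_lmap(2)] lmap_lin[OF x(1)])
      then show "lin scale (\<lambda>b2. Rop u (\<xi> (Lop b2 a))) z \<in> {0}" using op_kill(1)[OF z] lmap_0[OF x(1)] by simp
    qed (simp add: op_kill)
    finally show ?thesis by (simp add: idl_0)
  next
    case 2
    have "lin scale (\<lambda>w. actw w \<xi> a) r = lin scale (\<lambda>b. sw b (\<lambda>b1 b2. mon b2 * \<xi> (a * mon b1))) r0"
      unfolding 2 lett_def by (simp add: lmap_lin[OF lmap_lin_self] actw_rm yact_def)
    also have "\<dots> \<in> J"
    proof (rule conv_kill[OF vs_scale lsub_idl Del_J[OF 2(1)]])
      fix v z assume z: "z \<in> J"
      have "lin scale (\<lambda>u. mon v * \<xi> (a * mon u)) z = mon v * \<xi> (a * z)"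
        using lmap_eq_lin[OF lmap_comp[OF lmap_comp[OF lmap_mult_left x(1)] lmap_mult_left] vs_scale, of "mon v" a z] by simp
      then show "lin scale (\<lambda>u. mon v * \<xi> (a * mon u)) z \<in> J" using z by (simp add: x idl_mult_left)
    next
      fix u z assume z: "z \<in> J"
      have "lin scale (\<lambda>v. mon v * \<xi> (a * mon u)) z = z * \<xi> (a * mon u)"
        using lmap_eq_lin[OF lmap_mult_right[where y = "\<xi> (a * mon u)"] vs_scale, of z] by simp
      then show "lin scale (\<lambda>v. mon v * \<xi> (a * mon u)) z \<in> J" using z by (simp add: idl_mult_right)
    qed
    finally show ?thesis .
  next
    case 3 then show ?thesis by (simp add: act_cross[OF x(1)] idl_0)
  qed
qed

lemma act_JU:
  assumes "good \<xi>" "z \<in> JU"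
  shows "lin scale (\<lambda>w. actw w \<xi> a) z \<in> J"
proof (rule lin_idl[OF vs_scale lsub_idl _ assms(2)])
  fix r p q assume r: "r \<in> double_rels"
  \<comment> \<open>The right context \<open>q\<close> is absorbed into \<open>\<xi>\<close>, which
    stays good; the left context \<open>p\<close> acts last and preserves functions with values in
    \<open>J\<close>.\<close>
  have "actw p (\<lambda>c. lin scale (\<lambda>w. actw w (actw q \<xi>) c) r) a \<in> J"
    by (intro null_actw act_rel good_actw assms(1) r)
  then show "lin scale (\<lambda>w. actw (p + w + q) \<xi> a) r \<in> J"
    by (simp add: plus_list_def lin_actw)
qed

section \<open>Injectivity\<close>

text \<open>The weight left over when \<open>\<Phi> a\<close> acts on the counit: by
  \<open>GG_eval\<close>, evaluating the result at \<open>1\<close> gives the sum of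
  \<open>a\<^sub>1\<close> scaled by \<open>gg a\<^sub>2\<close>.\<close>

definition gg :: "'i word \<Rightarrow> qfield" where
  "gg q = sw3 q (\<lambda>v w2 w3. chi w2 * pt w3 v)"

definition GG :: "'i word vec \<Rightarrow> 'i word vec" where
  "GG = lin scale (\<lambda>w. sw w (\<lambda>u q. scale (gg q) (mon u)))"

definition xi0 :: "'i word vec \<Rightarrow> 'i word vec" where
  "xi0 a = scale (lin (*) eps a) 1"

lemma good_xi0: "good xi0"
  by (auto simp: good_def lmap_def xi0_def sc.scale_left_distrib eps_J idl_0)

text \<open>At \<open>1\<close> the counit turns the \<open>F\<close>, \<open>K'\<close> part into
  the word \<open>y\<close> itself. The left operators in \<open>bact\<close> meet only
  \<open>1\<close>, on which they act by the counit, so the right operator remains.\<close>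

lemma act_xi0: "actw (rp b @ rm y) xi0 1 = Rop b (mon y)"
proof -
  have x: "lmap scale scale xi0" using good_xi0 by (simp add: good_def)
  have y: "lmap scale scale (yact y xi0)" using good_yact[OF good_xi0] by (simp add: good_def)
  have y1: "yact y xi0 1 = mon y"
    by (simp add: yact_def xi0_def scale_mult sw_eps_left_scale del: scale_single)
  have "actw (rp b @ rm y) xi0 1 = sw b (\<lambda>b1 b2. scale (eps b2) (Rop b1 (yact y xi0 1)))"
    using y by (simp add: actw_rp[OF y] actw_rm bact_def op_one lmap_def)
  then show ?thesis by (simp add: y1 sw_eps_right_scale[of b "\<lambda>b1. Rop b1 (mon y)"])
qed

lemma GG_eval: "GG x = lin scale (\<lambda>w. actw w xi0 1) (Phi x)"
proof -
  have "lin scale (\<lambda>w. actw w xi0 1) (Phw w) = sw w (\<lambda>u q. scale (gg q) (mon u))" for w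
  proof -
    have "lin scale (\<lambda>w. actw w xi0 1) (Phw w) = sw w (\<lambda>w1 r. sw r (\<lambda>w2 w3. sw w1 (\<lambda>u v. scale (chi w2 * pt w3 v) (mon u))))"
      unfolding Phw_def sw3_def sw_lin[OF vs_scale] lin_scale[OF vs_scale] lin_single[OF vs_scale] act_xi0 op_mon
      by (simp add: sw_scale pt_def del: foldr_append)
    also have "\<dots> = sw w (\<lambda>w1 r. sw w1 (\<lambda>u v. sw r (\<lambda>w2 w3. scale (chi w2 * pt w3 v) (mon u))))"
      by (rule sw_cong_cops) (rule sw_swap)
    also have "\<dots> = sw w (\<lambda>u q. sw q (\<lambda>v r. sw r (\<lambda>w2 w3. scale (chi w2 * pt w3 v) (mon u))))"
      by (rule sw_coassoc)
    finally show ?thesis by (simp only: gg_def sw3_def sw_scale_left)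
  qed
  then show ?thesis by (simp add: GG_def Phi_def lmap_lin[OF lmap_lin_self])
qed

lemma gg_J: "x \<in> J \<Longrightarrow> lin (*) gg x = 0"
proof -
  assume x: "x \<in> J"
  have "lin (*) (\<lambda>q. sw q (\<lambda>v y. sw y (\<lambda>w2 w3. chi w2 * pt w3 v))) x \<in> {0}"
  proof (rule conv_kill[OF vs_times lsub_zero[OF vs_times] Del_J[OF x]])
    fix u z assume z: "z \<in> J"
    show "lin (*) (\<lambda>y. sw y (\<lambda>w2 w3. chi w2 * pt w3 u)) z \<in> {0}"
      by (rule conv_kill[OF vs_times lsub_zero[OF vs_times] Del_J[OF z]])
         (simp_all add: lin_times_left lin_times_right chi_J pt_J_left)
  qed (simp add: lin_sw lin_times_left pt_J_right)
  then show ?thesis unfolding gg_def[abs_def] sw3_def by simp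
qed

lemma GG_J: "x \<in> J \<Longrightarrow> GG x \<in> J"
  unfolding GG_def
  by (rule conv_kill[OF vs_scale lsub_idl Del_J];
      simp add: lin_scale_vec gg_J idl_0 lmap_lin[OF lmap_scale, symmetric] idl_scale del: scale_single)

lemma gg_invariant:
  assumes "r \<in> J" shows "lin (*) (\<lambda>w. gg (a @ w @ b)) r = 0"
  using gg_J[OF idl_mult_right[OF idl_mult_left[OF assms, of "mon a"], of "mon b"]]
  by (simp add: lin_sandwich plus_list_def)

section \<open>Theta degree and leading terms\<close>

definition tpart :: "'i word \<Rightarrow> 'i word" where
  "tpart = filter (\<lambda>g. \<not> is_theta g)"

lemma tpart_simps [simp]:
  "tpart [] = []" "tpart (GTheta i # w) = tpart w" "tpart (GH i # w) = GH i # tpart w"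
  "tpart (GHinv i # w) = GHinv i # tpart w" "tpart (u @ v) = tpart u @ tpart v"
  by (simp_all add: tpart_def)

lemma tfree_tpart: "tfree (tpart w)"
  by (auto simp: tpart_def tfree_def)

lemma sw_tfree: "tfree t \<Longrightarrow> sw t F = F t t"
  by (induction t arbitrary: F rule: cops.induct) auto

text \<open>A theta that goes to the left factor leaves nothing on the right, while torus letters
  are copied to both factors. Keeping every theta on the left therefore gives the single term
  \<open>(w, tpart w)\<close>.\<close>

lemma sw_leading:
  fixes F :: "'i word \<Rightarrow> 'i word \<Rightarrow> 'i word vec"
  assumes "lsub scale N" "\<And>u q. (u, q) \<in> cops w \<Longrightarrow> ntheta u < ntheta w \<Longrightarrow> F u q \<in> N"
  shows "sw w F - F w (tpart w) \<in> N"
  using assms(2)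
proof (induction w arbitrary: F rule: cops.induct)
  case 1 then show ?case using assms(1) by (simp add: lsub_0)
next
  case (2 i w)
  have "sw w (\<lambda>u v. F (GTheta i # u) v) - F (GTheta i # w) (tpart w) \<in> N"
    by (rule "2.IH"(1)) (force intro: "2.prems")
  moreover have "sw w (\<lambda>u v. F (GH i # u) (GTheta i # v)) \<in> N"
  proof (intro sw_closed)
    fix u v assume uv: "(u, v) \<in> cops w"
    then have "ntheta u \<le> ntheta w" using cops_facts[OF uv] by simp
    then show "F (GH i # u) (GTheta i # v) \<in> N" using uv by (intro "2.prems") force+
  qed (use assms(1) in \<open>auto simp: lsub_def\<close>)
  ultimately have "sw w (\<lambda>u v. F (GTheta i # u) v) - F (GTheta i # w) (tpart w) + sw w (\<lambda>u v. F (GH i # u) (GTheta i # v)) \<in> N"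
    by (rule lsub_add[OF assms(1)])
  then show ?case by (simp add: algebra_simps)
next
  case (3 i w)
  show ?case unfolding sw.simps tpart_simps by (rule "3.IH") (force intro: "3.prems")
next
  case (4 i w)
  show ?case unfolding sw.simps tpart_simps by (rule "4.IH") (force intro: "4.prems")
qed

lemma pl_tfree: "\<not> is_theta g \<Longrightarrow> tfree t \<Longrightarrow> pl g t \<noteq> 0"
proof (induction t)
  case Nil then show ?case by (cases g) simp_all
next
  case (Cons l t) then show ?case by (cases g; cases l) simp_all
qed

lemma psi_tfree: "tfree w \<Longrightarrow> tfree t \<Longrightarrow> psi w t \<noteq> 0"
proof (induction w)
  case Nil then show ?case by (simp add: eps_def)
next
  case (Cons g w)
  moreover have "\<not> is_theta g" using Cons by (auto simp: tfree_def)
  ultimately show ?case using pl_tfree[of g t] by (auto simp: sw_tfree tfree_def)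
qed

lemma chi_tfree: "tfree t \<Longrightarrow> chi t \<noteq> 0"
proof (induction t rule: rev_induct)
  case (snoc g t)
  then have "tfree t" "\<not> is_theta g" by (auto simp: tfree_def)
  moreover have "ug g t \<noteq> 0" using calculation by (cases g) (auto simp: ug_torus pl_tfree)
  ultimately show ?case using snoc by (simp add: chi_snoc sw_tfree)
qed (simp add: chi_Nil)

text \<open>Torus words are group-like, so the Sweedler sums collapse to one term, a product of
  powers of \<open>v\<close>.\<close>

lemma gg_tfree: "tfree t \<Longrightarrow> gg t \<noteq> 0"
proof -
  assume t: "tfree t"
  have "tfree (tw t)"
  proof -
    have "is_theta (map_bgen \<tau> g) = is_theta g" for g by (cases g) auto
    then show ?thesis using t by (auto simp: tfree_def)
  qed
  then show ?thesis using t by (simp add: gg_def sw3_def sw_tfree chi_tfree pt_def psi_tfree)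
qed

definition mw :: "('i word \<Rightarrow> qfield) \<Rightarrow> 'i word vec \<Rightarrow> 'i word vec" where
  "mw c = lin scale (\<lambda>w. scale (c w) (mon w))"

lemma mw_linear: "mw c (x + y) = mw c x + mw c y" "mw c (x - y) = mw c x - mw c y" "mw c 0 = 0"
   "mw c (scale k x) = scale k (mw c x)" "mw c (mon w) = scale (c w) (mon w)"
  by (simp_all add: mw_def)

lemma lookup_mw: "lookup (mw c x) w = c w * lookup x w"
  by (induction x rule: vec_induct)
     (simp_all add: mw_linear lookup_add algebra_simps lookup_single when_def del: scale_single)

text \<open>When \<open>c\<close> takes one value on all words of a relation in context, rescaling
  multiplies that sandwich by the value. The projection to a theta degree and the rescaling by
  leading coefficients are both of this kind.\<close>

lemma mw_J:
  assumes HH: "\<And>a b i j. c (a @ [GH i, GH j] @ b) = c (a @ [GH j, GH i] @ b)"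
    and HT: "\<And>a b i j. c (a @ [GH i, GTheta j] @ b) = c (a @ [GTheta j, GH i] @ b)"
    and HI: "\<And>a b i. c (a @ [GH i, GHinv i] @ b) = c (a @ b)" "\<And>a b i. c (a @ [GHinv i, GH i] @ b) = c (a @ b)"
    and S: "\<And>a b i j m r. r \<le> m \<Longrightarrow> c (a @ (replicate r (GTheta i) @ [GTheta j] @ replicate (m - r) (GTheta i)) @ b)
        = c (a @ (replicate m (GTheta i) @ [GTheta j]) @ b)"
    and x: "x \<in> J"
  shows "mw c x \<in> J"
  unfolding mw_def
proof (rule lin_idl[OF vs_scale lsub_idl _ x])
  fix r a b assume r: "r \<in> borel_rels"
  have "\<exists>k. lin scale (\<lambda>w. scale (c (a @ w @ b)) (mon (a @ w @ b))) r = scale k (mon a * r * mon b)"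
  proof -
    consider "r \<in> torus_rels" | i j where "r = sr i j" using r by (auto simp: borel_rels_def serre_rels_def)
    then show ?thesis
    proof cases
      case 1
      then show ?thesis
      proof (cases r rule: torus_cases)
        case (HH i j)
        show ?thesis using assms(1)[of a i j b] unfolding HH
          by (intro exI[of _ "c (a @ [GH i, GH j] @ b)"])
             (simp add: mono_mult scale_mult left_diff_distrib right_diff_distrib sc.scale_right_diff_distrib del: scale_single)
      next
        case (HT i j)
        show ?thesis using assms(2)[of a i j b] unfolding HT
          by (intro exI[of _ "c (a @ [GH i, GTheta j] @ b)"])
             (simp add: mono_mult scale_mult left_diff_distrib right_diff_distrib sc.scale_right_diff_distrib mult.commute del: scale_single)
      next
        case (HI i)
        show ?thesis using assms(3)[of a i b] unfolding HI
          by (intro exI[of _ "c (a @ b)"])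
             (simp add: mono_mult scale_mult left_diff_distrib right_diff_distrib sc.scale_right_diff_distrib lin_mono_one del: scale_single)
      next
        case (IH i)
        show ?thesis using assms(4)[of a i b] unfolding IH
          by (intro exI[of _ "c (a @ b)"])
             (simp add: mono_mult scale_mult left_diff_distrib right_diff_distrib sc.scale_right_diff_distrib lin_mono_one del: scale_single)
      qed
    next
      case 2
      let ?m = "nat (1 - C i j)" and ?w = "\<lambda>r. replicate r (GTheta i) @ [GTheta j] @ replicate (nat (1 - C i j) - r) (GTheta i)"
      let ?k = "c (a @ (replicate ?m (GTheta i) @ [GTheta j]) @ b)"
      have "lin scale (\<lambda>w. scale (c (a @ w @ b)) (mon (a @ w @ b))) r
          = (\<Sum>r\<in>{0..?m}. scale ((- 1) ^ r * qbinomial (vi d i) ?m r) (scale (c (a @ ?w r @ b)) (mon (a @ ?w r @ b))))"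
        unfolding 2 sr_def srr_def by (simp del: scale_single append.assoc append_Cons)
      also have "\<dots> = (\<Sum>r\<in>{0..?m}. scale ((- 1) ^ r * qbinomial (vi d i) ?m r) (scale ?k (mon (a @ ?w r @ b))))"
        by (intro sum.cong refl) (simp only: S atLeastAtMost_iff)
      also have "\<dots> = scale ?k (mon a * r * mon b)"
        unfolding 2 sr_def srr_def
        by (simp add: sum_distrib_left sum_distrib_right scale_mult mono_mult sc.scale_sum_right mult.commute del: scale_single)
      finally show ?thesis ..
    qed
  qed
  moreover have "mon a * r * mon b \<in> J" by (rule idl_mult_right[OF idl_mult_left[OF idl_incl[OF r]]])
  ultimately show "lin scale (\<lambda>w. scale (c (a + w + b)) (mon (a + w + b))) r \<in> J"
    by (auto simp: plus_list_def idl_scale)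
qed

abbreviation "pr n \<equiv> mw (\<lambda>w. if ntheta w = n then 1 else 0)"

lemma ntheta_replicate [simp]: "ntheta (replicate r (GTheta i)) = r"
  by (induction r) simp_all

lemma tpart_replicate [simp]: "tpart (replicate r (GTheta i)) = []"
  by (induction r) simp_all

lemma pr_J: "x \<in> J \<Longrightarrow> pr n x \<in> J"
  by (rule mw_J) simp_all

text \<open>The coefficient depends only on the torus part of a word, and \<open>gg\<close> kills
  \<open>J\<close>; hence it is constant on each relation in context, and so is its inverse.
  Rescaling by the inverse preserves \<open>J\<close> and undoes the rescaling.\<close>

lemma unscale_J:
  assumes "mw (\<lambda>w. gg (tpart w)) x \<in> J" shows "x \<in> J"
proof -
  have R: "mon [GH i, GH j] - mon [GH j, GH i] \<in> J" "mon [GH i, GHinv i] - 1 \<in> J" "mon [GHinv i, GH i] - 1 \<in> J" for i j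
    by (rule idl_incl; force simp: borel_rels_def torus_rels_def)+
  have "mw (\<lambda>w. inverse (gg (tpart w))) (mw (\<lambda>w. gg (tpart w)) x) \<in> J"
    by (rule mw_J[OF _ _ _ _ _ assms])
       (use gg_invariant[OF R(1)] gg_invariant[OF R(2)] gg_invariant[OF R(3)] in \<open>simp_all add: lin_mono_one\<close>)
  moreover have "mw (\<lambda>w. inverse (gg (tpart w))) (mw (\<lambda>w. gg (tpart w)) x) = x"
    by (rule poly_mapping_eqI) (simp add: lookup_mw gg_tfree tfree_tpart)
  ultimately show ?thesis by simp
qed

lemma GG_linear: "GG (x + y) = GG x + GG y" "GG (x - y) = GG x - GG y" "GG (scale c x) = scale c (GG x)" "GG 0 = 0"
  "GG (mon w) = sw w (\<lambda>u q. scale (gg q) (mon u))"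
  by (simp_all add: GG_def)

lemma pr_GG: "ntheta w \<le> n \<Longrightarrow> pr n (GG (mon w)) = (if ntheta w = n then scale (gg (tpart w)) (mon w) else 0)"
proof -
  assume w: "ntheta w \<le> n"
  let ?N = "{x :: 'i word vec. pr n x = 0}"
  have N: "lsub scale ?N" by (auto simp: lsub_def mw_linear)
  have "GG (mon w) - scale (gg (tpart w)) (mon w) \<in> ?N"
    unfolding GG_linear by (rule sw_leading[OF N]) (use w in \<open>simp add: mw_linear del: scale_single\<close>)
  then show ?thesis by (auto simp: mw_linear simp del: scale_single)
qed

text \<open>Induction on a strict bound for the theta degree. The top component of
  \<open>GG x\<close> is the rescaled top component of \<open>x\<close>. As \<open>J\<close> is
  homogeneous, that component lies in \<open>J\<close>, its image under \<open>GG\<close> does too,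
  and the rest has smaller degree.\<close>

lemma GG_inj: "keys x \<subseteq> {w. ntheta w < n} \<Longrightarrow> GG x \<in> J \<Longrightarrow> x \<in> J"
proof (induction n arbitrary: x)
  case 0 then have "x = 0" by (simp add: poly_mapping_eq_iff in_keys_iff subset_iff fun_eq_iff)
  then show ?case by (simp add: idl_0)
next
  case (Suc n)
  let ?y = "pr n x"
  let ?z = "x - pr n x"
  have kz: "keys ?z \<subseteq> {w. ntheta w < n}"
    using Suc.prems(1) by (auto simp: in_keys_iff lookup_minus lookup_mw less_Suc_eq split: if_splits)
  have ky: "keys ?y \<subseteq> {w. ntheta w = n}"
    by (auto simp: in_keys_iff lookup_mw split: if_splits)
  have "pr n (GG z) = 0" if "keys z \<subseteq> {w. ntheta w < n}" for z
    using that by (induction z rule: vec_induct_keys) (auto simp: GG_linear(1-4) mw_linear(1-4) pr_GG simp del: scale_single)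
  from this[OF kz] have "pr n (GG ?z) = 0" .
  moreover have "pr n (GG y) = mw (\<lambda>w. gg (tpart w)) y" if "keys y \<subseteq> {w. ntheta w = n}" for y
    using that by (induction y rule: vec_induct_keys) (auto simp: GG_linear(1-4) mw_linear pr_GG simp del: scale_single)
  from this[OF ky] have "pr n (GG ?y) = mw (\<lambda>w. gg (tpart w)) ?y" .
  moreover have "GG x = GG ?y + GG ?z" by (simp flip: GG_linear(1))
  ultimately have "pr n (GG x) = mw (\<lambda>w. gg (tpart w)) ?y" by (simp add: mw_linear)
  with pr_J[OF Suc.prems(2), of n] have "mw (\<lambda>w. gg (tpart w)) ?y \<in> J" by (simp only:)
  then have y: "?y \<in> J" by (rule unscale_J)
  then have "GG ?z \<in> J" using idl_diff[OF Suc.prems(2) GG_J[OF y]] by (simp add: GG_linear)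
  then have "?z \<in> J" by (rule Suc.IH[OF kz])
  from idl_add[OF y this] show ?case by simp
qed

theorem Phi_inj: assumes "Phi x \<in> JU" shows "x \<in> J"
proof (rule GG_inj)
  show "GG x \<in> J" unfolding GG_eval by (rule act_JU[OF good_xi0 assms])
  show "keys x \<subseteq> {w. ntheta w < Suc (Max (ntheta ` keys x))}"
    by (auto simp: less_Suc_eq_le intro: Max_ge)
qed

end

section \<open>Monoid algebras, quotients and presentations as records\<close>

lemma monoid_alg_simps [simp]:
  "carrier (monoid_alg M) = {p. keys p \<subseteq> carrier M}" "\<one>\<^bsub>monoid_alg M\<^esub> = mon \<one>\<^bsub>M\<^esub>"
  "\<zero>\<^bsub>monoid_alg M\<^esub> = 0" "x \<oplus>\<^bsub>monoid_alg M\<^esub> y = x + y" "c \<odot>\<^bsub>monoid_alg M\<^esub> x = scale c x"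
  by (simp_all add: monoid_alg_def)

lemma monoid_alg_mult:
  "p \<otimes>\<^bsub>monoid_alg M\<^esub> q = lin scale (\<lambda>x. lin scale (\<lambda>y. mon (x \<otimes>\<^bsub>M\<^esub> y)) q) p"
  by (simp add: monoid_alg_def lin_def sc.scale_sum_right)

lemma monoid_alg_mult_linear:
  "(p + p') \<otimes>\<^bsub>monoid_alg M\<^esub> q = p \<otimes>\<^bsub>monoid_alg M\<^esub> q + p' \<otimes>\<^bsub>monoid_alg M\<^esub> q"
  "q \<otimes>\<^bsub>monoid_alg M\<^esub> (p + p') = q \<otimes>\<^bsub>monoid_alg M\<^esub> p + q \<otimes>\<^bsub>monoid_alg M\<^esub> p'"
  "scale c p \<otimes>\<^bsub>monoid_alg M\<^esub> q = scale c (p \<otimes>\<^bsub>monoid_alg M\<^esub> q)"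
  "p \<otimes>\<^bsub>monoid_alg M\<^esub> scale c q = scale c (p \<otimes>\<^bsub>monoid_alg M\<^esub> q)"
  "0 \<otimes>\<^bsub>monoid_alg M\<^esub> q = 0" "p \<otimes>\<^bsub>monoid_alg M\<^esub> 0 = 0"
  "mon x \<otimes>\<^bsub>monoid_alg M\<^esub> mon y = mon (x \<otimes>\<^bsub>M\<^esub> y)"
  by (simp_all add: monoid_alg_mult lin_fun_add lmap_lin[OF lmap_scale])

lemma lsub_keys: "lsub scale {p. keys p \<subseteq> S}"
proof -
  have "keys (scale c x) \<subseteq> S" if "keys x \<subseteq> S" for c and x :: "'a vec"
    using that by (auto simp: in_keys_iff)
  moreover have "keys (x + y) \<subseteq> S" if "keys x \<subseteq> S" "keys y \<subseteq> S" for x y :: "'a vec"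
    using keys_add_sub[of x y] that by blast
  ultimately show ?thesis by (simp add: lsub_def)
qed

lemma monoid_alg_closed:
  assumes "monoid M" "keys p \<subseteq> carrier M" "keys q \<subseteq> carrier M"
  shows "keys (p \<otimes>\<^bsub>monoid_alg M\<^esub> q) \<subseteq> carrier M"
proof -
  have "p \<otimes>\<^bsub>monoid_alg M\<^esub> q \<in> {p. keys p \<subseteq> carrier M}"
    unfolding monoid_alg_mult
    using assms by (intro lsub_lin[OF lsub_keys]) (auto simp: monoid.m_closed subset_iff)
  then show ?thesis by simp
qed

lemma monoid_alg_assoc:
  assumes "monoid M" "keys x \<subseteq> carrier M" "keys y \<subseteq> carrier M" "keys z \<subseteq> carrier M"
  shows "(x \<otimes>\<^bsub>monoid_alg M\<^esub> y) \<otimes>\<^bsub>monoid_alg M\<^esub> z = x \<otimes>\<^bsub>monoid_alg M\<^esub> (y \<otimes>\<^bsub>monoid_alg M\<^esub> z)"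
proof -
  have 1: "(mon a \<otimes>\<^bsub>monoid_alg M\<^esub> mon b) \<otimes>\<^bsub>monoid_alg M\<^esub> z = mon a \<otimes>\<^bsub>monoid_alg M\<^esub> (mon b \<otimes>\<^bsub>monoid_alg M\<^esub> z)"
    if "a \<in> carrier M" "b \<in> carrier M" for a b
    using assms(4) by (induction z rule: vec_induct_keys)
      (use that assms(1) in \<open>simp_all add: monoid_alg_mult_linear monoid.m_assoc del: scale_single\<close>)
  have 2: "(mon a \<otimes>\<^bsub>monoid_alg M\<^esub> y) \<otimes>\<^bsub>monoid_alg M\<^esub> z = mon a \<otimes>\<^bsub>monoid_alg M\<^esub> (y \<otimes>\<^bsub>monoid_alg M\<^esub> z)"
    if "a \<in> carrier M" for a
    using assms(3) by (induction y rule: vec_induct_keys)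
      (use that in \<open>simp_all add: monoid_alg_mult_linear 1[unfolded monoid_alg_mult_linear] del: scale_single\<close>)
  show ?thesis
    using assms(2) by (induction x rule: vec_induct_keys)
      (simp_all add: monoid_alg_mult_linear 2 del: scale_single)
qed

lemma ring_monoid_alg:
  assumes "monoid M" shows "ring (monoid_alg M)"
proof (rule ringI)
  show "abelian_group (monoid_alg M)"
  proof (rule abelian_groupI)
    fix x assume x: "x \<in> carrier (monoid_alg M)"
    show "\<exists>y\<in>carrier (monoid_alg M). y \<oplus>\<^bsub>monoid_alg M\<^esub> x = \<zero>\<^bsub>monoid_alg M\<^esub>"
      using x by (intro bexI[of _ "- x"]) auto
  qed (use lsub_keys[of "carrier M"] in \<open>auto simp: lsub_def add_ac\<close>)
  show "monoid (monoid_alg M)"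
  proof (rule monoidI)
    fix x assume "x \<in> carrier (monoid_alg M)"
    then have x: "keys x \<subseteq> carrier M" by simp
    show "\<one>\<^bsub>monoid_alg M\<^esub> \<otimes>\<^bsub>monoid_alg M\<^esub> x = x"
      using x by (induction x rule: vec_induct_keys) (simp_all add: monoid_alg_mult_linear monoid.l_one[OF assms] del: scale_single)
    show "x \<otimes>\<^bsub>monoid_alg M\<^esub> \<one>\<^bsub>monoid_alg M\<^esub> = x"
      using x by (induction x rule: vec_induct_keys) (simp_all add: monoid_alg_mult_linear monoid.r_one[OF assms] del: scale_single)
  qed (use monoid_alg_closed[OF assms] monoid_alg_assoc[OF assms] monoid.one_closed[OF assms] in auto)
qed (simp_all add: monoid_alg_mult_linear)

text \<open>Serves all quotients of the development: algebras presented on all letters,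
  \<open>U_hat\<close> on its own letters, and tensor squares, which are quotients of the monoid
  algebra of a product.\<close>

lemma quot_monoid_alg:
  assumes "monoid M" and I: "I \<subseteq> carrier (monoid_alg M)" "lsub scale I"
    and "\<forall>a\<in>I. \<forall>x\<in>carrier (monoid_alg M). x \<otimes>\<^bsub>monoid_alg M\<^esub> a \<in> I \<and> a \<otimes>\<^bsub>monoid_alg M\<^esub> x \<in> I"
  defines "A \<equiv> monoid_alg M" and "Q \<equiv> quot_alg (monoid_alg M) I" and "cl \<equiv> (+>\<^bsub>monoid_alg M\<^esub>) I"
  shows "ideal I A" "ring Q" "carrier Q = cl ` carrier A" "\<one>\<^bsub>Q\<^esub> = cl \<one>\<^bsub>A\<^esub>" "\<zero>\<^bsub>Q\<^esub> = cl 0"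
    "x \<in> carrier A \<Longrightarrow> y \<in> carrier A \<Longrightarrow> cl x \<otimes>\<^bsub>Q\<^esub> cl y = cl (x \<otimes>\<^bsub>A\<^esub> y)"
    "x \<in> carrier A \<Longrightarrow> y \<in> carrier A \<Longrightarrow> cl x \<oplus>\<^bsub>Q\<^esub> cl y = cl (x + y)"
    "c \<odot>\<^bsub>Q\<^esub> cl x = cl (scale c x)" "cl x = cl y \<longleftrightarrow> x - y \<in> I" "t \<in> cl x \<longleftrightarrow> t - x \<in> I"
proof -
  interpret A: ring A unfolding A_def by (rule ring_monoid_alg[OF assms(1)])
  have sub: "subgroup I (add_monoid A)"
  proof
    show "I \<subseteq> carrier (add_monoid A)" using I by (simp add: A_def)
    fix x assume x: "x \<in> I"
    then have "x \<in> carrier A" using I by (auto simp: A_def)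
    moreover have "- x \<in> I" by (rule lsub_uminus[OF vs_scale I(2) x])
    moreover have "- x \<in> carrier A" using subsetD[OF I(1) \<open>- x \<in> I\<close>] by (simp only: A_def)
    ultimately have "\<ominus>\<^bsub>A\<^esub> x = - x" by (intro A.minus_equality) (simp_all add: A_def)
    with \<open>- x \<in> I\<close> show "inv\<^bsub>add_monoid A\<^esub> x \<in> I" by (simp add: a_inv_def)
  qed (use I(2) in \<open>auto simp: lsub_def A_def\<close>)
  show id: "ideal I A"
    by (rule idealI[OF A.ring_axioms sub]) (use assms(4) in \<open>auto simp: A_def\<close>)
  interpret ideal I A by fact
  have cl: "cl x = (\<lambda>i. i + x) ` I" for x
    unfolding cl_def a_r_coset_def' by (auto simp: A_def)
  show mem: "t \<in> cl x \<longleftrightarrow> t - x \<in> I" for t x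
    unfolding cl by (auto simp: image_iff intro: bexI[of _ "t - x"])
  show eq: "cl x = cl y \<longleftrightarrow> x - y \<in> I" for x y
  proof
    assume "cl x = cl y"
    then have "x \<in> cl y" using mem[of x x] I(2) by (auto simp: lsub_def)
    then show "x - y \<in> I" by (simp add: mem)
  next
    assume xy: "x - y \<in> I"
    have "t - x \<in> I \<longleftrightarrow> t - y \<in> I" for t
      using lsub_add[OF I(2) _ xy, of "t - x"] lsub_diff[OF vs_scale I(2) _ xy, of "t - y"] by auto
    then show "cl x = cl y" by (auto simp: mem)
  qed
  have f: "carrier Q = carrier (A Quot I)" "mult Q = mult (A Quot I)" "one Q = one (A Quot I)"
    "zero Q = zero (A Quot I)" "add Q = add (A Quot I)" "smult Q = (\<lambda>c X. \<Union>x\<in>X. cl (scale c x))"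
    by (simp_all add: Q_def quot_alg_def ring.defs module.defs A_def cl_def)
  show "ring Q"
  proof -
    interpret R: ring "A Quot I" by (rule quotient_is_ring)
    show ?thesis
    proof (rule ringI)
      show "abelian_group Q"
        by (rule abelian_groupI) (use R.a_assoc R.a_comm R.l_neg in \<open>auto simp: f intro: bexI[of _ "\<ominus>\<^bsub>A Quot I\<^esub> _"]\<close>)
      show "monoid Q" by (rule monoidI) (auto simp: f R.m_assoc)
    qed (auto simp: f R.l_distr R.r_distr)
  qed
  show "carrier Q = cl ` carrier A"
    by (auto simp: f FactRing_def A_RCOSETS_def' cl_def A_def)
  show "\<one>\<^bsub>Q\<^esub> = cl \<one>\<^bsub>A\<^esub>" by (simp add: f FactRing_def cl_def A_def)
  show "\<zero>\<^bsub>Q\<^esub> = cl 0" by (simp add: f FactRing_def cl)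
  show "cl x \<otimes>\<^bsub>Q\<^esub> cl y = cl (x \<otimes>\<^bsub>A\<^esub> y)" if "x \<in> carrier A" "y \<in> carrier A" for x y
    using rcoset_mult_add[OF that] by (simp add: f FactRing_def cl_def A_def)
  show "cl x \<oplus>\<^bsub>Q\<^esub> cl y = cl (x + y)" if "x \<in> carrier A" "y \<in> carrier A" for x y
    using a_rcos_sum[OF that] by (simp add: f FactRing_def cl_def A_def)
  show "c \<odot>\<^bsub>Q\<^esub> cl x = cl (scale c x)" for c x
  proof -
    \<comment> \<open>All representatives give the same coset, so the union in the definition of
      scalar multiplication collapses.\<close>
    have 1: "cl (scale c t) = cl (scale c x)" if "t \<in> cl x" for t
      using that lsub_scale[OF I(2), of "t - x" c] by (simp add: eq mem sc.scale_right_diff_distrib)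
    have 2: "x \<in> cl x" using I(2) by (simp add: mem lsub_def)
    have "(\<Union>t\<in>cl x. cl (scale c t)) = (\<Union>t\<in>cl x. cl (scale c x))"
      by (rule SUP_cong[OF refl 1])
    then show ?thesis using 2 by (simp only: f) blast
  qed
qed

section \<open>Free algebras on words and presentations\<close>

abbreviation word_monoid :: "'g set \<Rightarrow> 'g list monoid" where
  "word_monoid G \<equiv> \<lparr>carrier = lists G, mult = (@), one = []\<rparr>"

lemma monoid_words: "monoid (word_monoid G)"
  by (rule monoidI) auto

lemma free_alg_simps [simp]:
  "carrier (free_alg G) = {p. keys p \<subseteq> lists G}" "\<one>\<^bsub>free_alg G\<^esub> = 1"
  "\<zero>\<^bsub>free_alg G\<^esub> = 0" "x \<oplus>\<^bsub>free_alg G\<^esub> y = x + y" "c \<odot>\<^bsub>free_alg G\<^esub> x = scale c x"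
  "x \<otimes>\<^bsub>free_alg G\<^esub> y = x * y"
  by (simp_all add: free_alg_def mono_Nil monoid_alg_mult lin_mult_expand[of x] plus_list_def)

lemma ring_free_alg: "ring (free_alg G)"
  unfolding free_alg_def by (rule ring_monoid_alg[OF monoid_words])

lemma keys_mult_words: "keys x \<subseteq> lists G \<Longrightarrow> keys y \<subseteq> lists G \<Longrightarrow> keys (x * y) \<subseteq> lists G"
  using monoid_alg_closed[OF monoid_words[of G], of x y] by (simp flip: free_alg_def)

lemma free_alg_minus: "keys x \<subseteq> lists G \<Longrightarrow> keys y \<subseteq> lists G \<Longrightarrow> x \<ominus>\<^bsub>free_alg G\<^esub> y = x - y"
proof -
  interpret ring "free_alg G" by (rule ring_free_alg)
  assume "keys x \<subseteq> lists G" "keys y \<subseteq> lists G"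
  then have "\<ominus>\<^bsub>free_alg G\<^esub> y = - y" by (intro minus_equality) auto
  then show ?thesis by (simp add: a_minus_def)
qed

lemma free_alg_pow: "x [^]\<^bsub>free_alg G\<^esub> (n::nat) = x ^ n"
proof -
  interpret ring "free_alg G" by (rule ring_free_alg)
  show ?thesis by (induction n) (simp_all add: power_commutes)
qed

lemma free_alg_finsum: "finite S \<Longrightarrow> (\<And>a. a \<in> S \<Longrightarrow> keys (f a) \<subseteq> lists G) \<Longrightarrow> finsum (free_alg G) f S = sum f S"
proof (induction S rule: finite_induct)
  interpret ring "free_alg G" by (rule ring_free_alg)
  case empty show ?case by simp
next
  interpret ring "free_alg G" by (rule ring_free_alg)
  case (insert a S)
  then show ?case by (subst finsum_insert) auto
qed

lemma gen_mon: "gen g = mon [g]"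
  by (simp add: gen_def)

lemma serre_free_alg:
  assumes "a \<in> G" "b \<in> G"
  shows "serre (free_alg G) q m (gen a) (gen b) = srr q m a b"
proof -
  have p: "mon [a] ^ n = mon (replicate n a)" for n
    by (induction n) (simp_all add: mono_Nil[symmetric] mono_mult)
  show ?thesis
    unfolding serre_def srr_def using assms
    by (subst free_alg_finsum) (auto simp: free_alg_pow gen_mon p mono_mult in_keys_iff lookup_single when_def split: if_splits)
qed

lemma idl_ideal: "ideal (idl R) (free_alg UNIV)"
proof -
  have "ideal (idl R) (monoid_alg (word_monoid UNIV))"
  proof (rule quot_monoid_alg(1)[OF monoid_words])
    show "\<forall>a\<in>idl R. \<forall>x\<in>carrier (monoid_alg (word_monoid UNIV)).
        x \<otimes>\<^bsub>monoid_alg (word_monoid UNIV)\<^esub> a \<in> idl R \<and> a \<otimes>\<^bsub>monoid_alg (word_monoid UNIV)\<^esub> x \<in> idl R"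
      by (simp only: free_alg_def[symmetric] free_alg_simps) (blast intro: idl_mult_left idl_mult_right)
  qed auto
  then show ?thesis by (simp add: free_alg_def)
qed

lemma genideal_idl: "genideal (free_alg UNIV) R = idl R"
proof
  have "R \<subseteq> idl R" by (auto intro: idl_incl)
  then show "genideal (free_alg UNIV) R \<subseteq> idl R"
    unfolding genideal_def using idl_ideal[of R] by blast
  show "idl R \<subseteq> genideal (free_alg UNIV) R"
  proof
    fix x assume x: "x \<in> idl R"
    have "x \<in> I" if I: "ideal I (free_alg UNIV)" "R \<subseteq> I" for I
    proof -
      interpret ideal I "free_alg UNIV" by fact
      show ?thesis using x
      proof (induction rule: idl.induct)
        case idl_0 show ?case using zero_closed[of] additive_subgroup.zero_closed[OF additive_subgroup_axioms] by simp
      next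
        case (idl_add x y) then show ?case using additive_subgroup.a_closed[OF additive_subgroup_axioms] by simp
      next
        case (idl_gen r c a b)
        then have "r \<in> I" using I by auto
        then have "(scale c (mon a) \<otimes>\<^bsub>free_alg UNIV\<^esub> r) \<otimes>\<^bsub>free_alg UNIV\<^esub> mon b \<in> I"
          by (intro I_r_closed I_l_closed) auto
        then show ?case by (simp add: scale_mult del: scale_single)
      qed
    qed
    then show "x \<in> genideal (free_alg UNIV) R" by (auto simp: genideal_def)
  qed
qed

text \<open>\<open>idl R'\<close> lives in the free algebra on all letters; cut down to words over
  \<open>G\<close> it is an ideal there. This makes the map from \<open>U_hat\<close> to
  \<open>U_tilde\<close> well defined.\<close>

lemma genideal_subset_idl:
  assumes "R \<subseteq> idl R'" "R \<subseteq> carrier (free_alg G)"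
  shows "genideal (free_alg G) R \<subseteq> idl R'"
proof -
  have "ideal (idl R' \<inter> carrier (free_alg G)) (monoid_alg (word_monoid G))"
  proof (rule quot_monoid_alg(1)[OF monoid_words])
    show "lsub scale (idl R' \<inter> carrier (free_alg G))"
      using lsub_keys[of "lists G"] lsub_idl[of R'] by (auto simp: lsub_def)
    show "\<forall>a\<in>idl R' \<inter> carrier (free_alg G). \<forall>x\<in>carrier (monoid_alg (word_monoid G)).
        x \<otimes>\<^bsub>monoid_alg (word_monoid G)\<^esub> a \<in> idl R' \<inter> carrier (free_alg G) \<and>
        a \<otimes>\<^bsub>monoid_alg (word_monoid G)\<^esub> x \<in> idl R' \<inter> carrier (free_alg G)"
      using keys_mult_words[of _ G]
      by (simp add: idl_mult_left idl_mult_right flip: free_alg_def)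
  qed (auto simp: free_alg_def)
  then have "ideal (idl R' \<inter> carrier (free_alg G)) (free_alg G)" by (simp only: free_alg_def)
  then show ?thesis unfolding genideal_def using assms by blast
qed

text \<open>The common interface to the Borel algebra and to the double with invertible torus,
  through which statements about words become statements about the presented algebras.\<close>

locale word_quotient =
  fixes Q :: "'q alg" and N :: "'g list vec set" and cl :: "'g list vec \<Rightarrow> 'q"
  assumes carrier: "carrier Q = range cl"
    and mult: "cl x \<otimes>\<^bsub>Q\<^esub> cl y = cl (x * y)" and add: "cl x \<oplus>\<^bsub>Q\<^esub> cl y = cl (x + y)"
    and smult: "c \<odot>\<^bsub>Q\<^esub> cl x = cl (scale c x)" and one: "\<one>\<^bsub>Q\<^esub> = cl 1" and zero: "\<zero>\<^bsub>Q\<^esub> = cl 0"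
    and eq: "cl x = cl y \<longleftrightarrow> x - y \<in> N"
begin

lemma cl_closed [simp, intro]: "cl x \<in> carrier Q"
  by (simp add: carrier)

lemma cl_cases: "X \<in> carrier Q \<Longrightarrow> (\<And>x. X = cl x \<Longrightarrow> P) \<Longrightarrow> P"
  by (auto simp: carrier)

lemma ring: "ring Q"
proof (rule ringI)
  show "abelian_group Q"
  proof (rule abelian_groupI)
    fix X assume "X \<in> carrier Q"
    then obtain x where "X = cl x" by (rule cl_cases)
    then show "\<exists>Y\<in>carrier Q. Y \<oplus>\<^bsub>Q\<^esub> X = \<zero>\<^bsub>Q\<^esub>"
      by (intro bexI[of _ "cl (- x)"]) (simp_all add: add zero)
  qed (auto elim!: cl_cases simp: add zero add_ac)
  show "monoid Q" by (rule monoidI) (auto elim!: cl_cases simp: mult one mult.assoc)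
qed (auto elim!: cl_cases simp: add mult distrib_left distrib_right)

sublocale ring Q by (rule ring)

definition rep :: "'q \<Rightarrow> 'g list vec" where
  "rep X = (SOME x. cl x = X)"

lemma cl_rep: "X \<in> carrier Q \<Longrightarrow> cl (rep X) = X"
  unfolding rep_def by (rule someI_ex) (auto elim: cl_cases)

lemma rep_cl: "rep (cl x) - x \<in> N"
  using cl_rep[of "cl x"] by (simp add: eq)

lemma hom_unique:
  assumes f: "f \<in> alg_hom Q T" "f' \<in> alg_hom Q T" and "\<And>l. f (cl (mon [l])) = f' (cl (mon [l]))"
  shows "f (cl x) = f' (cl x)"
proof -
  have h: "f (cl (x + y)) = f (cl x) \<oplus>\<^bsub>T\<^esub> f (cl y)" "f (cl (x * y)) = f (cl x) \<otimes>\<^bsub>T\<^esub> f (cl y)"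
    "f (cl (scale c x)) = c \<odot>\<^bsub>T\<^esub> f (cl x)" "f (cl 1) = \<one>\<^bsub>T\<^esub>" if "f \<in> alg_hom Q T" for f x y c
    using that by (auto simp: alg_hom_def ring_hom_def simp flip: add mult smult one)
  have w: "f (cl (mon w)) = f' (cl (mon w))" for w
  proof (induction w)
    case (Cons l w)
    have "f (cl (mon [l] * mon w)) = f' (cl (mon [l] * mon w))"
      unfolding h(2)[OF f(1)] h(2)[OF f(2)] using Cons assms(3) by simp
    then show ?case by (simp add: mono_mult)
  qed (simp add: mono_Nil h(4)[OF f(1)] h(4)[OF f(2)])
  show ?thesis
  proof (induction x rule: vec_induct)
    case zero show ?case using h(3)[OF f(1), of 0 1] h(3)[OF f(2), of 0 1] h(4)[OF f(1)] h(4)[OF f(2)] by simp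
  qed (simp_all add: h(1,3)[OF f(1)] h(1,3)[OF f(2)] w del: scale_single)
qed

lemma lift_hom:
  assumes "\<And>x y. h (x + y) = h x \<oplus>\<^bsub>T\<^esub> h y" "\<And>x y. h (x * y) = h x \<otimes>\<^bsub>T\<^esub> h y" "\<And>c x. h (scale c x) = c \<odot>\<^bsub>T\<^esub> h x"
    "h 1 = \<one>\<^bsub>T\<^esub>" "\<And>x. h x \<in> carrier T" "\<And>x y. x - y \<in> N \<Longrightarrow> h x = h y"
  shows "(\<lambda>X. h (rep X)) \<in> alg_hom Q T" "h (rep (cl x)) = h x"
proof -
  show 1: "h (rep (cl x)) = h x" for x by (rule assms(6)[OF rep_cl])
  show "(\<lambda>X. h (rep X)) \<in> alg_hom Q T"
    unfolding alg_hom_def ring_hom_def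
    by (auto simp: assms(5) elim!: cl_cases) (simp_all add: 1 mult add smult one assms(1-4))
qed

end

lemma idl_mult: "\<forall>a\<in>idl R. \<forall>x. x * a \<in> idl R \<and> a * x \<in> idl R"
  by (simp add: idl_mult_left idl_mult_right)

lemmas quot_free_alg = quot_monoid_alg[OF monoid_words[of UNIV], of "idl R" for R, folded free_alg_def, simplified, OF idl_mult]

lemma presented_word_quotient:
  "word_quotient (presented_alg UNIV R) (idl R) ((+>\<^bsub>free_alg UNIV\<^esub>) (idl R))"
  unfolding presented_alg_def genideal_idl
  by unfold_locales (simp_all add: quot_free_alg)

lemma presented_gen_cl: "presented_gen UNIV R g = idl R +>\<^bsub>free_alg UNIV\<^esub> mon [g]"
  by (simp add: presented_gen_def genideal_idl gen_mon)

section \<open>Tensor squares and Sweedler sums\<close>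

lemma lin_fun_diff: "vector_space s \<Longrightarrow> lin s (\<lambda>k. F k - G k) x = lin s F x - lin s G x"
  using lin_fun_add[of s "\<lambda>k. F k - G k" G x] by simp

context word_quotient
begin

abbreviation "MM \<equiv> monoid_alg (Q \<times>\<times> Q)"
abbreviation "BI \<equiv> bilinear_ideal Q Q"

definition tcl :: "('q \<times> 'q) vec \<Rightarrow> ('q \<times> 'q) vec set" where
  "tcl = (+>\<^bsub>MM\<^esub>) BI"

definition pairs :: "('g list \<times> 'g list) vec \<Rightarrow> ('q \<times> 'q) vec" where
  "pairs = lin scale (\<lambda>(u, v). mon (cl (mon u), cl (mon v)))"

lemma monoid_Q: "monoid Q" by (rule monoid_axioms)

lemma monoid_QQ: "monoid (Q \<times>\<times> Q)"
  by (rule DirProd_monoid[OF monoid_Q monoid_Q])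

lemma lsub_BI: "lsub scale BI"
  unfolding bilinear_ideal_def lsub_def by (auto intro: sc.span_zero sc.span_add sc.span_scale)

lemma BI_rels: "r \<in> bilinear_rels Q Q \<Longrightarrow> r \<in> BI"
  unfolding bilinear_ideal_def by (rule sc.span_base)

lemma BI_induct:
  assumes "lsub scale P" "\<And>r. r \<in> bilinear_rels Q Q \<Longrightarrow> r \<in> P" "x \<in> BI"
  shows "x \<in> P"
proof -
  have "sc.subspace P" using assms(1) by (auto simp: sc.subspace_def lsub_def)
  then show ?thesis using sc.span_minimal[of "bilinear_rels Q Q" P] assms unfolding bilinear_ideal_def by blast
qed

lemma bilinear_cases:
  assumes "r \<in> bilinear_rels Q Q"
  obtains x x' y where "r = mon (cl (x + x'), cl y) - mon (cl x, cl y) - mon (cl x', cl y)"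
  | x y y' where "r = mon (cl x, cl (y + y')) - mon (cl x, cl y) - mon (cl x, cl y')"
  | c x y where "r = mon (cl (scale c x), cl y) - scale c (mon (cl x, cl y))"
  | c x y where "r = mon (cl x, cl (scale c y)) - scale c (mon (cl x, cl y))"
  using assms unfolding bilinear_rels_def
  by (auto elim!: cl_cases simp: add smult)

lemma bilinear_relsI:
  "mon (cl (x + x'), cl y) - mon (cl x, cl y) - mon (cl x', cl y) \<in> bilinear_rels Q Q"
  "mon (cl x, cl (y + y')) - mon (cl x, cl y) - mon (cl x, cl y') \<in> bilinear_rels Q Q"
  "mon (cl (scale c x), cl y) - scale c (mon (cl x, cl y)) \<in> bilinear_rels Q Q"
  "mon (cl x, cl (scale c y)) - scale c (mon (cl x, cl y)) \<in> bilinear_rels Q Q"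
proof -
  have c: "cl z \<in> carrier Q" for z by simp
  show "mon (cl (x + x'), cl y) - mon (cl x, cl y) - mon (cl x', cl y) \<in> bilinear_rels Q Q"
    unfolding bilinear_rels_def add[symmetric] using c by blast
  show "mon (cl x, cl (y + y')) - mon (cl x, cl y) - mon (cl x, cl y') \<in> bilinear_rels Q Q"
    unfolding bilinear_rels_def add[symmetric] using c by blast
  show "mon (cl (scale c x), cl y) - scale c (mon (cl x, cl y)) \<in> bilinear_rels Q Q"
    unfolding bilinear_rels_def smult[symmetric] scale_single mult_1_right using c by blast
  show "mon (cl x, cl (scale c y)) - scale c (mon (cl x, cl y)) \<in> bilinear_rels Q Q"
    unfolding bilinear_rels_def smult[symmetric] scale_single mult_1_right using c by blast
qed

lemma MM_mult_mon: "mon (cl x, cl y) \<otimes>\<^bsub>MM\<^esub> mon (cl x', cl y') = mon (cl (x * x'), cl (y * y'))"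
  by (simp add: monoid_alg_mult_linear mult)

lemma monoid_alg_mult_diff:
  "(p - p') \<otimes>\<^bsub>monoid_alg M\<^esub> q = p \<otimes>\<^bsub>monoid_alg M\<^esub> q - p' \<otimes>\<^bsub>monoid_alg M\<^esub> q"
  "q \<otimes>\<^bsub>monoid_alg M\<^esub> (p - p') = q \<otimes>\<^bsub>monoid_alg M\<^esub> p - q \<otimes>\<^bsub>monoid_alg M\<^esub> p'"
  using monoid_alg_mult_linear(1)[where p = "p - p'" and p' = p'] monoid_alg_mult_linear(2)[where p = "p - p'" and p' = p']
  by (simp_all add: eq_diff_eq)

lemma BI_rel_mult:
  assumes "r \<in> bilinear_rels Q Q"
  shows "mon (cl a, cl b) \<otimes>\<^bsub>MM\<^esub> r \<in> BI" "r \<otimes>\<^bsub>MM\<^esub> mon (cl a, cl b) \<in> BI"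
proof -
  have "mon (cl a, cl b) \<otimes>\<^bsub>MM\<^esub> r \<in> bilinear_rels Q Q \<and> r \<otimes>\<^bsub>MM\<^esub> mon (cl a, cl b) \<in> bilinear_rels Q Q"
    using assms
  proof (cases r rule: bilinear_cases)
    case (1 x x' y) show ?thesis unfolding 1 monoid_alg_mult_diff MM_mult_mon distrib_left distrib_right
      by (simp only: bilinear_relsI simp_thms)
  next
    case (2 x y y') show ?thesis unfolding 2 monoid_alg_mult_diff MM_mult_mon distrib_left distrib_right
      by (simp only: bilinear_relsI simp_thms)
  next
    case (3 c x y) show ?thesis unfolding 3 monoid_alg_mult_diff monoid_alg_mult_linear(3,4) MM_mult_mon scale_mult
      by (simp only: bilinear_relsI simp_thms)
  next
    case (4 c x y) show ?thesis unfolding 4 monoid_alg_mult_diff monoid_alg_mult_linear(3,4) MM_mult_mon scale_mult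
      by (simp only: bilinear_relsI simp_thms)
  qed
  then show "mon (cl a, cl b) \<otimes>\<^bsub>MM\<^esub> r \<in> BI" "r \<otimes>\<^bsub>MM\<^esub> mon (cl a, cl b) \<in> BI" by (auto intro: BI_rels)
qed

lemma BI_carrier: "BI \<subseteq> carrier MM"
proof
  fix z assume "z \<in> BI"
  then show "z \<in> carrier MM"
  proof (rule BI_induct[rotated 2])
    show "lsub scale (carrier MM)" using lsub_keys[of "carrier (Q \<times>\<times> Q)"] by simp
    then have d: "x - y \<in> carrier MM" if "x \<in> carrier MM" "y \<in> carrier MM" for x y
      using that lsub_diff[OF vs_scale] by blast
    have m: "scale c (mon (cl x, cl y)) \<in> carrier MM" "mon (cl x, cl y) \<in> carrier MM" for c x y by (auto split: if_splits)
    fix r assume "r \<in> bilinear_rels Q Q"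
    then show "r \<in> carrier MM" by (cases r rule: bilinear_cases) (simp_all only: d m)
  qed
qed

lemma BI_mult:
  "\<forall>a\<in>BI. \<forall>x\<in>carrier MM. x \<otimes>\<^bsub>MM\<^esub> a \<in> BI \<and> a \<otimes>\<^bsub>MM\<^esub> x \<in> BI"
proof (intro ballI)
  fix a x assume assms: "a \<in> BI" "x \<in> carrier MM"
  have *: "mon (cl p, cl q) \<otimes>\<^bsub>MM\<^esub> a \<in> BI \<and> a \<otimes>\<^bsub>MM\<^esub> mon (cl p, cl q) \<in> BI" for p q
  proof -
    have "a \<in> {a. mon (cl p, cl q) \<otimes>\<^bsub>MM\<^esub> a \<in> BI \<and> a \<otimes>\<^bsub>MM\<^esub> mon (cl p, cl q) \<in> BI}"
      by (rule BI_induct[OF _ _ assms(1)])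
         (use lsub_BI in \<open>auto simp: lsub_def monoid_alg_mult_linear(1-6) BI_rel_mult\<close>)
    then show ?thesis by simp
  qed
  have "keys x \<subseteq> carrier (Q \<times>\<times> Q)" using assms(2) by simp
  then show "x \<otimes>\<^bsub>MM\<^esub> a \<in> BI \<and> a \<otimes>\<^bsub>MM\<^esub> x \<in> BI"
  proof (induction x rule: vec_induct_keys)
    case (mon k c)
    then obtain p q where "k = (cl p, cl q)" by (auto elim!: cl_cases)
    then show ?case using * lsub_BI by (simp add: monoid_alg_mult_linear(3,4) lsub_scale del: scale_single)
  qed (use lsub_BI in \<open>auto simp: lsub_def monoid_alg_mult_linear(1-6)\<close>)
qed

lemmas tensor_facts = quot_monoid_alg[OF monoid_QQ BI_carrier lsub_BI BI_mult, folded tensor_alg_def tcl_def]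

lemma pairs_linear: "pairs (x + y) = pairs x + pairs y" "pairs (scale c x) = scale c (pairs x)" "pairs 0 = 0"
  "pairs (x - y) = pairs x - pairs y" "pairs (mon (u, v)) = mon (cl (mon u), cl (mon v))"
  by (simp_all add: pairs_def)

lemma pairs_carrier [simp]: "pairs z \<in> carrier MM"
  unfolding pairs_def by (simp, rule lsub_lin[OF lsub_keys[of "carrier (Q \<times>\<times> Q)"], simplified]) auto

lemma pairs_mult: "pairs (z * z') = pairs z \<otimes>\<^bsub>MM\<^esub> pairs z'"
proof (induction z rule: vec_induct)
  case (mon k c)
  show ?case
  proof (induction z' rule: vec_induct)
    case m2: (mon k' c')
    have "mon k * mon k' = mon (fst k @ fst k', snd k @ snd k')"
      by (simp add: mult_single plus_prod_def plus_list_def)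
    moreover have "mon k = mon (fst k, snd k)" "mon k' = mon (fst k', snd k')" by simp_all
    ultimately have "pairs (mon k * mon k') = pairs (mon k) \<otimes>\<^bsub>MM\<^esub> pairs (mon k')"
      by (simp only: pairs_linear(5) MM_mult_mon mono_mult)
    then show ?case by (simp only: pairs_linear scale_mult monoid_alg_mult_linear)
  qed (simp_all only: pairs_linear distrib_left monoid_alg_mult_linear mult_zero_right)
qed (simp_all only: pairs_linear distrib_right monoid_alg_mult_linear mult_zero_left)

lemma pairs_one: "pairs 1 = \<one>\<^bsub>MM\<^esub>"
proof -
  have 1: "(1 :: ('g list \<times> 'g list) vec) = mon ([], [])"
    by (metis single_one zero_prod_def zero_list_def)
  have "pairs (mon ([], [])) = \<one>\<^bsub>MM\<^esub>"
    by (subst pairs_linear(5)) (simp add: one mono_Nil)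
  then show ?thesis unfolding 1 .
qed

text \<open>The bilinearity relations expand both arguments into words. Thus a pure tensor of
  classes is \<open>tcl (pairs z)\<close> for a tensor \<open>z\<close> of words.\<close>

lemma pairs_tens: "mon (cl x, cl y) - pairs (tens x y) \<in> BI"
proof -
  note L = lsub_add[OF lsub_BI] lsub_scale[OF lsub_BI]
  have z1: "mon (cl 0, cl y) \<in> BI" for y using BI_rels[OF bilinear_relsI(3)[of 0 0 y]] by simp
  have z2: "mon (cl x, cl 0) \<in> BI" for x using BI_rels[OF bilinear_relsI(4)[of x 0 0]] by simp
  have 1: "mon (cl (mon u), cl y) - pairs (tens (mon u) y) \<in> BI" for u
  proof (induction y rule: vec_induct)
    case zero then show ?case using z2 by (simp add: pairs_linear)
  next
    case (add y y')
    from L(1)[OF BI_rels[OF bilinear_relsI(2)[of "mon u" y y']] L(1)[OF add]] show ?case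
      by (simp add: tens_add_right pairs_linear algebra_simps)
  next
    case (mon v c)
    from BI_rels[OF bilinear_relsI(4)[of "mon u" c "mon v"]] show ?case
      by (simp only: tens_scale_right pairs_linear tens_mon)
  qed
  show ?thesis
  proof (induction x rule: vec_induct)
    case zero then show ?case using z1 by (simp add: pairs_linear)
  next
    case (add x x')
    from L(1)[OF BI_rels[OF bilinear_relsI(1)[of x x' y]] L(1)[OF add]] show ?case
      by (simp add: tens_add_left pairs_linear algebra_simps)
  next
    case (mon u c)
    from L(1)[OF BI_rels[OF bilinear_relsI(3)[of c "mon u" y]] L(2)[OF 1[of u], of c]] show ?case
      by (simp add: tens_scale_left pairs_linear sc.scale_right_diff_distrib del: scale_single)
  qed
qed

lemma tensor_elem_cl: "tensor_elem Q Q (cl x) (cl y) = tcl (pairs (tens x y))"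
  using pairs_tens[of x y] unfolding tensor_elem_def tcl_def[symmetric] by (simp add: tensor_facts(9))

lemma pairs_span2: "z \<in> span2 N \<Longrightarrow> pairs z \<in> BI"
proof (induction rule: span2.induct)
  note d = lsub_diff[OF vs_scale lsub_BI]
  case (span2_left x y)
  then have "cl x = cl 0" by (simp add: eq)
  moreover have "mon (cl 0, cl y) \<in> BI" using BI_rels[OF bilinear_relsI(3)[of 0 0 y]] by simp
  ultimately show ?case using d[OF _ pairs_tens[of x y], of "mon (cl 0, cl y)"] by simp
next
  note d = lsub_diff[OF vs_scale lsub_BI]
  case (span2_right x y)
  then have "cl x = cl 0" by (simp add: eq)
  moreover have "mon (cl y, cl 0) \<in> BI" using BI_rels[OF bilinear_relsI(4)[of y 0 0]] by simp
  ultimately show ?case using d[OF _ pairs_tens[of y x], of "mon (cl y, cl 0)"] by simp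
qed (use lsub_BI in \<open>auto simp: pairs_linear lsub_def\<close>)

text \<open>The representative picked by \<open>SOME\<close> differs from \<open>pairs z\<close> by
  bilinear relations. Since \<open>g\<close> is bilinear and computes \<open>f\<close> on classes up
  to \<open>NM\<close>, these contribute only elements of \<open>NM\<close>. It is applied with
  \<open>NM = {0}\<close> for scalars and \<open>NM = J\<close> for Borel values.\<close>

lemma sweedler_eval:
  fixes M :: "'c alg" and sv :: "qfield \<Rightarrow> 'v::ab_group_add \<Rightarrow> 'v" and NM :: "'v set" and cm :: "'v \<Rightarrow> 'c"
  assumes M: "abelian_monoid M" "\<And>x. cm x \<in> carrier M" "\<And>x y. cm x \<oplus>\<^bsub>M\<^esub> cm y = cm (x + y)"
      "\<And>c x. c \<odot>\<^bsub>M\<^esub> cm x = cm (sv c x)" "\<zero>\<^bsub>M\<^esub> = cm 0" "\<And>x y. cm x = cm y \<longleftrightarrow> x - y \<in> NM"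
    and sv: "vector_space sv" "lsub sv NM"
    and f: "\<And>x y. f (cl x) (cl y) = cm (g x y)"
    and g: "\<And>y. lmap scale sv (\<lambda>x. g x y)" "\<And>x. lmap scale sv (g x)"
  shows "sweedler M (tcl (pairs z)) f = cm (lin sv (\<lambda>(u, v). g (mon u) (mon v)) z)"
proof -
  interpret M: abelian_monoid M by fact
  define t where "t = (SOME t. t \<in> tcl (pairs z))"
  have "pairs z \<in> tcl (pairs z)" using lsub_BI by (simp add: tensor_facts(10) lsub_def)
  then have "t \<in> tcl (pairs z)" unfolding t_def by (rule someI)
  then have t: "t - pairs z \<in> BI" by (simp add: tensor_facts(10))
  have tk: "keys t \<subseteq> carrier Q \<times> carrier Q"
  proof -
    have "t - pairs z + pairs z \<in> carrier MM"
      using t BI_carrier pairs_carrier[of z] lsub_add[OF lsub_keys[of "carrier (Q \<times>\<times> Q)"], of "t - pairs z" "pairs z"] by auto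
    then show ?thesis by simp
  qed
  \<comment> \<open>\<open>f\<close> is defined on classes; choosing representatives makes it a
    linear map on formal pairs, bilinear up to \<open>NM\<close>.\<close>
  define L where "L = lin sv (\<lambda>(a, b). g (rep a) (rep b))"
  have L: "lmap scale sv L" unfolding L_def by (rule lmap_lin_self[OF sv(1)])
  have W: "g (rep (cl x)) (rep (cl y)) - g x y \<in> NM" for x y
  proof -
    have "cm (g (rep (cl x)) (rep (cl y))) = f (cl (rep (cl x))) (cl (rep (cl y)))" by (rule f[symmetric])
    also have "\<dots> = cm (g x y)" unfolding cl_rep[OF cl_closed] by (rule f)
    finally show ?thesis using M(6) by blast
  qed
  have fs: "finite S \<Longrightarrow> finsum M (\<lambda>a. cm (h a)) S = cm (sum h S)" for S and h :: "'q \<times> 'q \<Rightarrow> 'v"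
    by (induction S rule: finite_induct) (simp_all add: M(5,3) M(2) M.finsum_insert Pi_def)
  have "sweedler M (tcl (pairs z)) f = finsum M (\<lambda>p. lookup t p \<odot>\<^bsub>M\<^esub> f (fst p) (snd p)) (keys t)"
    by (simp add: sweedler_def t_def Let_def)
  also have "\<dots> = finsum M (\<lambda>p. cm (sv (lookup t p) (g (rep (fst p)) (rep (snd p))))) (keys t)"
  proof (rule M.finsum_cong')
    fix p assume "p \<in> keys t"
    then have "fst p \<in> carrier Q" "snd p \<in> carrier Q" using tk by auto
    then show "lookup t p \<odot>\<^bsub>M\<^esub> f (fst p) (snd p) = cm (sv (lookup t p) (g (rep (fst p)) (rep (snd p))))"
      using f[of "rep (fst p)" "rep (snd p)"] by (simp add: cl_rep M(4))
  qed (auto simp: M(2))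
  also have "\<dots> = cm (L t)"
    by (simp add: fs L_def lin_def case_prod_unfold)
  also have "cm (L t) = cm (lin sv (\<lambda>(u, v). g (mon u) (mon v)) z)"
  proof -
    have ga: "g (x + x') y = g x y + g x' y" "g (scale c x) y = sv c (g x y)"
       "g x (y + y') = g x y + g x y'" "g x (scale c y) = sv c (g x y)" for x x' y y' c
      using g by (auto simp: lmap_def)
    have lm: "L (mon (a, b)) = g (rep a) (rep b)" for a b using sv(1) by (simp add: L_def)
    have "t - pairs z \<in> {x. L x \<in> NM}"
    proof (rule BI_induct[OF _ _ t])
      show "lsub scale {x. L x \<in> NM}" using sv(2) L lmap_0[OF L] by (auto simp: lsub_def lmap_def)
    next
      note d = lsub_diff[OF sv] and a = lsub_add[OF sv(2)] and c = lsub_scale[OF sv(2)]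
      fix r assume "r \<in> bilinear_rels Q Q"
      then have "L r \<in> NM"
      proof (cases r rule: bilinear_cases)
        case (1 x x' y)
        have "L r = (g (rep (cl (x + x'))) (rep (cl y)) - g (x + x') y)
            - (g (rep (cl x)) (rep (cl y)) - g x y) - (g (rep (cl x')) (rep (cl y)) - g x' y)"
          unfolding 1 by (simp add: lmap_diff[OF L] lm ga)
        then show ?thesis by (simp only: d W)
      next
        case (2 x y y')
        have "L r = (g (rep (cl x)) (rep (cl (y + y'))) - g x (y + y'))
            - (g (rep (cl x)) (rep (cl y)) - g x y) - (g (rep (cl x)) (rep (cl y')) - g x y')"
          unfolding 2 by (simp add: lmap_diff[OF L] lm ga)
        then show ?thesis by (simp only: d W)
      next
        case (3 k x y)
        have "L r = (g (rep (cl (scale k x))) (rep (cl y)) - g (scale k x) y)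
            - sv k (g (rep (cl x)) (rep (cl y)) - g x y)"
          unfolding 3 using L module.scale_right_diff_distrib[OF sv(1)[folded module_iff_vector_space]]
          by (simp add: lmap_diff[OF L] lm ga lmap_def del: scale_single)
        then show ?thesis by (simp only: d W c)
      next
        case (4 k x y)
        have "L r = (g (rep (cl x)) (rep (cl (scale k y))) - g x (scale k y))
            - sv k (g (rep (cl x)) (rep (cl y)) - g x y)"
          unfolding 4 using L module.scale_right_diff_distrib[OF sv(1)[folded module_iff_vector_space]]
          by (simp add: lmap_diff[OF L] lm ga lmap_def del: scale_single)
        then show ?thesis by (simp only: d W c)
      qed
      then show "r \<in> {x. L x \<in> NM}" by simp
    qed
    then have 1: "L t - L (pairs z) \<in> NM" by (simp add: lmap_diff[OF L])
    have "L (pairs z) - lin sv (\<lambda>(u, v). g (mon u) (mon v)) z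
        = lin sv (\<lambda>p. L (mon (cl (mon (fst p)), cl (mon (snd p)))) - g (mon (fst p)) (mon (snd p))) z"
      unfolding pairs_def lmap_lin[OF L] by (simp add: lin_fun_diff[OF sv(1)] case_prod_unfold)
    also have "\<dots> \<in> NM" by (rule lsub_lin[OF sv(2)]) (simp only: lm W)
    finally have "(L t - L (pairs z)) + (L (pairs z) - lin sv (\<lambda>(u, v). g (mon u) (mon v)) z) \<in> NM"
      by (rule lsub_add[OF sv(2) 1])
    then show ?thesis by (simp add: M(6))
  qed
  finally show ?thesis .
qed

end

section \<open>The Borel Hopf algebra\<close>

lemma keys_words [intro]:
  "set w \<subseteq> G \<Longrightarrow> keys (mon w) \<subseteq> lists G" "keys x \<subseteq> lists G \<Longrightarrow> keys (scale c x) \<subseteq> lists G"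
  "keys x \<subseteq> lists G \<Longrightarrow> keys y \<subseteq> lists G \<Longrightarrow> keys (x - y) \<subseteq> lists G" "keys (1 :: 'g list vec) \<subseteq> lists G"
proof -
  note L = lsub_keys[of "lists G"]
  show "set w \<subseteq> G \<Longrightarrow> keys (mon w) \<subseteq> lists G" by (auto split: if_splits)
  show "keys x \<subseteq> lists G \<Longrightarrow> keys (scale c x) \<subseteq> lists G" using lsub_scale[OF L] by simp
  show "keys x \<subseteq> lists G \<Longrightarrow> keys y \<subseteq> lists G \<Longrightarrow> keys (x - y) \<subseteq> lists G" using lsub_diff[OF vs_scale L] by simp
  show "keys (1 :: 'g list vec) \<subseteq> lists G" by (simp flip: mono_Nil)
qed

lemma lett_linear: "lett h (x + y) = lett h x + lett h y" "lett h (x - y) = lett h x - lett h y"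
  "lett h (scale c x) = scale c (lett h x)" "lett h (mon w) = mon (h w)" "lett h 0 = 0"
  by (simp_all add: lett_def)

lemma lett_mult: "(\<And>u v. h (u @ v) = h u @ h v) \<Longrightarrow> lett h (x * y) = lett h x * lett h y"
  unfolding lett_def by (rule lin_monoid_hom) (simp add: plus_list_def mono_mult)

lemma lett_srr: "lett (map t) (srr q m a b) = srr q m (t a) (t b)"
  by (simp add: srr_def lett_def)

lemma alg_homD:
  assumes "f \<in> alg_hom A B"
  shows "x \<in> carrier A \<Longrightarrow> f x \<in> carrier B" "x \<in> carrier A \<Longrightarrow> y \<in> carrier A \<Longrightarrow> f (x \<otimes>\<^bsub>A\<^esub> y) = f x \<otimes>\<^bsub>B\<^esub> f y"
    "x \<in> carrier A \<Longrightarrow> y \<in> carrier A \<Longrightarrow> f (x \<oplus>\<^bsub>A\<^esub> y) = f x \<oplus>\<^bsub>B\<^esub> f y"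
    "x \<in> carrier A \<Longrightarrow> f (c \<odot>\<^bsub>A\<^esub> x) = c \<odot>\<^bsub>B\<^esub> f x" "f \<one>\<^bsub>A\<^esub> = \<one>\<^bsub>B\<^esub>"
  using assms by (auto simp: alg_hom_def ring_hom_def)

lemma ground_simps [simp]:
  "carrier ground_alg = UNIV" "x \<otimes>\<^bsub>ground_alg\<^esub> y = x * y" "x \<oplus>\<^bsub>ground_alg\<^esub> y = x + y"
  "\<one>\<^bsub>ground_alg\<^esub> = 1" "\<zero>\<^bsub>ground_alg\<^esub> = 0" "c \<odot>\<^bsub>ground_alg\<^esub> x = c * x"
  by (simp_all add: ground_alg_def)

lemma ring_ground: "ring ground_alg"
proof (rule ringI)
  show "abelian_group ground_alg"
    by (rule abelian_groupI) (auto simp: add_ac intro: exI[of _ "- _"])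
  show "monoid ground_alg" by (rule monoidI) (auto simp: mult_ac)
qed (auto simp: algebra_simps)

context satake
begin

lemma vi_s: "vi d i powi C i j = vp (s i j)" "vi d i powi - C i j = vp (- s i j)"
  by (simp_all add: vi_powi s_def)

lemma Bor_rels_eq: "Bor_rels (free_alg UNIV) C d = borel_rels"
proof -
  have "Bor_rels (free_alg UNIV) C d =
     {mon [GH i, GH j] - mon [GH j, GH i] | i j. True}
   \<union> {mon [GH i, GTheta j] - scale (vp (s i j)) (mon [GTheta j, GH i]) | i j. True}
   \<union> {sr i j | i j. i \<noteq> j}
   \<union> {mon [GH i, GHinv i] - 1 | i. True}
   \<union> {mon [GHinv i, GH i] - 1 | i. True}"
    unfolding Bor_rels_def
    by (simp add: serre_free_alg free_alg_minus sr_def vi_s gen_mon[symmetric] del: scale_single)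
       (simp add: gen_mon mono_mult del: scale_single)
  then show ?thesis unfolding borel_rels_def torus_rels_def serre_rels_def by (simp only: Un_ac)
qed

definition bcl :: "'i word vec \<Rightarrow> 'i B" where "bcl = (+>\<^bsub>free_alg UNIV\<^esub>) J"

sublocale B: word_quotient "Bor C d" J bcl
  using presented_word_quotient[of borel_rels] by (simp add: Bor_def Bor_rels_eq bcl_def)

lemma theta_bcl: "theta_elem C d i = bcl (mon [GTheta i])" and h_bcl: "h_elem C d i = bcl (mon [GH i])"
  by (simp_all add: theta_elem_def h_elem_def Bor_rels_eq presented_gen_cl bcl_def)

lemma bcl_hh: "bcl (mon [GH i]) \<otimes>\<^bsub>Bor C d\<^esub> bcl (mon [GHinv i]) = \<one>\<^bsub>Bor C d\<^esub>"
  "bcl (mon [GHinv i]) \<otimes>\<^bsub>Bor C d\<^esub> bcl (mon [GH i]) = \<one>\<^bsub>Bor C d\<^esub>"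
  unfolding B.mult B.one B.eq mono_mult by (rule idl_incl; force simp: borel_rels_def torus_rels_def)+

lemma Bor_hom_unique:
  assumes T: "monoid T" and f: "f \<in> alg_hom (Bor C d) T" "f' \<in> alg_hom (Bor C d) T"
    and th: "\<And>i. f (theta_elem C d i) = f' (theta_elem C d i)" and h: "\<And>i. f (h_elem C d i) = f' (h_elem C d i)"
  shows "f (bcl x) = f' (bcl x)"
proof (rule B.hom_unique[OF f])
  fix l
  show "f (bcl (mon [l])) = f' (bcl (mon [l]))"
  proof (cases l)
    case (GHinv i)
    let ?h = "bcl (mon [GH i])" and ?k = "bcl (mon [GHinv i])"
    have "f ?h \<otimes>\<^bsub>T\<^esub> f ?k = \<one>\<^bsub>T\<^esub>" "f' ?k \<otimes>\<^bsub>T\<^esub> f' ?h = \<one>\<^bsub>T\<^esub>"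
      using alg_homD(2)[OF f(1), of ?h ?k] alg_homD(2)[OF f(2), of ?k ?h] alg_homD(5)[OF f(1)] alg_homD(5)[OF f(2)]
      by (simp_all add: bcl_hh)
    moreover have "f ?h = f' ?h" using h by (simp add: h_bcl)
    ultimately have "f' ?k = f ?k"
      using monoid.inv_unique[OF T, of "f' ?k" "f ?h" "f ?k"] alg_homD(1)[OF f(1)] alg_homD(1)[OF f(2)] by simp
    then show ?thesis by (simp add: GHinv)
  qed (use th h in \<open>simp_all add: theta_bcl h_bcl\<close>)
qed

text \<open>The prescribed values determine a homomorphism, so the one chosen by \<open>SOME\<close>
  agrees with any explicit one that has them.\<close>

lemma some_hom:
  assumes T: "monoid T" and g: "g \<in> alg_hom (Bor C d) T" "\<And>i. g (theta_elem C d i) = a i" "\<And>i. g (h_elem C d i) = b i"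
    and F: "F = (SOME f. f \<in> alg_hom (Bor C d) T \<and> (\<forall>i. f (theta_elem C d i) = a i) \<and> (\<forall>i. f (h_elem C d i) = b i))"
  shows "F (bcl x) = g (bcl x)"
proof -
  have F: "F \<in> alg_hom (Bor C d) T \<and> (\<forall>i. F (theta_elem C d i) = a i) \<and> (\<forall>i. F (h_elem C d i) = b i)"
    unfolding F by (rule someI[of _ g]) (use g in auto)
  show ?thesis by (rule Bor_hom_unique[OF T]) (simp_all add: F g)
qed

lemma comult_bcl: "comult C d (bcl x) = B.tcl (B.pairs (Del x))"
proof -
  let ?T = "tensor_alg (Bor C d) (Bor C d)" and ?h = "\<lambda>x. B.tcl (B.pairs (Del x))"
  interpret T: ring ?T by (rule B.tensor_facts(2))
  have N: "?h x = ?h y" if "x - y \<in> J" for x y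
    using B.pairs_span2[OF Del_J[OF that]] by (simp add: B.tensor_facts(9) B.pairs_linear)
  have one: "Del 1 = (1 :: ('i word \<times> 'i word) vec)"
    by (simp flip: mono_Nil) (metis single_one zero_prod_def zero_list_def)
  have h: "(\<lambda>X. ?h (B.rep X)) \<in> alg_hom (Bor C d) ?T"
  proof (rule B.lift_hom(1))
    fix x y c
    show "?h (x + y) = ?h x \<oplus>\<^bsub>?T\<^esub> ?h y"
      by (subst B.tensor_facts(7)[OF B.pairs_carrier B.pairs_carrier]) (simp add: B.pairs_linear Del_linear)
    show "?h (x * y) = ?h x \<otimes>\<^bsub>?T\<^esub> ?h y"
      by (subst B.tensor_facts(6)[OF B.pairs_carrier B.pairs_carrier]) (simp add: B.pairs_mult Del_mult)
    show "?h (scale c x) = c \<odot>\<^bsub>?T\<^esub> ?h x"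
      by (subst B.tensor_facts(8)) (simp add: B.pairs_linear Del_linear)
    show "?h 1 = \<one>\<^bsub>?T\<^esub>" by (simp only: one B.pairs_one B.tensor_facts(4))
    show "?h x \<in> carrier ?T" unfolding B.tensor_facts(3) by (rule imageI[OF B.pairs_carrier])
    show "x - y \<in> J \<Longrightarrow> ?h x = ?h y" by (rule N)
  qed
  have h2: "?h (B.rep (bcl x)) = ?h x" for x by (rule N[OF B.rep_cl])
  have "comult C d (bcl x) = (\<lambda>X. ?h (B.rep X)) (bcl x)"
  proof (rule some_hom[OF T.monoid_axioms h])
    show "?h (B.rep (theta_elem C d i)) = tensor_elem (Bor C d) (Bor C d) (theta_elem C d i) \<one>\<^bsub>Bor C d\<^esub>
        \<oplus>\<^bsub>?T\<^esub> tensor_elem (Bor C d) (Bor C d) (h_elem C d i) (theta_elem C d i)" for i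
      unfolding theta_bcl h_bcl h2 B.one B.tensor_elem_cl
      by (subst B.tensor_facts(7)[OF B.pairs_carrier B.pairs_carrier]) (simp flip: B.pairs_linear(1) mono_Nil)
    show "?h (B.rep (h_elem C d i)) = tensor_elem (Bor C d) (Bor C d) (h_elem C d i) (h_elem C d i)" for i
      unfolding h_bcl h2 B.tensor_elem_cl by simp
    show "comult C d = (SOME f. f \<in> alg_hom (Bor C d) ?T \<and>
       (\<forall>i. f (theta_elem C d i) = tensor_elem (Bor C d) (Bor C d) (theta_elem C d i) \<one>\<^bsub>Bor C d\<^esub>
        \<oplus>\<^bsub>?T\<^esub> tensor_elem (Bor C d) (Bor C d) (h_elem C d i) (theta_elem C d i)) \<and>
       (\<forall>i. f (h_elem C d i) = tensor_elem (Bor C d) (Bor C d) (h_elem C d i) (h_elem C d i)))"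
      by (simp add: comult_def Let_def)
  qed
  then show ?thesis by (simp only: h2)
qed

lemma eps_mult: "lin (*) eps (x * y) = lin (*) eps x * lin (*) eps y"
proof (induction x rule: vec_induct)
  case (mon k c)
  show ?case
    by (induction y rule: vec_induct) (simp_all add: distrib_left mult_single plus_list_def mult_ac)
qed (simp_all add: distrib_right)

lemma counit_bcl: "counit C d (bcl x) = lin (*) eps x"
proof -
  have N: "lin (*) eps x = lin (*) eps y" if "x - y \<in> J" for x y
    using eps_J[OF that] by simp
  have h: "(\<lambda>X. lin (*) eps (B.rep X)) \<in> alg_hom (Bor C d) ground_alg"
    by (rule B.lift_hom(1); simp add: eps_mult lin_mono_one N)
  have h2: "lin (*) eps (B.rep (bcl x)) = lin (*) eps x" for x by (rule N[OF B.rep_cl])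
  have "counit C d (bcl x) = (\<lambda>X. lin (*) eps (B.rep X)) (bcl x)"
    by (rule some_hom[OF ring.is_monoid[OF ring_ground] h, of "\<lambda>_. 0" "\<lambda>_. 1"])
       (simp_all add: theta_bcl h_bcl h2 counit_def)
  then show ?thesis by (simp only: h2)
qed

lemma tau_map_bcl: "tau_map C d \<tau> (bcl x) = bcl (lett tw x)"
proof -
  have N: "bcl (lett tw x) = bcl (lett tw y)" if "x - y \<in> J" for x y
    using tw_idl_borel[OF that] by (simp add: B.eq lett_def)
  have one: "lett tw 1 = 1" by (simp add: lett_linear flip: mono_Nil)
  have h: "(\<lambda>X. bcl (lett tw (B.rep X))) \<in> alg_hom (Bor C d) (Bor C d)"
    by (rule B.lift_hom(1); simp add: B.add B.mult B.smult B.one lett_linear lett_mult one N)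
  have h2: "bcl (lett tw (B.rep (bcl x))) = bcl (lett tw x)" for x by (rule N[OF B.rep_cl])
  have "tau_map C d \<tau> (bcl x) = (\<lambda>X. bcl (lett tw (B.rep X))) (bcl x)"
    by (rule some_hom[OF B.monoid_Q h, of "\<lambda>i. theta_elem C d (\<tau> i)" "\<lambda>i. h_elem C d (\<tau> i)"])
       (simp_all add: theta_bcl h_bcl h2 tau_map_def lett_linear)
  then show ?thesis by (simp only: h2)
qed

section \<open>Existence and uniqueness of the Hopf pairing\<close>

definition PSI :: "'i word vec \<Rightarrow> 'i word vec \<Rightarrow> qfield" where
  "PSI x y = lin (*) (\<lambda>a. lin (*) (psi a) y) x"

lemma PSI_lmap: "lmap scale (*) (\<lambda>x. PSI x y)" "lmap scale (*) (PSI x)"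
  by (auto simp: PSI_def lmap_def lin_fun_add lin_times_left)

lemma PSI_linear: "PSI (x + x') y = PSI x y + PSI x' y" "PSI (scale c x) y = c * PSI x y"
  "PSI x (y + y') = PSI x y + PSI x y'" "PSI x (scale c y) = c * PSI x y" "PSI 0 y = 0" "PSI x 0 = 0"
  "PSI (mon a) (mon b) = psi a b"
  using PSI_lmap lmap_0[OF PSI_lmap(1)] lmap_0[OF PSI_lmap(2)] by (auto simp: lmap_def PSI_def)

lemma PSI_J: "x \<in> J \<Longrightarrow> PSI x y = 0" "y \<in> J \<Longrightarrow> PSI x y = 0"
  unfolding PSI_def by (subst lin_swap[OF vs_times]) (simp_all add: psi_J_left psi_J_right)

lemma PSI_rep: "PSI (B.rep (bcl x)) (B.rep (bcl y)) = PSI x y"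
proof -
  have "PSI (B.rep (bcl x) - x) (B.rep (bcl y)) = 0" "PSI x (B.rep (bcl y) - y) = 0"
    by (rule PSI_J[OF B.rep_cl])+
  then show ?thesis by (simp add: lmap_diff[OF PSI_lmap(1)] lmap_diff[OF PSI_lmap(2)])
qed

lemma sweedler_ground:
  assumes "\<And>x y. f (bcl x) (bcl y) = g x y" "\<And>y. lmap scale (*) (\<lambda>x. g x y)" "\<And>x. lmap scale (*) (g x)"
  shows "sweedler ground_alg (comult C d (bcl z)) f = lin (*) (\<lambda>w. sw w (\<lambda>u v. g (mon u) (mon v))) z"
proof -
  interpret ring ground_alg by (rule ring_ground)
  have "sweedler ground_alg (comult C d (bcl z)) f = lin (*) (\<lambda>(u, v). g (mon u) (mon v)) (Del z)"
    unfolding comult_bcl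
    by (rule B.sweedler_eval[where cm = "\<lambda>x. x" and NM = "{0}", OF abelian_monoid_axioms])
       (use assms in \<open>auto intro: lsub_zero\<close>)
  then show ?thesis by (simp only: lin_Del[OF vs_times])
qed

lemma sweedler_Bor:
  assumes "\<And>x y. f (bcl x) (bcl y) = bcl (g x y)" "\<And>y. lmap scale scale (\<lambda>x. g x y)" "\<And>x. lmap scale scale (g x)"
  shows "sweedler (Bor C d) (comult C d (bcl z)) f = bcl (lin scale (\<lambda>w. sw w (\<lambda>u v. g (mon u) (mon v))) z)"
proof -
  have "sweedler (Bor C d) (comult C d (bcl z)) f = bcl (lin scale (\<lambda>(u, v). g (mon u) (mon v)) (Del z))"
    unfolding comult_bcl
    by (rule B.sweedler_eval[where sv = scale and NM = J, OF B.abelian_monoid_axioms])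
       (use assms in \<open>auto simp: B.add B.smult B.zero B.eq\<close>)
  then show ?thesis by (simp only: lin_Del[OF vs_scale])
qed

lemma lmap_prod:
  "lmap scale (*) p \<Longrightarrow> lmap scale (*) (\<lambda>x. p x * c)" "lmap scale (*) p \<Longrightarrow> lmap scale (*) (\<lambda>x. c * p x)" for c :: qfield
  by (auto simp: lmap_def algebra_simps)

lemma PSI_mult_right: "PSI x (y * y') = lin (*) (\<lambda>w. sw w (\<lambda>u v. PSI (mon u) y * PSI (mon v) y')) x"
proof (induction y rule: vec_induct)
  case (mon b c)
  show ?case
  proof (induction y' rule: vec_induct)
    case m2: (mon b' c')
    show ?case
      by (induction x rule: vec_induct)
        (simp_all add: PSI_linear scale_mult mono_mult psi_append_right sw_times_left mult_ac distrib_left del: scale_single)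
  qed (simp_all add: distrib_left PSI_linear sw_add lin_fun_add)
qed (simp_all add: distrib_right PSI_linear sw_add lin_fun_add)

lemma PSI_mult_left: "PSI (x * x') y = lin (*) (\<lambda>w. sw w (\<lambda>u v. PSI x (mon u) * PSI x' (mon v))) y"
proof (induction x rule: vec_induct)
  case (mon b c)
  show ?case
  proof (induction x' rule: vec_induct)
    case m2: (mon b' c')
    show ?case
      by (induction y rule: vec_induct)
        (simp_all add: PSI_linear scale_mult mono_mult psi_append_left sw_times_left mult_ac distrib_left del: scale_single)
  qed (simp_all add: distrib_left PSI_linear sw_add lin_fun_add)
qed (simp_all add: distrib_right PSI_linear sw_add lin_fun_add)

lemma PSI_one: "PSI x 1 = lin (*) eps x" "PSI 1 x = lin (*) eps x"
  by (simp_all add: PSI_def psi_Nil_right lin_mono_one psi.simps(1)[abs_def])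

lemma hopf_pairing_exists: "is_hopf_pairing C d (\<lambda>X Y. PSI (B.rep X) (B.rep Y))"
  unfolding is_hopf_pairing_def
proof (intro conjI ballI allI)
  let ?p = "\<lambda>X Y. PSI (B.rep X) (B.rep Y)"
  show "bilinear_form (Bor C d) ?p"
    unfolding bilinear_form_def by (auto elim!: B.cl_cases simp: B.add B.smult PSI_rep PSI_linear)
  fix a b b' assume "a \<in> carrier (Bor C d)" "b \<in> carrier (Bor C d)" "b' \<in> carrier (Bor C d)"
  then obtain x y y' where [simp]: "a = bcl x" "b = bcl y" "b' = bcl y'" by (metis B.cl_cases)
  show "?p a (b \<otimes>\<^bsub>Bor C d\<^esub> b') = sweedler ground_alg (comult C d a) (\<lambda>a1 a2. ?p a1 b * ?p a2 b')"
    by (subst \<open>a = bcl x\<close>, subst sweedler_ground[where g = "\<lambda>u v. PSI u y * PSI v y'"])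
       (simp_all add: PSI_rep lmap_prod PSI_lmap B.mult PSI_mult_right)
next
  let ?p = "\<lambda>X Y. PSI (B.rep X) (B.rep Y)"
  fix a b b' assume "a \<in> carrier (Bor C d)" "b \<in> carrier (Bor C d)" "b' \<in> carrier (Bor C d)"
  then obtain x y y' where [simp]: "b' = bcl x" "a = bcl y" "b = bcl y'" by (metis B.cl_cases)
  show "?p (a \<otimes>\<^bsub>Bor C d\<^esub> b) b' = sweedler ground_alg (comult C d b') (\<lambda>a1 a2. ?p a a1 * ?p b a2)"
    by (subst \<open>b' = bcl x\<close>, subst sweedler_ground[where g = "\<lambda>u v. PSI y u * PSI y' v"])
       (simp_all add: PSI_rep lmap_prod PSI_lmap B.mult PSI_mult_left)
qed (auto elim!: B.cl_cases simp: B.one PSI_rep PSI_one counit_bcl theta_bcl h_bcl PSI_linear psi_letter vi_s kap_def simp del: psi.simps(2))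

lemma vp_neq_inv: "vp (s j j) \<noteq> 1"
  using vp_neq_1[OF s_diag] .

text \<open>The pairing is chosen by \<open>SOME\<close>, so its axioms have to determine it: they
  fix the values on pairs of letters, and the two multiplicativity laws then reproduce the
  recursions of \<open>pl\<close> and \<open>psi\<close>.\<close>

lemma hopf_pairing_unique:
  assumes "is_hopf_pairing C d \<phi>"
  shows "\<phi> (bcl x) (bcl y) = PSI x y"
proof -
  define p where "p x y = \<phi> (bcl x) (bcl y)" for x y
  have lin1: "lmap scale (*) (\<lambda>x. p x y)" and lin2: "lmap scale (*) (p x)" for x y
    using assms unfolding is_hopf_pairing_def bilinear_form_def p_def lmap_def
    by (simp_all flip: B.add B.smult)
  have mr: "p x (y * y') = lin (*) (\<lambda>w. sw w (\<lambda>u v. p (mon u) y * p (mon v) y')) x" for x y y'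
  proof -
    have "p x (y * y') = sweedler ground_alg (comult C d (bcl x)) (\<lambda>a1 a2. \<phi> a1 (bcl y) * \<phi> a2 (bcl y'))"
      using assms unfolding is_hopf_pairing_def p_def by (simp flip: B.mult)
    also have "\<dots> = lin (*) (\<lambda>w. sw w (\<lambda>u v. p (mon u) y * p (mon v) y')) x"
      by (rule sweedler_ground) (simp_all add: p_def[symmetric] lmap_prod lin1 lin2)
    finally show ?thesis .
  qed
  have ml: "p (x * x') y = lin (*) (\<lambda>w. sw w (\<lambda>u v. p x (mon u) * p x' (mon v))) y" for x x' y
  proof -
    have "p (x * x') y = sweedler ground_alg (comult C d (bcl y)) (\<lambda>a1 a2. \<phi> (bcl x) a1 * \<phi> (bcl x') a2)"
      using assms unfolding is_hopf_pairing_def p_def by (simp flip: B.mult)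
    also have "\<dots> = lin (*) (\<lambda>w. sw w (\<lambda>u v. p x (mon u) * p x' (mon v))) y"
      by (rule sweedler_ground) (simp_all add: p_def[symmetric] lmap_prod lin1 lin2)
    finally show ?thesis .
  qed
  have p1: "p x 1 = lin (*) eps x" "p 1 x = lin (*) eps x" for x
    using assms unfolding is_hopf_pairing_def p_def by (simp_all add: counit_bcl flip: B.one)
  have g: "p (mon [GTheta i]) (mon [GTheta j]) = (if i = j then kap i else 0)"
    "p (mon [GH i]) (mon [GH j]) = vp (s i j)" "p (mon [GTheta i]) (mon [GH j]) = 0" for i j
    using assms unfolding is_hopf_pairing_def p_def by (simp_all add: theta_bcl h_bcl kap_def vi_s)
  have cong: "p x y = p x' y" "p z x = p z x'" if "x - x' \<in> J" for x x' y z
    using that by (simp_all add: p_def B.eq[THEN iffD2])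
  \<comment> \<open>The data prescribe the pairing of \<open>\<vartheta>\<close> with
    \<open>h\<close> but not of \<open>h\<close> with \<open>\<vartheta>\<close>. The latter
    vanishes because \<open>h\<^sub>j\<close> and \<open>\<vartheta>\<^sub>j\<close> commute up to
    the scalar \<open>vp (s j j)\<close>, which differs from \<open>1\<close>.\<close>
  have hth: "p (mon [GH i]) (mon [GTheta j]) = 0" for i j
  proof -
    have "mon [GH j, GTheta j] - scale (vp (s j j)) (mon [GTheta j, GH j]) \<in> J"
      by (rule idl_incl) (auto simp: borel_rels_def torus_rels_def simp del: scale_single)
    from cong(2)[OF this, of "mon [GH i]"]
    have "p (mon [GH i]) (mon [GH j] * mon [GTheta j]) = vp (s j j) * p (mon [GH i]) (mon [GTheta j] * mon [GH j])"
      using lin2 by (simp add: lmap_def mono_mult del: scale_single)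
    then have "vp (s i j) * p (mon [GH i]) (mon [GTheta j]) = vp (s j j) * (p (mon [GH i]) (mon [GTheta j]) * vp (s i j))"
      unfolding mr by (simp add: g)
    then have "vp (s i j) * p (mon [GH i]) (mon [GTheta j]) * (1 - vp (s j j)) = 0"
      by (simp add: algebra_simps)
    then show ?thesis using vp_neq_inv[of j] by simp
  qed
  have R: "mon [GH i] * mon [GHinv i] - 1 \<in> J" "mon [GHinv i] * mon [GH i] - 1 \<in> J" for i
    unfolding mono_mult by (rule idl_incl; force simp: borel_rels_def torus_rels_def)+
  \<comment> \<open>Pairing with \<open>h\<^sub>i\<close> and with its inverse are convolution
    inverses; this determines the values that involve inverse letters.\<close>
  have inv_l: "lin (*) (\<lambda>w. sw w (\<lambda>u v. p (mon [GH i]) (mon u) * p (mon [GHinv i]) (mon v))) y = lin (*) eps y" for i y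
    using cong(1)[OF R(1), of i y] unfolding ml p1 .
  have inv_r: "lin (*) (\<lambda>w. sw w (\<lambda>u v. p (mon u) (mon [GH i]) * p (mon v) (mon [GHinv i]))) x = lin (*) eps x" for i x
    using cong(2)[OF R(1), of x i] unfolding mr p1 .
  have vi: "x = vp (- n)" if "vp n * x = 1" for x n
    using that by (metis inverse_unique vp_minus)
  have gi: "p (mon [GHinv i]) (mon [GH j]) = vp (- s i j)" "p (mon [GH i]) (mon [GHinv j]) = vp (- s i j)" for i j
    using inv_l[of i "mon [GH j]"] inv_r[of j "mon [GH i]"] by (simp_all add: g vi)
  have gt: "p (mon [GHinv i]) (mon [GTheta j]) = 0" "p (mon [GTheta i]) (mon [GHinv j]) = 0" for i j
    using inv_l[of i "mon [GTheta j]"] inv_r[of j "mon [GTheta i]"] p1 by (simp_all add: g hth mono_Nil p1 flip: mono_Nil)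
  have gii: "p (mon [GHinv i]) (mon [GHinv j]) = vp (s i j)" for i j
    using inv_r[of j "mon [GHinv i]"] vi[of "- s i j"] by (simp add: gi)
  have letters: "p (mon [l]) (mon [l']) = pl2 l l'" for l l'
    by (cases l; cases l') (simp_all add: g hth gi gt gii)
  have pNil: "p (mon w) (mon []) = eps w" "p (mon []) (mon w) = eps w" for w
    using p1[of "mon w"] by (simp_all add: mono_Nil)
  have letter: "p (mon [l]) (mon u) = pl l u" for l u
  proof (induction u)
    case Nil show ?case by (cases l) (simp_all add: pNil)
  next
    case (Cons l' u)
    have "p (mon [l]) (mon [l'] * mon u) = sw [l] (\<lambda>a b. p (mon a) (mon [l']) * p (mon b) (mon u))"
      unfolding mr by simp
    then show ?case using Cons by (cases l) (simp_all add: mono_mult letters pNil)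
  qed
  have words: "p (mon w) (mon u) = psi w u" for w u
  proof (induction w arbitrary: u)
    case (Cons l w)
    have "p (mon [l] * mon w) (mon u) = sw u (\<lambda>a b. p (mon [l]) (mon a) * p (mon w) (mon b))"
      unfolding ml by simp
    then show ?case by (simp add: mono_mult letter Cons)
  qed (simp add: pNil)
  have "p x y = lin (*) (\<lambda>w. p (mon w) y) x" by (rule lmap_eq_lin[OF lin1 vs_times])
  also have "\<dots> = PSI x y"
    unfolding PSI_def by (simp only: lmap_eq_lin[OF lin2 vs_times, of "mon w" y for w] words)
  finally have "p x y = PSI x y" .
  then show ?thesis by (simp add: p_def)
qed

lemma hopf_pairing_bcl: "hopf_pairing C d (bcl x) (bcl y) = PSI x y"
  by (rule hopf_pairing_unique) (use someI[of "is_hopf_pairing C d", OF hopf_pairing_exists] in \<open>simp add: hopf_pairing_def\<close>)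

text \<open>Both nested Sweedler sums are evaluated by \<open>sweedler_Bor\<close>; the outer one
  qualifies because the inner value \<open>?G\<close> is again linear in \<open>z1\<close> and in
  \<open>z2\<close>.\<close>

lemma imult_bcl: "imult C d \<tau> (bcl x) (bcl y) = bcl (STAR x y)"
proof -
  let ?g = "\<lambda>z1 z2 u v. scale (PSI (lett tw v) z1) (z2 * u)"
  let ?G = "\<lambda>z1 z2. lin scale (\<lambda>w. sw w (\<lambda>u v. ?g z1 z2 (mon u) (mon v))) y"
  have inner: "sweedler (Bor C d) (comult C d (bcl y)) (\<lambda>b1 b2. hopf_pairing C d (tau_map C d \<tau> b2) (bcl z1) \<odot>\<^bsub>Bor C d\<^esub> (bcl z2 \<otimes>\<^bsub>Bor C d\<^esub> b1))
     = bcl (?G z1 z2)" for z1 z2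
    by (rule sweedler_Bor)
       (auto simp: tau_map_bcl hopf_pairing_bcl B.mult B.smult lmap_def distrib_left sc.scale_right_distrib scale_mult lett_linear PSI_linear sc.scale_left_distrib mult_ac)
  have "imult C d \<tau> (bcl x) (bcl y) = bcl (lin scale (\<lambda>w. sw w (\<lambda>u v. ?G (mon u) (mon v))) x)"
    unfolding imult_def
  proof (rule sweedler_Bor[where g = ?G])
    show "sweedler (Bor C d) (comult C d (bcl y)) (\<lambda>b1 b2. hopf_pairing C d (tau_map C d \<tau> b2) (bcl z1) \<odot>\<^bsub>Bor C d\<^esub> (bcl z2 \<otimes>\<^bsub>Bor C d\<^esub> b1))
     = bcl (?G z1 z2)" for z1 z2 by (rule inner)
    show "lmap scale scale (\<lambda>z1. ?G z1 z2)" for z2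
      by (auto simp: lmap_def PSI_linear sc.scale_left_distrib sw_add lin_fun_add sw_scale[symmetric] lmap_lin[OF lmap_scale] sc.scale_scale[symmetric] simp del: sc.scale_scale)
    show "lmap scale scale (\<lambda>z2. ?G z1 z2)" for z1
      by (auto simp: lmap_def distrib_right sc.scale_right_distrib sw_add lin_fun_add scale_mult sw_scale lmap_lin[OF lmap_scale] mult_ac)
  qed
  moreover have "lin scale (\<lambda>w. sw w (\<lambda>u v. ?G (mon u) (mon v))) x = STAR x y"
    unfolding STAR_def lin_sw[OF vs_scale, symmetric] star_def
    by (simp add: lett_linear PSI_linear pt_def mono_mult del: scale_single)
  ultimately show ?thesis by simp
qed

end

section \<open>Subalgebras\<close>

lemma alg_hom_subalg_gen:
  assumes f: "f \<in> alg_hom A B" and A: "ring A" "\<And>c x. x \<in> carrier A \<Longrightarrow> c \<odot>\<^bsub>A\<^esub> x \<in> carrier A"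
    and S: "S \<subseteq> carrier A"
  shows "f ` subalg_gen A S = subalg_gen B (f ` S)"
proof -
  interpret ring A by fact
  have c: "x \<in> carrier A" if "x \<in> subalg_gen A S" for x
    using that by induction (use S A in auto)
  have "f x \<in> subalg_gen B (f ` S)" if "x \<in> subalg_gen A S" for x
    using that by induction (auto simp: alg_homD[OF f] c intro: subalg_gen.intros)
  moreover have "y \<in> f ` subalg_gen A S" if "y \<in> subalg_gen B (f ` S)" for y
    using that
  proof induction
    case one then show ?case by (intro rev_image_eqI[OF subalg_gen.one]) (simp add: alg_homD(5)[OF f])
  next
    case (incl x) then show ?case by (auto intro: subalg_gen.incl)
  next
    case (add x y)
    then obtain a b where ab: "x = f a" "a \<in> subalg_gen A S" "y = f b" "b \<in> subalg_gen A S" by auto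
    then show ?case
      by (intro image_eqI[of _ _ "a \<oplus>\<^bsub>A\<^esub> b"] subalg_gen.add) (simp_all add: alg_homD(3)[OF f] c)
  next
    case (mult x y)
    then obtain a b where ab: "x = f a" "a \<in> subalg_gen A S" "y = f b" "b \<in> subalg_gen A S" by auto
    then show ?case
      by (intro image_eqI[of _ _ "a \<otimes>\<^bsub>A\<^esub> b"] subalg_gen.mult) (simp_all add: alg_homD(2)[OF f] c)
  next
    case (smult x k)
    then obtain a where ab: "x = f a" "a \<in> subalg_gen A S" by auto
    then show ?case
      by (intro image_eqI[of _ _ "k \<odot>\<^bsub>A\<^esub> a"] subalg_gen.smult) (simp_all add: alg_homD(4)[OF f] c)
  qed
  ultimately show ?thesis by blast
qed

context word_quotient
begin

lemma subalg_gen_lsub: "lsub scale {x. cl x \<in> subalg_gen Q S}"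
proof -
  have "cl 0 \<in> subalg_gen Q S" using subalg_gen.smult[OF subalg_gen.one, where A = Q and S = S and c = 0] by (simp add: one smult)
  then show ?thesis unfolding lsub_def by (auto simp flip: add smult intro: subalg_gen.add subalg_gen.smult)
qed

text \<open>Lets the subalgebra \<open>Bor_hat\<close> be handled by restricting the alphabet of
  words.\<close>

lemma subalg_gen_letters:
  "subalg_gen Q ((\<lambda>g. cl (mon [g])) ` A) = cl ` {x. keys x \<subseteq> lists A}" (is "?S = ?R")
proof
  note Q = one add mult smult
  show "?S \<subseteq> ?R"
  proof
    fix X assume "X \<in> ?S"
    then show "X \<in> ?R"
    proof induction
      case one show ?case unfolding Q(1) by (intro imageI CollectI keys_words)
    next
      case (incl x) then show ?case by auto
    next
      case (add X Y)
      then obtain x y where "X = cl x" "keys x \<subseteq> lists A" "Y = cl y" "keys y \<subseteq> lists A" by auto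
      then show ?case using lsub_add[OF lsub_keys[of "lists A"], of x y] by (auto simp: Q(2))
    next
      case (mult X Y)
      then obtain x y where "X = cl x" "keys x \<subseteq> lists A" "Y = cl y" "keys y \<subseteq> lists A" by auto
      then show ?case using keys_mult_words[of x A y] by (auto simp: Q(3))
    next
      case (smult X c)
      then obtain x where "X = cl x" "keys x \<subseteq> lists A" by auto
      then show ?case unfolding Q(4) by (auto intro!: imageI keys_words(2) simp: Q(4) simp del: lists_eq_set)
    qed
  qed
  show "?R \<subseteq> ?S"
  proof clarify
    have w: "w \<in> lists A \<Longrightarrow> cl (mon w) \<in> ?S" for w
    proof (induction w)
      case Nil then show ?case using subalg_gen.one[of Q] by (simp add: Q(1) mono_Nil)
    next
      case (Cons g w)
      then have "cl (mon [g]) \<otimes>\<^bsub>Q\<^esub> cl (mon w) \<in> ?S" by (intro subalg_gen.mult[OF subalg_gen.incl]) auto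
      then show ?case by (simp add: Q(3) mono_mult)
    qed
    fix x :: "'g list vec" assume "keys x \<subseteq> lists A"
    note L = subalg_gen_lsub[of "(\<lambda>g. cl (mon [g])) ` A"]
    from \<open>keys x \<subseteq> lists A\<close> have "x \<in> {x. cl x \<in> ?S}"
      by (induction rule: vec_induct_keys)
         (rule lsub_0[OF L], rule lsub_add[OF L], assumption+, rule lsub_scale[OF L], rule CollectI, rule w)
    then show "cl x \<in> ?S" by simp
  qed
qed

end

section \<open>The isomorphism\<close>

context satake
begin

definition hat_rels :: "'i ugen list vec set" where
  "hat_rels =
     {mon [a, b] - mon [b, a] | a b. a \<in> range GK \<union> range GK' \<and> b \<in> range GK \<union> range GK'}
   \<union> {mon [GE i, GF j] - mon [GF j, GE i] - scale (if i = j then - kap i else 0) (mon [GK i] - mon [GK' i]) | i j. True}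
   \<union> {mon [GK i, GE j] - scale (vp (s i j)) (mon [GE j, GK i]) | i j. True}
   \<union> {mon [GK i, GF j] - scale (vp (- s i j)) (mon [GF j, GK i]) | i j. True}
   \<union> {mon [GK' i, GE j] - scale (vp (- s i j)) (mon [GE j, GK' i]) | i j. True}
   \<union> {mon [GK' i, GF j] - scale (vp (s i j)) (mon [GF j, GK' i]) | i j. True}
   \<union> {srr (vi d i) (nat (1 - C i j)) (GE i) (GE j) | i j. i \<noteq> j}
   \<union> {srr (vi d i) (nat (1 - C i j)) (GF i) (GF j) | i j. i \<noteq> j}"

lemma U_hat_rels_eq:
  assumes "U_hat_gens \<subseteq> G"
  shows "U_hat_rels (free_alg G) C d = hat_rels"
proof -
  have mem [simp]: "GE i \<in> G" "GF i \<in> G" "GK i \<in> G" "GK' i \<in> G" for i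
    using assms by (auto simp: U_hat_gens_def)
  have mm: "gen a \<otimes>\<^bsub>free_alg G\<^esub> gen b = mon [a, b]" for a b
    by (simp add: gen_mon mono_mult)
  have comm: "{x \<otimes>\<^bsub>free_alg G\<^esub> y \<ominus>\<^bsub>free_alg G\<^esub> y \<otimes>\<^bsub>free_alg G\<^esub> x | x y. x \<in> gen ` S \<and> y \<in> gen ` S}
      = {mon [a, b] - mon [b, a] | a b. a \<in> S \<and> b \<in> S}" if "S \<subseteq> G" for S
  proof -
    have "gen a \<otimes>\<^bsub>free_alg G\<^esub> gen b \<ominus>\<^bsub>free_alg G\<^esub> gen b \<otimes>\<^bsub>free_alg G\<^esub> gen a = mon [a, b] - mon [b, a]"
      if "a \<in> S" "b \<in> S" for a b
      unfolding mm by (rule free_alg_minus) (use that \<open>S \<subseteq> G\<close> in auto)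
    then show ?thesis by (intro equalityI subsetI; clarsimp; metis imageI)
  qed
  have b: "mon [a, b] \<ominus>\<^bsub>free_alg G\<^esub> scale c (mon [b, a]) = mon [a, b] - scale c (mon [b, a])"
    if "a \<in> G" "b \<in> G" for a b c
    using that by (intro free_alg_minus keys_words) auto
  have e: "mon [GE i, GF j] \<ominus>\<^bsub>free_alg G\<^esub> mon [GF j, GE i] \<ominus>\<^bsub>free_alg G\<^esub> scale c (mon [GK i] \<ominus>\<^bsub>free_alg G\<^esub> mon [GK' i])
     = mon [GE i, GF j] - mon [GF j, GE i] - scale c (mon [GK i] - mon [GK' i])" for i j c
    by (subst free_alg_minus, simp, simp)+ (rule free_alg_minus; intro keys_words; simp)
  have k: "inverse (vi d i) - vi d i = - kap i" for i by (simp add: kap_def)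
  show ?thesis
    unfolding U_hat_rels_def hat_rels_def
    by (subst comm, force, simp only: serre_free_alg mm mem, simp only: free_alg_simps gen_mon vi_s k e b mem)
qed

text \<open>Sorting the defining relations: those within \<open>E\<close>, \<open>K\<close> and
  within \<open>F\<close>, \<open>K'\<close>, including invertibility, are the images of the Borel
  relations under the two letter maps, and the rest are the cross relations.\<close>

lemma U_tilde_rels_eq: "U_tilde_rels (free_alg UNIV) C d = double_rels"
proof -
  have u: "gen a \<otimes>\<^bsub>free_alg UNIV\<^esub> gen b \<ominus>\<^bsub>free_alg UNIV\<^esub> \<one>\<^bsub>free_alg UNIV\<^esub> = mon [a, b] - 1" for a b :: "'i ugen"
    by (simp add: gen_mon mono_mult free_alg_minus)
  have im: "h ` {f i j | i j. P i j} = {h (f i j) | i j. P i j}" "h ` {g i | i. R i} = {h (g i) | i. R i}"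
    for h :: "'i word vec \<Rightarrow> 'i ugen list vec" and f :: "'i \<Rightarrow> 'i \<Rightarrow> _" and P and g :: "'i \<Rightarrow> _" and R
    by blast+
  have one: "lett (map t) 1 = 1" for t :: "'i bgen \<Rightarrow> 'i ugen"
    by (simp add: lett_linear flip: mono_Nil)
  have comm: "{mon [a, b] - mon [b, a] | a b. a \<in> range GK \<union> range GK' \<and> b \<in> range GK \<union> range GK'} =
      {mon [GK i, GK j] - mon [GK j, GK i] | i j. True} \<union> {mon [GK' i, GK' j] - mon [GK' j, GK' i] | i j. True}
    \<union> {mon [GK i, GK' j] - mon [GK' j, GK i] | i j. True}
    \<union> {mon [GK' i, GK j] - mon [GK j, GK' i] | i j. True}" (is "_ = ?R")
    by blast
  show ?thesis
    unfolding U_tilde_rels_def U_hat_rels_eq[OF subset_UNIV] u hat_rels_def comm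
      double_rels_def borel_rels_def torus_rels_def serre_rels_def cross_rels_def
    by (simp only: image_Un im lett_linear lett_srr sr_def list.map rpl.simps rml.simps one Un_ac)
qed

definition ucl :: "'i ugen list vec \<Rightarrow> 'i U" where "ucl = (+>\<^bsub>free_alg UNIV\<^esub>) JU"

sublocale U: word_quotient "U_tilde C d" JU ucl
  using presented_word_quotient[of double_rels] by (simp add: U_tilde_def U_tilde_rels_eq ucl_def)

lemma U_gen_ucl: "U_tilde_gen C d g = ucl (mon [g])"
  by (simp add: U_tilde_gen_def U_tilde_rels_eq presented_gen_cl ucl_def)

lemma ucl_eq: "ucl x = ucl y \<longleftrightarrow> cg JU x y"
  by (simp add: U.eq cg_def)

lemma B_elem_ucl: "B_elem C d \<tau> i = ucl (mon [GF i] + mon [GE (\<tau> i), GK' i])"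
  and k_elem_ucl: "k_elem C d \<tau> i = ucl (mon [GK i, GK' (\<tau> i)])"
  by (simp_all add: B_elem_def k_elem_def U_gen_ucl U.add U.mult mono_mult)

lemma k_inv_ucl: "inv\<^bsub>U_tilde C d\<^esub> (k_elem C d \<tau> i) = ucl (mon [GKinv i, GK'inv (\<tau> i)])"
proof -
  let ?K = "ucl (mon [GK i])" and ?K' = "ucl (mon [GK' (\<tau> i)])" and ?L = "ucl (mon [GKinv i])" and ?L' = "ucl (mon [GK'inv (\<tau> i)])"
  note m = U.m_assoc[OF U.cl_closed U.cl_closed U.cl_closed]
  have u: "?K \<otimes>\<^bsub>U_tilde C d\<^esub> ?L = \<one>\<^bsub>U_tilde C d\<^esub>" "?L \<otimes>\<^bsub>U_tilde C d\<^esub> ?K = \<one>\<^bsub>U_tilde C d\<^esub>"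
    "?K' \<otimes>\<^bsub>U_tilde C d\<^esub> ?L' = \<one>\<^bsub>U_tilde C d\<^esub>" "?L' \<otimes>\<^bsub>U_tilde C d\<^esub> ?K' = \<one>\<^bsub>U_tilde C d\<^esub>"
    "?L \<otimes>\<^bsub>U_tilde C d\<^esub> ?L' = ?L' \<otimes>\<^bsub>U_tilde C d\<^esub> ?L"
    unfolding U.mult U.one ucl_eq by (rule JUi kk_inv)+
  have "inv\<^bsub>U_tilde C d\<^esub> (?K \<otimes>\<^bsub>U_tilde C d\<^esub> ?K') = ?L' \<otimes>\<^bsub>U_tilde C d\<^esub> ?L"
  proof (rule U.inv_char)
    have "?K \<otimes>\<^bsub>U_tilde C d\<^esub> ?K' \<otimes>\<^bsub>U_tilde C d\<^esub> (?L' \<otimes>\<^bsub>U_tilde C d\<^esub> ?L) = ?K \<otimes>\<^bsub>U_tilde C d\<^esub> ((?K' \<otimes>\<^bsub>U_tilde C d\<^esub> ?L') \<otimes>\<^bsub>U_tilde C d\<^esub> ?L)"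
      by (simp only: U.m_assoc U.m_closed U.cl_closed)
    then show "?K \<otimes>\<^bsub>U_tilde C d\<^esub> ?K' \<otimes>\<^bsub>U_tilde C d\<^esub> (?L' \<otimes>\<^bsub>U_tilde C d\<^esub> ?L) = \<one>\<^bsub>U_tilde C d\<^esub>"
      by (simp add: u(1,3))
    have "?L' \<otimes>\<^bsub>U_tilde C d\<^esub> ?L \<otimes>\<^bsub>U_tilde C d\<^esub> (?K \<otimes>\<^bsub>U_tilde C d\<^esub> ?K') = ?L' \<otimes>\<^bsub>U_tilde C d\<^esub> ((?L \<otimes>\<^bsub>U_tilde C d\<^esub> ?K) \<otimes>\<^bsub>U_tilde C d\<^esub> ?K')"
      by (simp only: U.m_assoc U.m_closed U.cl_closed)
    then show "?L' \<otimes>\<^bsub>U_tilde C d\<^esub> ?L \<otimes>\<^bsub>U_tilde C d\<^esub> (?K \<otimes>\<^bsub>U_tilde C d\<^esub> ?K') = \<one>\<^bsub>U_tilde C d\<^esub>"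
      by (simp add: u(2,4))
  qed auto
  then show ?thesis unfolding u(5)[symmetric] by (simp add: k_elem_ucl U.mult mono_mult)
qed

text \<open>\<open>U_hat\<close> is presented on fewer letters, so its carrier is not the set of
  classes of all words as \<open>word_quotient\<close> demands. The few facts about it are obtained
  directly; the map to \<open>U_tilde\<close> exists because its ideal is contained in
  \<open>JU\<close>.\<close>

lemma U_hat_facts:
  shows "ring (U_hat C d)" "X \<in> carrier (U_hat C d) \<Longrightarrow> c \<odot>\<^bsub>U_hat C d\<^esub> X \<in> carrier (U_hat C d)"
    and "g \<in> U_hat_gens \<Longrightarrow> U_hat_gen C d g \<in> carrier (U_hat C d)"
    and "\<exists>f \<in> alg_hom (U_hat C d) (U_tilde C d). \<forall>g\<in>U_hat_gens. f (U_hat_gen C d g) = U_tilde_gen C d g"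
proof -
  let ?A = "free_alg U_hat_gens :: ('i ugen list \<Rightarrow>\<^sub>0 qfield) alg"
  define I where "I = genideal ?A hat_rels"
  define hcl where "hcl = (+>\<^bsub>?A\<^esub>) I"
  interpret A: ring ?A by (rule ring_free_alg)
  have K: "keys (srr q m a b) \<subseteq> lists U_hat_gens" if "a \<in> U_hat_gens" "b \<in> U_hat_gens" for q m and a b :: "'i ugen"
  proof -
    have "srr q m a b \<in> {x. keys x \<subseteq> lists U_hat_gens}"
      unfolding srr_def using that
      by (intro lsub_sum[OF lsub_keys] CollectI keys_words) auto
    then show ?thesis by simp
  qed
  have R: "hat_rels \<subseteq> carrier ?A"
    unfolding hat_rels_def free_alg_simps
    by (intro Un_least; rule subsetI; rule CollectI; elim CollectE exE conjE; hypsubst;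
        intro keys_words K; auto simp: U_hat_gens_def)
  have "hat_rels \<subseteq> double_rels"
    unfolding U_tilde_rels_eq[symmetric] U_tilde_rels_def U_hat_rels_eq[OF subset_UNIV] by blast
  then have sub: "I \<subseteq> JU"
    unfolding I_def using R by (intro genideal_subset_idl) (auto intro: idl_incl)
  interpret I: ideal I ?A unfolding I_def by (rule A.genideal_ideal[OF R])
  have Ic: "I \<subseteq> carrier ?A" using I.a_subset .
  have Il: "lsub scale I"
  proof -
    have "scale c x \<in> I" if "x \<in> I" for c x
      using I.I_l_closed[OF that, of "scale c 1"] keys_words(2)[OF keys_words(4), of c U_hat_gens]
      by (simp add: scale_mult del: scale_single)
    then show ?thesis using I.a_closed I.zero_closed by (auto simp: lsub_def)
  qed
  have Im: "\<forall>a\<in>I. \<forall>x\<in>carrier ?A. x \<otimes>\<^bsub>?A\<^esub> a \<in> I \<and> a \<otimes>\<^bsub>?A\<^esub> x \<in> I"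
    using I.I_l_closed I.I_r_closed by blast
  have Q: "U_hat C d = quot_alg ?A I"
    by (simp add: U_hat_def presented_alg_def U_hat_rels_eq I_def)
  note F = quot_monoid_alg[OF monoid_words[of U_hat_gens], of I, folded free_alg_def Q hcl_def, OF Ic Il Im]
  show "ring (U_hat C d)" by (rule F(2))
  show sm: "X \<in> carrier (U_hat C d) \<Longrightarrow> c \<odot>\<^bsub>U_hat C d\<^esub> X \<in> carrier (U_hat C d)" for X c
    unfolding F(3) by (auto intro!: imageI keys_words(2) simp: F(8) simp del: lists_eq_set)
  have g: "U_hat_gen C d g = hcl (mon [g])" for g
    by (simp add: U_hat_gen_def presented_gen_def U_hat_rels_eq gen_mon hcl_def I_def)
  have gc: "mon [g] \<in> carrier ?A" if "g \<in> U_hat_gens" for g using that by auto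
  show "g \<in> U_hat_gens \<Longrightarrow> U_hat_gen C d g \<in> carrier (U_hat C d)"
    unfolding g F(3) using gc by blast
  define f where "f X = ucl (SOME x. hcl x = X)" for X
  have f: "f (hcl x) = ucl x" for x
  proof -
    have "hcl (SOME y. hcl y = hcl x) = hcl x" by (rule someI[of "\<lambda>y. hcl y = hcl x" x]) simp
    then show ?thesis using sub unfolding f_def F(9) U.eq by blast
  qed
  have "f \<in> alg_hom (U_hat C d) (U_tilde C d)"
    unfolding alg_hom_def ring_hom_def F(3)
    by (auto simp: F(4) F(6) F(7) F(8) f U.add U.mult U.smult U.one simp del: free_alg_simps(1)) 
  then show "\<exists>f \<in> alg_hom (U_hat C d) (U_tilde C d). \<forall>g\<in>U_hat_gens. f (U_hat_gen C d g) = U_tilde_gen C d g"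
    by (intro bexI[of _ f]) (simp_all add: g f U_gen_ucl)
qed

lemma U_incl_image: "U_incl C d ` carrier (Ui_hat C d \<tau>) =
  subalg_gen (U_tilde C d) (range (B_elem C d \<tau>) \<union> range (k_elem C d \<tau>))"
proof -
  let ?f = "U_incl C d"
  have "?f \<in> alg_hom (U_hat C d) (U_tilde C d) \<and> (\<forall>g\<in>U_hat_gens. ?f (U_hat_gen C d g) = U_tilde_gen C d g)"
    using U_hat_facts(4) unfolding Bex_def U_incl_def by (rule someI_ex)
  then have f: "?f \<in> alg_hom (U_hat C d) (U_tilde C d)" and g: "\<And>g. g \<in> U_hat_gens \<Longrightarrow> ?f (U_hat_gen C d g) = U_tilde_gen C d g"
    by auto
  interpret A: ring "U_hat C d" by (rule U_hat_facts(1))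
  have [simp]: "GE i \<in> U_hat_gens" "GF i \<in> U_hat_gens" "GK i \<in> U_hat_gens" "GK' i \<in> U_hat_gens" for i :: 'i
    by (auto simp: U_hat_gens_def)
  note [simp] = U_hat_facts(3)
  have B: "?f (B_hat_elem C d \<tau> i) = B_elem C d \<tau> i" "?f (k_hat_elem C d \<tau> i) = k_elem C d \<tau> i" for i
    by (simp_all add: B_hat_elem_def B_elem_def k_hat_elem_def k_elem_def alg_homD[OF f] g)
  have "?f ` subalg_gen (U_hat C d) (range (B_hat_elem C d \<tau>) \<union> range (k_hat_elem C d \<tau>)) =
    subalg_gen (U_tilde C d) (?f ` (range (B_hat_elem C d \<tau>) \<union> range (k_hat_elem C d \<tau>)))"
    by (rule alg_hom_subalg_gen[OF f U_hat_facts(1,2)]) (auto simp: B_hat_elem_def k_hat_elem_def)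
  then show ?thesis by (simp add: Ui_hat_def subalg_def image_Un image_image B)
qed

section \<open>Images of the generated subalgebras\<close>

lemma STAR_words:
  assumes A: "range GH \<subseteq> A" and x: "keys x \<subseteq> lists A" and y: "keys y \<subseteq> lists A"
  shows "keys (STAR x y) \<subseteq> lists A"
proof -
  note L = lsub_keys[of "lists A"]
  have st: "star a b \<in> {x. keys x \<subseteq> lists A}" if "set a \<subseteq> A" "set b \<subseteq> A" for a b
    unfolding star_def
  proof (intro sw_closed lsub_add[OF L] lsub_scale[OF L])
    fix a1 a2 b1 b2 assume "(a1, a2) \<in> cops a" "(b1, b2) \<in> cops b"
    then have "set a2 \<subseteq> A" "set b1 \<subseteq> A" using cops_letters[of a1 a2 a] cops_letters[of b1 b2 b] that A by blast+
    then show "mon (a2 @ b1) \<in> {x. keys x \<subseteq> lists A}" by (auto split: if_splits)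
  qed
  have "STAR x y \<in> {x. keys x \<subseteq> lists A}"
    unfolding STAR_def using x y by (intro lsub_lin[OF L] st) auto
  then show ?thesis by simp
qed

text \<open>Applied to the full alphabet and to the one without inverses, which gives the images of
  the whole algebra and of its hat part. The forward inclusion is \<open>star_induct\<close>; for
  the converse, \<open>STAR_words\<close> keeps products within the alphabet.\<close>

lemma Phi_subalg:
  assumes A: "range GH \<subseteq> A"
    and fwd: "\<And>g. g \<in> A \<Longrightarrow> ucl (Phi (mon [g])) \<in> subalg_gen (U_tilde C d) S"
    and bwd: "\<And>Y. Y \<in> S \<Longrightarrow> \<exists>x. keys x \<subseteq> lists A \<and> Y = ucl (Phi x)"
  shows "(\<lambda>x. ucl (Phi x)) ` {x. keys x \<subseteq> lists A} = subalg_gen (U_tilde C d) S" (is "?L = ?R")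
proof
  let ?P = "{x. ucl (Phi x) \<in> ?R}"
  have P: "lsub scale ?P"
    using U.subalg_gen_lsub[of S] by (auto simp: lsub_def Phi_linear)
  have m: "ucl (Phi (STAR x y)) = ucl (Phi x) \<otimes>\<^bsub>U_tilde C d\<^esub> ucl (Phi y)" for x y
    unfolding U.mult ucl_eq by (rule Phi_STAR)
  show "?L \<subseteq> ?R"
  proof clarify
    have w: "mon w \<in> ?P" if "w \<in> lists A" for w
    proof (rule star_induct[OF A P])
      show "mon [] \<in> ?P" using subalg_gen.one[of "U_tilde C d"] by (simp add: Phi_linear Phw_letters U.one)
      show "STAR x (mon [g]) \<in> ?P" if "x \<in> ?P" "g \<in> A" for x g
        using that fwd by (auto simp: m intro: subalg_gen.mult)
    qed (use that in auto)
    fix x :: "'i word vec" assume "keys x \<subseteq> lists A"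
    then have "x \<in> ?P"
      by (induction rule: vec_induct_keys) (rule lsub_0[OF P], rule lsub_add[OF P], assumption+, rule lsub_scale[OF P], rule w)
    then show "ucl (Phi x) \<in> ?R" by simp
  qed
  show "?R \<subseteq> ?L"
  proof
    note L = lsub_keys[of "lists A"]
    fix Y assume "Y \<in> ?R"
    then show "Y \<in> ?L"
    proof induction
      case one
      have "\<one>\<^bsub>U_tilde C d\<^esub> = ucl (Phi (mon []))" by (simp add: Phi_linear Phw_letters U.one)
      then show ?case by (rule image_eqI) auto
    next
      case (incl Y) then show ?case using bwd by auto
    next
      case (add X Y)
      then obtain x y where xy: "X = ucl (Phi x)" "keys x \<subseteq> lists A" "Y = ucl (Phi y)" "keys y \<subseteq> lists A" by auto
      show ?case
        by (rule image_eqI[of _ _ "x + y"]) (use xy lsub_add[OF L, of x y] in \<open>auto simp: U.add Phi_linear\<close>)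
    next
      case (mult X Y)
      then obtain x y where xy: "X = ucl (Phi x)" "keys x \<subseteq> lists A" "Y = ucl (Phi y)" "keys y \<subseteq> lists A" by auto
      show ?case
        by (rule image_eqI[of _ _ "STAR x y"]) (use xy STAR_words[OF A, of x y] in \<open>auto simp: m\<close>)
    next
      case (smult X c)
      then obtain x where x: "X = ucl (Phi x)" "keys x \<subseteq> lists A" by auto
      show ?case
        by (rule image_eqI[of _ _ "scale c x"]) (use x keys_words(2)[of x A c] in \<open>simp_all add: U.smult Phi_linear\<close>)
    qed
  qed
qed

lemma Phi_gens: "ucl (Phi (mon [GTheta i])) = B_elem C d \<tau> i" "ucl (Phi (mon [GH i])) = k_elem C d \<tau> (\<tau> i)"
  "ucl (Phi (mon [GHinv i])) = vp (- s i (\<tau> i)) \<odot>\<^bsub>U_tilde C d\<^esub> inv\<^bsub>U_tilde C d\<^esub> (k_elem C d \<tau> (\<tau> i))"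
  unfolding Phi_linear(4) Phw_letters k_inv_ucl by (simp_all add: B_elem_ucl k_elem_ucl U.smult)

lemma Phi_image_tilde: "range (\<lambda>x. ucl (Phi x)) = carrier (Ui_tilde C d \<tau>)"
proof -
  let ?S = "range (B_elem C d \<tau>) \<union> range (k_elem C d \<tau>) \<union> range (\<lambda>i. inv\<^bsub>U_tilde C d\<^esub> (k_elem C d \<tau> i))"
  have "(\<lambda>x. ucl (Phi x)) ` {x. keys x \<subseteq> lists UNIV} = subalg_gen (U_tilde C d) ?S"
  proof (rule Phi_subalg)
    show "ucl (Phi (mon [g])) \<in> subalg_gen (U_tilde C d) ?S" for g
      by (cases g) (auto simp: Phi_gens simp del: Phi_linear intro!: subalg_gen.smult intro: subalg_gen.incl)
    fix Y assume "Y \<in> ?S"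
    then consider i where "Y = B_elem C d \<tau> i" | i where "Y = k_elem C d \<tau> i" | i where "Y = inv\<^bsub>U_tilde C d\<^esub> (k_elem C d \<tau> i)"
      by auto
    then have "\<exists>x. Y = ucl (Phi x)"
    proof cases
      case (1 i) then show ?thesis by (metis Phi_gens(1))
    next
      case (2 i) then show ?thesis using Phi_gens(2)[of "\<tau> i"] by (intro exI[of _ "mon [GH (\<tau> i)]"]) simp
    next
      case (3 i)
      \<comment> \<open>The scalar cancels the value of \<open>\<chi>\<close> on the inverse of
        \<open>h\<close> with index \<open>\<tau> i\<close>.\<close>
      have "ucl (Phi (scale (vp (s (\<tau> i) i)) (mon [GHinv (\<tau> i)]))) = Y"
        by (simp add: 3 k_inv_ucl Phi_linear Phw_letters del: scale_single)
      then show ?thesis by metis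
    qed
    then show "\<exists>x. keys x \<subseteq> lists UNIV \<and> Y = ucl (Phi x)" by auto
  qed auto
  then show ?thesis by (simp add: Ui_tilde_def subalg_def)
qed

lemma Phi_image_hat: "(\<lambda>x. ucl (Phi x)) ` {x. keys x \<subseteq> lists (range GTheta \<union> range GH)} =
  subalg_gen (U_tilde C d) (range (B_elem C d \<tau>) \<union> range (k_elem C d \<tau>))" (is "_ = subalg_gen _ ?S")
proof (rule Phi_subalg)
  show "ucl (Phi (mon [g])) \<in> subalg_gen (U_tilde C d) ?S" if "g \<in> range GTheta \<union> range GH" for g
    using that by (auto simp: Phi_gens intro: subalg_gen.incl)
  fix Y assume "Y \<in> ?S"
  then consider i where "Y = B_elem C d \<tau> i" | i where "Y = k_elem C d \<tau> i"
    by auto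
  then show "\<exists>x. keys x \<subseteq> lists (range GTheta \<union> range GH) \<and> Y = ucl (Phi x)"
  proof cases
    case (1 i) then show ?thesis by (intro exI[of _ "mon [GTheta i]"]) (auto simp: Phi_gens)
  next
    case (2 i) then show ?thesis by (intro exI[of _ "mon [GH (\<tau> i)]"]) (auto simp: Phi_gens)
  qed
qed auto

lemma carrier_Bi_hat: "carrier (Bi_hat C d \<tau>) = bcl ` {x. keys x \<subseteq> lists (range GTheta \<union> range GH)}"
  by (simp add: Bi_hat_def Bor_hat_def subalg_def image_Un image_image theta_bcl h_bcl flip: B.subalg_gen_letters)

definition PHI :: "'i B \<Rightarrow> 'i U" where "PHI X = ucl (Phi (B.rep X))"

lemma PHI_bcl: "PHI (bcl x) = ucl (Phi x)"
  unfolding PHI_def U.eq Phi_linear(5)[symmetric] by (rule Phi_J[OF B.rep_cl])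

lemma PHI_iso: "PHI \<in> alg_iso (Bi_tilde C d \<tau>) (Ui_tilde C d \<tau>)"
proof -
  have r: "ucl (Phi x) \<in> carrier (Ui_tilde C d \<tau>)" for x
    using Phi_image_tilde by blast
  have "bij_betw PHI (range bcl) (carrier (Ui_tilde C d \<tau>))"
    unfolding bij_betw_def
  proof
    show "inj_on PHI (range bcl)"
    proof (rule inj_onI, clarify)
      fix x y assume "PHI (bcl x) = PHI (bcl y)"
      then have "Phi (x - y) \<in> JU" by (simp add: PHI_bcl U.eq Phi_linear)
      then show "bcl x = bcl y" by (simp add: B.eq Phi_inj)
    qed
    show "PHI ` range bcl = carrier (Ui_tilde C d \<tau>)"
      by (simp add: image_image PHI_bcl Phi_image_tilde)
  qed
  moreover have "PHI (imult C d \<tau> (bcl x) (bcl y)) = PHI (bcl x) \<otimes>\<^bsub>U_tilde C d\<^esub> PHI (bcl y)" for x y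
    unfolding imult_bcl PHI_bcl U.mult ucl_eq by (rule Phi_STAR)
  moreover have "Phi 1 = 1" using Phi_linear(4)[of "[]"] by (simp add: Phw_letters mono_Nil)
  moreover have "PHI \<one>\<^bsub>Bor C d\<^esub> = \<one>\<^bsub>U_tilde C d\<^esub>" by (simp add: B.one U.one PHI_bcl \<open>Phi 1 = 1\<close>)
  ultimately show ?thesis
    using r by (auto simp: alg_iso_def alg_hom_def ring_iso_def ring_hom_def Bi_tilde_def Ui_tilde_def subalg_def
        B.carrier B.add B.smult PHI_bcl U.add U.smult Phi_linear)
qed

end

theorem theorem4p4:
  fixes C :: "'i::finite \<Rightarrow> 'i \<Rightarrow> int" and d :: "'i \<Rightarrow> nat" and \<tau> :: "'i \<Rightarrow> 'i"
  assumes "symmetrizable_gcm C d" and "quasi_split_satake C d \<tau>"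
  shows "\<exists>\<Phi> \<in> alg_iso (Bi_tilde C d \<tau>) (Ui_tilde C d \<tau>).
           (\<forall>i. \<Phi> (theta_elem C d i) = B_elem C d \<tau> i \<and> \<Phi> (h_elem C d i) = k_elem C d \<tau> (\<tau> i)) \<and>
           \<Phi> ` carrier (Bi_hat C d \<tau>) = U_incl C d ` carrier (Ui_hat C d \<tau>)"
proof -
  interpret satake C d \<tau> by unfold_locales (fact assms)+
  show ?thesis
    by (rule bexI[OF _ PHI_iso])
       (simp add: theta_bcl h_bcl PHI_bcl Phi_gens carrier_Bi_hat image_image Phi_image_hat U_incl_image)
qed

end
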